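(* Let $H$ be a nonnegative self-adjoint operator on a separable Hilbert space $\mathcal{H}$ and $P$ an orthogonal projection. Let $t\mapsto P(t)$ be a strongly continuous function, defined on a neighborhood of $0$, with values orthogonal projections on $\mathcal{H}$ and $P(0)=P$, such that $D[H^{1/2}P(t)]\supset D[H^{1/2}P]$ and $\lim_{t\to0}\|H^{1/2}P(t)v\|=\|H^{1/2}Pv\|$ for all $v\in D[H^{1/2}P]$. Assume $H_P$ is densely defined in $\mathcal{H}$, and assume moreover that $P$ and all $P(t)$ are of finite dimension. Then: (i) for every $f\in\mathcal{H}$ and $\varepsilon=\pm1$, as $n\to\infty$, $[P(1/n)e^{-i\varepsilon tH/n}P(1/n)]^nf$, $[P(1/n)e^{-i\varepsilon tH/n}]^nf$ and $[e^{-i\varepsilon tH/n}P(1/n)]^nf$ all converge to $e^{-i\varepsilon tH_P}Pf$ in the norm of $\mathcal{H}$, uniformly for $t$ in each compact interval contained in $\mathbb{R}\setminus\{0\}$; (ii) for $\varepsilon=\pm1$, as $n\to\infty$, $[P(t/n)e^{-i\varepsilon tH/n}P(t/n)]^n$, $[P(t/n)e^{-i\varepsilon tH/n}]^n$ and $[e^{-i\varepsilon tH/n}P(t/n)]^n$ all converge to $e^{-i\varepsilon tH_P}P$ strongly on $\mathcal{H}$, uniformly for $t$ in each compact interval of $\mathbb{R}$.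
   Context: $H_P:=(H^{1/2}P)^*(H^{1/2}P)$ is the self-adjoint operator associated with the closed quadratic form $u\mapsto\|H^{1/2}Pu\|^2$ on $D[H^{1/2}P]=\{u:Pu\in D[H^{1/2}]\}$; "$H_P$ densely defined" means $D[H^{1/2}P]$ is dense in $\mathcal{H}$. *)

theory Defs
  imports "HOL-Analysis.Analysis"
begin

text \<open>A complex Hilbert space is modelled as a real Hilbert space (real inner product =
  real part of the complex inner product, complete) together with a complex structure
  imult (multiplication by the imaginary unit), which is real-linear, squares to minus the
  identity and is orthogonal.\<close>

class complex_hilbert = real_inner + complete_space +
  fixes imult :: "'a \<Rightarrow> 'a"
  assumes imult_add: "imult (x + y) = imult x + imult y"
    and imult_scaleR: "imult (r *\<^sub>R x) = r *\<^sub>R imult x"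
    and imult_imult: "imult (imult x) = - x"
    and inner_imult: "inner (imult x) (imult y) = inner x y"

definition op_clinear :: "('a::complex_hilbert) set \<times> ('a \<Rightarrow> 'a) \<Rightarrow> bool" where
  "op_clinear A \<longleftrightarrow> subspace (fst A) \<and> (\<forall>x\<in>fst A. imult x \<in> fst A) \<and>
     (\<forall>x\<in>fst A. \<forall>y\<in>fst A. snd A (x + y) = snd A x + snd A y) \<and>
     (\<forall>x\<in>fst A. \<forall>r. snd A (r *\<^sub>R x) = r *\<^sub>R snd A x) \<and>
     (\<forall>x\<in>fst A. snd A (imult x) = imult (snd A x))"

text \<open>Self-adjointness: densely defined, the adjoint's domain equals the domain, and the
  adjoint agrees with the operator.  (For complex-linear operators on a complex subspace
  the real parts of the inner products determine the complex ones.)\<close>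

definition op_self_adjoint :: "('a::complex_hilbert) set \<times> ('a \<Rightarrow> 'a) \<Rightarrow> bool" where
  "op_self_adjoint A \<longleftrightarrow> op_clinear A \<and> closure (fst A) = UNIV \<and>
     fst A = {y. \<exists>z. \<forall>x\<in>fst A. inner (snd A x) y = inner x z} \<and>
     (\<forall>x\<in>fst A. \<forall>y\<in>fst A. inner (snd A x) y = inner x (snd A y))"

definition op_nonneg :: "('a::complex_hilbert) set \<times> ('a \<Rightarrow> 'a) \<Rightarrow> bool" where
  "op_nonneg A \<longleftrightarrow> (\<forall>x\<in>fst A. inner x (snd A x) \<ge> 0)"

definition orth_proj :: "('a::complex_hilbert \<Rightarrow> 'a) \<Rightarrow> bool" where
  "orth_proj P \<longleftrightarrow> bounded_linear P \<and> (\<forall>x. P (P x) = P x) \<and>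
     (\<forall>x y. inner (P x) y = inner x (P y)) \<and> (\<forall>x. P (imult x) = imult (P x))"

definition finite_rank :: "('a::complex_hilbert \<Rightarrow> 'a) \<Rightarrow> bool" where
  "finite_rank P \<longleftrightarrow> (\<exists>B. finite B \<and> range P \<subseteq> span B)"

definition op_sqrt :: "('a::complex_hilbert) set \<times> ('a \<Rightarrow> 'a) \<Rightarrow> 'a set \<times> ('a \<Rightarrow> 'a)" where
  "op_sqrt H = (THE R. op_self_adjoint R \<and> op_nonneg R \<and> (\<forall>x. x \<notin> fst R \<longrightarrow> snd R x = 0) \<and>
      fst H = {x \<in> fst R. snd R x \<in> fst R} \<and> (\<forall>x\<in>fst H. snd H x = snd R (snd R x)))"

text \<open>U is the unitary group e^(-itA), i.e. the strongly continuous unitary group with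
  generator -iA (Stone's theorem).\<close>

definition unitary_group_of :: "('a::complex_hilbert) set \<times> ('a \<Rightarrow> 'a) \<Rightarrow> (real \<Rightarrow> 'a \<Rightarrow> 'a) \<Rightarrow> bool" where
  "unitary_group_of A U \<longleftrightarrow>
     (\<forall>t. bounded_linear (U t)) \<and> (\<forall>t x. norm (U t x) = norm x) \<and>
     (\<forall>t x. U t (imult x) = imult (U t x)) \<and> U 0 = id \<and>
     (\<forall>s t. U (s + t) = U s \<circ> U t) \<and> (\<forall>x. continuous_on UNIV (\<lambda>t. U t x)) \<and>
     (\<forall>x. x \<in> fst A \<longleftrightarrow> (\<exists>y. ((\<lambda>s. (1 / s) *\<^sub>R (U s x - x)) \<longlongrightarrow> y) (at 0))) \<and>
     (\<forall>x\<in>fst A. ((\<lambda>s. (1 / s) *\<^sub>R (U s x - x)) \<longlongrightarrow> - imult (snd A x)) (at 0))"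

definition expmi :: "('a::complex_hilbert) set \<times> ('a \<Rightarrow> 'a) \<Rightarrow> real \<Rightarrow> 'a \<Rightarrow> 'a" where
  "expmi A t = (THE U. unitary_group_of A U) t"

text \<open>H_P: the self-adjoint operator associated with the closed quadratic form
  u \<mapsto> norm (H^(1/2) P u)^2 on D[H^(1/2)P] = {u. P u \<in> D[H^(1/2)]}.\<close>

definition form_dom :: "('a::complex_hilbert) set \<times> ('a \<Rightarrow> 'a) \<Rightarrow> ('a \<Rightarrow> 'a) \<Rightarrow> 'a set" where
  "form_dom H P = {u. P u \<in> fst (op_sqrt H)}"

definition op_HP :: "('a::complex_hilbert) set \<times> ('a \<Rightarrow> 'a) \<Rightarrow> ('a \<Rightarrow> 'a) \<Rightarrow> 'a set \<times> ('a \<Rightarrow> 'a)" where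
  "op_HP H P =
    (let S = snd (op_sqrt H); Q = form_dom H P;
         D = {u \<in> Q. \<exists>w. \<forall>v\<in>Q. inner (S (P u)) (S (P v)) = inner w v}
     in (D, \<lambda>u. if u \<in> D then (THE w. \<forall>v\<in>Q. inner (S (P u)) (S (P v)) = inner w v) else 0))"

end

theory Submission
  imports Defs
begin

text \<open>
  Since \<open>P\<close> has finite rank and \<open>D[H\<^sup>1\<^sup>/\<^sup>2P]\<close> is dense, \<open>D[H\<^sup>1\<^sup>/\<^sup>2P]\<close> is the whole space.  Hence every
  \<open>T(p) = H\<^sup>1\<^sup>/\<^sup>2P(p)\<close> is an everywhere defined closable operator, so it is bounded; by the uniform
  boundedness principle the bound is uniform for \<open>p\<close> near \<open>0\<close>, and weak convergence together with
  convergence of norms gives \<open>T(p) v \<rightarrow> T(0) v\<close>.  In form sense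
  \<open>P(p) (e\<^sup>-\<^sup>i\<^sup>\<tau>\<^sup>H - 1) P(p) \<approx> - i \<tau> T(p)\<^sup>* T(p)\<close>, so the contractions
  \<open>G(p, \<tau>) = 1 - P(p) + P(p) e\<^sup>-\<^sup>i\<^sup>\<tau>\<^sup>H P(p)\<close> satisfy \<open>G(p, \<tau>) g - e\<^sup>-\<^sup>i\<^sup>\<tau>\<^sup>H\<^sup>P g = o(\<tau>)\<close>, uniformly for \<open>g\<close> in
  compact orbits of \<open>e\<^sup>-\<^sup>i\<^sup>s\<^sup>H\<^sup>P\<close>.  Telescoping yields \<open>G(p, \<tau>)\<^sup>n f \<approx> e\<^sup>-\<^sup>i\<^sup>n\<^sup>\<tau>\<^sup>H\<^sup>P f\<close>, and the three products
  differ from \<open>G(p, \<tau>)\<^sup>n P(p)\<close> by \<open>o(1)\<close>.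

  The operators defined by definite descriptions exist and are unique: \<open>H\<^sup>1\<^sup>/\<^sup>2\<close> is obtained from bounded
  square roots of \<open>(1 + H)\<^sup>-\<^sup>1\<close> and its complement, and \<open>e\<^sup>-\<^sup>i\<^sup>t\<^sup>H\<close> by Yosida approximation.
\<close>

subsection \<open>Bounded operators on a Hilbert space\<close>

text \<open>The range of \<open>P\<close> lies in \<open>D[H^(1/2)]\<close> but not necessarily in
  \<open>D[H]\<close>, so \<open>e^(-i tau H)\<close> need not be norm differentiable on it; this is
  why only form estimates are available. The delicate step is
  \<open>T(p)* T(p) x \<rightarrow> T(0)* T(0) x\<close>: strong convergence of \<open>T(p)\<close>
  does not pass to adjoints. It is rescued by the identity \<open>T(p)* z = P(p) H^(1/2) z\<close>
  on the dense set \<open>D[H^(1/2)]\<close>, where strong continuity of \<open>P(p)\<close>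
  applies, and by the uniform bound, which extends the convergence to all vectors. The ranges of
  \<open>P(p)\<close> move with \<open>p\<close>, so compactness is not taken from one
  finite-dimensional range but from orbit segments of the limiting group. The parameters
  \<open>p\<close> and \<open>\<tau>\<close> stay independent throughout, so that one estimate
  serves both \<open>P(1/n)\<close> and \<open>P(t/n)\<close>, uniformly in
  \<open>t\<close>.\<close>

instance complex_hilbert \<subseteq> banach ..

text \<open>A sequence in \<open>V\<close> minimising the distance to a point \<open>x\<close>
  outside \<open>V\<close> is Cauchy by the parallelogram law; its limit \<open>l\<close> is a
  nearest point, and \<open>x - l\<close> is the required vector.\<close>

lemma closed_subspace_orthogonal_vector:
  fixes V :: "'a::{real_inner,banach} set"
  assumes V: "closed V" "subspace V" and "V \<noteq> UNIV"
  shows "\<exists>y. y \<noteq> 0 \<and> (\<forall>v\<in>V. inner v y = 0)"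
proof -
  obtain x where x: "x \<notin> V" using assms(3) by auto
  have ne: "V \<noteq> {}" using V(2) subspace_0 by auto
  define d where "d = infdist x V"
  have d_le: "d \<le> norm (x - v)" if "v \<in> V" for v
    using infdist_le[OF that, of x] by (simp add: d_def dist_norm)
  have d0: "0 \<le> d" by (simp add: d_def infdist_nonneg)
  have "\<exists>v\<in>V. norm (x - v) < d + 1 / Suc n" for n
  proof -
    have "(INF a\<in>V. dist x a) < d + 1 / Suc n"
      using ne by (simp add: d_def infdist_def)
    then obtain a where "a \<in> V" "dist x a < d + 1 / Suc n"
      by (subst (asm) cINF_less_iff) (use ne in auto)
    then show ?thesis by (auto simp: dist_norm)
  qed
  then obtain v where v: "\<And>n. v n \<in> V" "\<And>n. norm (x - v n) < d + 1 / Suc n" by metis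
  \<comment> \<open>The midpoint of \<open>v n\<close> and \<open>v m\<close> lies in
    \<open>V\<close>, hence at distance at least \<open>d\<close>. The parallelogram law then leaves
    \<open>4 (d + 1/N)^2 - 4 d^2 = 8 d/N + 4/N^2\<close>, rounded up to a single fraction.\<close>
  have par: "(norm (v n - v m))\<^sup>2 \<le> (8 * d + 8) / real N" if "n \<ge> N" "m \<ge> N" "N > 0" for n m N
  proof -
    have mid: "(1/2) *\<^sub>R (v n + v m) \<in> V"
      using v(1) V(2) by (simp add: subspace_add subspace_scale)
    have "(norm (v n - v m))\<^sup>2 = 2 * (norm (x - v n))\<^sup>2 + 2 * (norm (x - v m))\<^sup>2
        - 4 * (norm (x - (1/2) *\<^sub>R (v n + v m)))\<^sup>2"
      by (simp add: power2_norm_eq_inner inner_simps inner_commute field_simps)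
    also have "\<dots> \<le> 2 * (d + 1 / N)\<^sup>2 + 2 * (d + 1 / N)\<^sup>2 - 4 * d\<^sup>2"
    proof -
      have b: "norm (x - v k) \<le> d + 1 / N" if "k \<ge> N" for k
      proof -
        have "1 / real (Suc k) \<le> 1 / real N" using that \<open>N > 0\<close> by (simp add: frac_le)
        then show ?thesis using v(2)[of k] by linarith
      qed
      have "(norm (x - v n))\<^sup>2 \<le> (d + 1 / N)\<^sup>2" "(norm (x - v m))\<^sup>2 \<le> (d + 1 / N)\<^sup>2"
        using b that by (auto intro!: power_mono)
      moreover have "d\<^sup>2 \<le> (norm (x - (1/2) *\<^sub>R (v n + v m)))\<^sup>2"
        using d_le[OF mid] d0 by (auto intro!: power_mono)
      ultimately show ?thesis by linarith
    qed
    also have "\<dots> = 8 * d / N + 4 * (1/N * (1 / N))"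
      by (simp add: power2_eq_square algebra_simps add_divide_distrib)
    also have "\<dots> \<le> 8 * d / N + 8 * (1/N)"
    proof -
      have "1 / real N * (1 / N) \<le> 1 / N"
        using \<open>N > 0\<close> by (intro mult_left_le) auto
      moreover have "0 \<le> 1 / real N" by simp
      ultimately show ?thesis by linarith
    qed
    finally show ?thesis by (simp add: add_divide_distrib)
  qed
  have "Cauchy v"
  proof (rule metric_CauchyI)
    fix e :: real assume e: "e > 0"
    obtain N where N: "N > 0" "(8 * d + 8) / real N < e\<^sup>2"
    proof -
      obtain N :: nat where *: "(8 * d + 8) / e\<^sup>2 < real N" using reals_Archimedean2 by blast
      have "0 < (8 * d + 8) / e\<^sup>2" using d0 e by simp
      with * have "real N > 0" "8 * d + 8 < e\<^sup>2 * real N"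
        using e by (linarith, simp add: pos_divide_less_eq mult.commute)
      then show thesis by (intro that[of N]) (auto simp: pos_divide_less_eq)
    qed
    show "\<exists>M. \<forall>m\<ge>M. \<forall>n\<ge>M. dist (v m) (v n) < e"
    proof (intro exI[of _ N] allI impI)
      fix m n assume "m \<ge> N" "n \<ge> N"
      then have "(norm (v m - v n))\<^sup>2 < e\<^sup>2" using par[of N m n] N by linarith
      then show "dist (v m) (v n) < e"
        using e power2_less_imp_less[of "norm (v m - v n)" e] by (simp add: dist_norm)
    qed
  qed
  then obtain l where l: "v \<longlonglongrightarrow> l" unfolding Cauchy_convergent_iff convergent_def by blast
  have lV: "l \<in> V" by (rule closed_sequentially[OF V(1) _ l]) (rule v(1))
  have "norm (x - l) \<le> d"
  proof (rule LIMSEQ_le)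
    show "(\<lambda>n. norm (x - v n)) \<longlonglongrightarrow> norm (x - l)" by (intro tendsto_intros l)
    have "(\<lambda>n. d + 1 / Suc n) \<longlonglongrightarrow> d + 0"
      by (intro tendsto_intros LIMSEQ_Suc[OF lim_1_over_n])
    then show "(\<lambda>n. d + 1 / Suc n) \<longlonglongrightarrow> d" by simp
    show "\<exists>N. \<forall>n\<ge>N. norm (x - v n) \<le> d + 1 / real (Suc n)" using v(2) less_imp_le by blast
  qed
  then have nl: "norm (x - l) = d" using d_le[OF lV] by simp
  show ?thesis
  proof (intro exI[of _ "x - l"] conjI ballI)
    show "x - l \<noteq> 0" using x lV by auto
    fix u assume u: "u \<in> V"
    show "inner u (x - l) = 0"
    proof (cases "u = 0")
      case False
      \<comment> \<open>Among all multiples of \<open>u\<close>, \<open>r *\<^sub>R u\<close> is the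
        best approximation of \<open>x - l\<close>; minimality of \<open>l\<close> forces the gain
        \<open>r * inner u (x - l)\<close> to vanish.\<close>
      define r where "r = inner u (x - l) / inner u u"
      have "l + r *\<^sub>R u \<in> V" using u lV V(2) by (simp add: subspace_add subspace_scale)
      from d_le[OF this] have "(norm (x - l))\<^sup>2 \<le> (norm ((x - l) - r *\<^sub>R u))\<^sup>2"
        using nl d0 by (auto intro!: power_mono simp: algebra_simps)
      also have "\<dots> = (norm (x - l))\<^sup>2 - 2 * r * inner u (x - l) + r * (r * inner u u)"
        by (simp add: power2_norm_eq_inner inner_simps inner_commute algebra_simps)
      also have "r * inner u u = inner u (x - l)" using False by (simp add: r_def)
      finally have "r * inner u (x - l) \<le> 0" by simp
      then have "(inner u (x - l))\<^sup>2 / inner u u \<le> 0" by (simp add: r_def power2_eq_square)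
      moreover have "inner u u > 0" using False by simp
      ultimately have "(inner u (x - l))\<^sup>2 \<le> 0" by (simp add: pos_divide_le_eq)
      then show ?thesis by simp
    qed simp
  qed
qed

text \<open>A nonzero \<open>y\<close> orthogonal to the kernel represents \<open>f\<close> after
  scaling, because \<open>f y *\<^sub>R x - f x *\<^sub>R y\<close> always lies in the
  kernel.\<close>

lemma riesz_representation:
  fixes f :: "'a::{real_inner,banach} \<Rightarrow> real"
  assumes "bounded_linear f"
  shows "\<exists>z. \<forall>x. f x = inner z x"
proof (cases "\<forall>x. f x = 0")
  case True then show ?thesis by (intro exI[of _ 0]) simp
next
  case False
  interpret bounded_linear f by fact
  define V where "V = {x. f x = 0}"
  have cl: "closed V" unfolding V_def
    by (intro closed_Collect_eq continuous_intros) (use assms linear_continuous_on in auto)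
  have sub: "subspace V" by (auto simp: V_def subspace_def zero add scale)
  have "V \<noteq> UNIV" using False by (auto simp: V_def)
  from closed_subspace_orthogonal_vector[OF cl sub this]
  obtain y where y: "y \<noteq> 0" "\<And>v. v \<in> V \<Longrightarrow> inner v y = 0" by auto
  have "f x = inner ((f y / inner y y) *\<^sub>R y) x" for x
  proof -
    have "f y *\<^sub>R x - f x *\<^sub>R y \<in> V" by (simp add: V_def diff scale)
    then have "inner (f y *\<^sub>R x - f x *\<^sub>R y) y = 0" by (rule y)
    then show ?thesis using y(1) by (simp add: inner_simps inner_commute field_simps)
  qed
  then show ?thesis by blast
qed

text \<open>The usual discriminant argument for the form of \<open>A\<close>, except that the form
  may be degenerate: then the quadratic in \<open>r\<close> is affine, and nonnegativity kills its
  slope.\<close>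

lemma pos_form_cauchy_schwarz:
  fixes A :: "'a::real_inner \<Rightarrow> 'a"
  assumes "linear A" and sym: "\<And>x y. inner (A x) y = inner x (A y)" and pos: "\<And>x. 0 \<le> inner x (A x)"
  shows "(inner x (A y))\<^sup>2 \<le> inner x (A x) * inner y (A y)"
proof -
  interpret linear A by fact
  have q: "0 \<le> inner x (A x) + 2 * r * inner x (A y) + r\<^sup>2 * inner y (A y)" for r
  proof -
    have "inner y (A x) = inner x (A y)" using sym by (metis inner_commute)
    then have "inner (x + r *\<^sub>R y) (A (x + r *\<^sub>R y)) = inner x (A x) + 2 * r * inner x (A y) + r\<^sup>2 * inner y (A y)"
      by (simp add: add scale inner_simps power2_eq_square algebra_simps)
    then show ?thesis using pos[of "x + r *\<^sub>R y"] by simp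
  qed
  show ?thesis
  proof (cases "inner y (A y) = 0")
    case True
    have "inner x (A y) = 0"
    proof (rule ccontr)
      assume n: "inner x (A y) \<noteq> 0"
      \<comment> \<open>At this \<open>r\<close> the affine function takes the value
        \<open>-1\<close>.\<close>
      show False using q[of "- (inner x (A x) + 1) / (2 * inner x (A y))"] True n
        by (simp add: field_simps)
    qed
    then show ?thesis using True by simp
  next
    case False
    then have p: "inner y (A y) > 0" using pos[of y] by linarith
    have "0 \<le> inner y (A y) * (inner x (A x) + 2 * (- inner x (A y) / inner y (A y)) * inner x (A y)
        + (- inner x (A y) / inner y (A y))\<^sup>2 * inner y (A y))"
      using q[of "- inner x (A y) / inner y (A y)"] p by (intro mult_nonneg_nonneg) simp_all
    also have "\<dots> = inner x (A x) * inner y (A y) - (inner x (A y))\<^sup>2"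
      using p by (simp add: field_simps power2_eq_square)
    finally show ?thesis by simp
  qed
qed

lemma pos_form_zero:
  fixes A :: "'a::real_inner \<Rightarrow> 'a"
  assumes "linear A" and sym: "\<And>x y. inner (A x) y = inner x (A y)" and pos: "\<And>x. 0 \<le> inner x (A x)"
    and z: "inner x (A x) = 0"
  shows "A x = 0"
  using pos_form_cauchy_schwarz[OF assms(1-3), of "A x" x] z by simp

text \<open>The order interval \<open>0 \<le> A \<le> 1\<close>. It is invariant under
  \<open>A \<mapsto> 1 - A\<close>, so the resolvent \<open>(1 + H)\<^sup>-\<^sup>1\<close> and its
  complement can be treated alike.\<close>

definition pos_contraction :: "('a::real_inner \<Rightarrow> 'a) \<Rightarrow> bool" where
  "pos_contraction A \<longleftrightarrow> bounded_linear A \<and> (\<forall>x y. inner (A x) y = inner x (A y)) \<and>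
     (\<forall>x. 0 \<le> inner x (A x) \<and> inner x (A x) \<le> inner x x)"

lemma pos_contractionD:
  assumes "pos_contraction A"
  shows "bounded_linear A" "linear A" "inner (A x) y = inner x (A y)" "0 \<le> inner x (A x)"
    "inner x (A x) \<le> inner x x"
  using assms by (auto simp: pos_contraction_def bounded_linear.linear)

text \<open>Cauchy-Schwarz for the form of \<open>A\<close>, applied to \<open>A x\<close> and
  \<open>x\<close>, bounds the fourth power of \<open>norm (A x)\<close> by the product of the
  squares of \<open>norm (A x)\<close> and \<open>norm x\<close>.\<close>

lemma pos_contraction_norm_le:
  assumes A: "pos_contraction A"
  shows "norm (A x) \<le> norm x"
proof (cases "A x = 0")
  case False
  have "(inner (A x) (A x))\<^sup>2 \<le> inner (A x) (A (A x)) * inner x (A x)"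
    using A by (intro pos_form_cauchy_schwarz) (auto simp: pos_contractionD)
  also have "\<dots> \<le> inner (A x) (A x) * inner x x"
    by (intro mult_mono pos_contractionD(4,5)[OF A] inner_ge_zero)
  finally have "inner (A x) (A x) \<le> inner x x"
    using False by (simp add: power2_eq_square)
  then show ?thesis by (simp add: norm_le)
qed simp

lemma pos_contraction_complement:
  assumes A: "pos_contraction A"
  shows "pos_contraction (\<lambda>x. x - A x)"
proof -
  have "bounded_linear (\<lambda>x. x - A x)"
    using A by (intro bounded_linear_intros) (auto simp: pos_contractionD)
  then show ?thesis using A unfolding pos_contraction_def
    by (auto simp: inner_simps)
qed

text \<open>The square root of \<open>1 - X\<close> is \<open>1 - Y\<close> where \<open>Y\<close> is the limit of \<open>Y \<mapsto> (X + Y\<^sup>2) / 2\<close>;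
  convergence in norm is dominated by the same scalar iteration for \<open>X = 1\<close>.\<close>

theorem pos_contraction_sqrt:
  fixes A :: "'a::{real_inner,banach} \<Rightarrow> 'a"
  assumes A: "pos_contraction A"
  shows "\<exists>R. pos_contraction R \<and> (\<forall>x. R (R x) = A x) \<and>
    (\<forall>V. bounded_linear V \<longrightarrow> (\<forall>x. V (A x) = A (V x)) \<longrightarrow> (\<forall>x. V (R x) = R (V x)))"
proof -
  have pc: "pos_contraction (\<lambda>x. x - A x)" by (rule pos_contraction_complement[OF A])
  define X where "X = Blinfun (\<lambda>x. x - A x)"
  have X: "blinfun_apply X x = x - A x" for x
    by (simp add: X_def bounded_linear_Blinfun_apply pos_contractionD(1)[OF pc])
  have normX: "norm X \<le> 1"
    by (rule norm_blinfun_bound) (use pos_contraction_norm_le[OF pc] X in auto)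
  define Y where "Y = rec_nat (0::'a \<Rightarrow>\<^sub>L 'a) (\<lambda>_ Y. (1/2) *\<^sub>R (X + (Y o\<^sub>L Y)))"
  define y where "y = rec_nat (0::real) (\<lambda>_ y. (1 + y * y) / 2)"
  have Y: "Y 0 = 0" "Y (Suc n) = (1/2) *\<^sub>R (X + (Y n o\<^sub>L Y n))" for n by (simp_all add: Y_def)
  have y: "y 0 = 0" "y (Suc n) = (1 + y n * y n) / 2" for n by (simp_all add: y_def)
  have y01: "0 \<le> y n \<and> y n \<le> 1" for n
  proof (induction n)
    case (Suc n)
    then have "y n * y n \<le> 1" using mult_le_one by blast
    then show ?case by (simp add: y)
  qed (simp add: y)
  have yinc: "y n \<le> y (Suc n)" for n
    using sum_squares_ge_zero[of "1 - y n" 0] by (simp add: y algebra_simps)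
  have norm_comp: "norm (f o\<^sub>L g) \<le> norm f * norm g" for f g :: "'a \<Rightarrow>\<^sub>L 'a"
    by (rule norm_blinfun_compose)
  have nY: "norm (Y n) \<le> y n" for n
  proof (induction n)
    case (Suc n)
    have "norm (Y (Suc n)) \<le> (1/2) * (norm X + norm (Y n) * norm (Y n))"
      using norm_triangle_ineq[of X "Y n o\<^sub>L Y n"] norm_comp[of "Y n" "Y n"] by (simp add: Y)
    also have "\<dots> \<le> (1/2) * (1 + y n * y n)"
      using Suc normX y01[of n] mult_mono[OF Suc Suc] by (simp add: add_mono)
    finally show ?case by (simp add: y)
  qed (simp add: Y y)
  have dY: "norm (Y (Suc n) - Y n) \<le> y (Suc n) - y n" for n
  proof (induction n)
    case 0 show ?case using normX by (simp add: Y y)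
  next
    case (Suc n)
    define D where "D = Y (Suc n) - Y n"
    \<comment> \<open>The splitting \<open>B\<^sup>2 - C\<^sup>2 = B (B - C) + (B - C) C\<close>
      holds for noncommuting factors, and its scalar counterpart gives exactly the increment of
      \<open>y\<close>.\<close>
    have "Y (Suc (Suc n)) - Y (Suc n) = (1/2) *\<^sub>R ((Y (Suc n) o\<^sub>L D) + (D o\<^sub>L Y n))"
      unfolding Y(2)[of "Suc n"] by (subst (3) Y(2))
        (simp add: D_def scaleR_diff_right[symmetric] bounded_bilinear.diff_left[OF bounded_bilinear_blinfun_compose]
          bounded_bilinear.diff_right[OF bounded_bilinear_blinfun_compose])
    then have "norm (Y (Suc (Suc n)) - Y (Suc n)) = (1/2) * norm ((Y (Suc n) o\<^sub>L D) + (D o\<^sub>L Y n))"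
      by simp
    also have "\<dots> \<le> (1/2) * (norm (Y (Suc n)) * norm D + norm D * norm (Y n))"
      using norm_triangle_ineq[of "Y (Suc n) o\<^sub>L D" "D o\<^sub>L Y n"] norm_comp[of "Y (Suc n)" D]
        norm_comp[of D "Y n"]
      by (intro mult_left_mono) linarith+
    also have "\<dots> \<le> (1/2) * (y (Suc n) * (y (Suc n) - y n) + (y (Suc n) - y n) * y n)"
      using Suc[folded D_def] nY y01 yinc by (intro mult_left_mono add_mono mult_mono) auto
    also have "\<dots> = y (Suc (Suc n)) - y (Suc n)"
      unfolding y(2)[of "Suc n"] by (subst (5) y(2)) (simp add: algebra_simps)
    finally show ?case .
  qed
  \<comment> \<open>The scalar sequence is increasing and bounded by 1, so its increments form a
    convergent majorant for the increments of \<open>Y\<close>.\<close>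
  have "(\<lambda>n. y (Suc n) - y n) sums (lim y - y 0)"
  proof (rule telescope_sums)
    have "incseq y" using yinc by (simp add: incseq_SucI)
    then have "convergent y" using y01 incseq_convergent[of y 1] convergent_def by metis
    then show "y \<longlonglongrightarrow> lim y" by (simp add: convergent_LIMSEQ_iff)
  qed
  then have "summable (\<lambda>n. Y (Suc n) - Y n)"
    using dY by (intro summable_comparison_test[of "\<lambda>n. Y (Suc n) - Y n" "\<lambda>n. y (Suc n) - y n"])
      (auto simp: sums_iff)
  then obtain Z0 where "(\<lambda>n. Y (Suc n) - Y n) sums Z0" by (auto simp: summable_def)
  then have "(\<lambda>n. \<Sum>k<n. Y (Suc k) - Y k) \<longlonglongrightarrow> Z0" by (simp add: sums_def)
  moreover have "(\<Sum>k<n. Y (Suc k) - Y k) = Y n" for n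
    unfolding sum_lessThan_telescope by (simp add: Y(1))
  ultimately have lim: "Y \<longlonglongrightarrow> Z0" by simp
  have limx: "(\<lambda>n. Y n x) \<longlonglongrightarrow> Z0 x" for x
    by (intro tendsto_intros lim)
  have "(\<lambda>n. Y (Suc n)) \<longlonglongrightarrow> (1/2) *\<^sub>R (X + (Z0 o\<^sub>L Z0))"
    unfolding Y by (intro tendsto_intros lim bounded_bilinear.tendsto[OF bounded_bilinear_blinfun_compose])
  then have Z0: "Z0 = (1/2) *\<^sub>R (X + (Z0 o\<^sub>L Z0))"
    using LIMSEQ_unique LIMSEQ_Suc[OF lim] by blast
  have fixp: "Z0 x = (1/2) *\<^sub>R (x - A x + Z0 (Z0 x))" for x
    using arg_cong[OF Z0, of "\<lambda>B. blinfun_apply B x"] unfolding blinfun.bilinear_simps X by simp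
  have "norm Z0 \<le> 1"
    using y01 nY by (intro LIMSEQ_le_const2[OF tendsto_norm[OF lim]]) (meson order_trans)
  then have nZ: "norm (Z0 x) \<le> norm x" for x
    using norm_blinfun[of Z0 x] by (meson mult_left_le_one_le norm_ge_zero order_trans)
  have symY: "inner (Y n x) z = inner x (Y n z)" for n x z
  proof (induction n arbitrary: x z)
    case (Suc n)
    then show ?case using pos_contractionD(3)[OF A]
      by (simp add: Y blinfun.bilinear_simps X inner_simps)
  qed (simp add: Y)
  have symZ: "inner (Z0 x) z = inner x (Z0 z)" for x z
  proof (rule LIMSEQ_unique)
    show "(\<lambda>n. inner (Y n x) z) \<longlonglongrightarrow> inner (Z0 x) z" by (intro tendsto_intros limx)
    show "(\<lambda>n. inner (Y n x) z) \<longlonglongrightarrow> inner x (Z0 z)" unfolding symY by (intro tendsto_intros limx)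
  qed
  define R where "R x = x - Z0 x" for x
  \<comment> \<open>With \<open>X = 1 - A\<close>, the fixed point equation
    \<open>2 Z0 = X + Z0\<^sup>2\<close> is \<open>(1 - Z0)\<^sup>2 = 1 - X\<close>.\<close>
  have RR: "R (R x) = A x" for x
  proof -
    have "2 *\<^sub>R Z0 x = x - A x + Z0 (Z0 x)" by (subst fixp) simp
    then show ?thesis by (simp add: R_def blinfun.bilinear_simps scaleR_2 algebra_simps)
  qed
  have blR: "bounded_linear R" unfolding R_def by (intro bounded_linear_intros)
  have symR: "inner (R x) z = inner x (R z)" for x z by (simp add: R_def inner_simps symZ)
  have "pos_contraction R"
    unfolding pos_contraction_def
  proof (intro conjI allI blR symR)
    fix x
    have "inner x (Z0 x) \<le> norm x * norm x"
      using norm_cauchy_schwarz[of x "Z0 x"] nZ[of x] by (meson mult_left_mono norm_ge_zero order_trans)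
    then show "0 \<le> inner x (R x)" by (simp add: R_def inner_simps power2_norm_eq_inner[symmetric] power2_eq_square)
    have "inner (R x) (R x) \<le> inner x x" using RR pos_contractionD(5)[OF A, of x] by (simp add: symR)
    then have "norm (R x) \<le> norm x" by (simp add: norm_le)
    then show "inner x (R x) \<le> inner x x"
      using norm_cauchy_schwarz[of x "R x"]
      by (simp add: power2_norm_eq_inner[symmetric] power2_eq_square) (meson mult_left_mono norm_ge_zero order_trans)
  qed
  moreover have "V (R x) = R (V x)" if V: "bounded_linear V" and com: "\<And>x. V (A x) = A (V x)" for V x
  proof -
    interpret V: bounded_linear V by fact
    have "V (Y n x) = Y n (V x)" for n
      by (induction n arbitrary: x) (simp_all add: Y blinfun.bilinear_simps X V.add V.diff V.scaleR V.zero com)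
    then have "(\<lambda>n. Y n (V x)) \<longlonglongrightarrow> V (Z0 x)" using V.tendsto[OF limx, of x] by simp
    then have "V (Z0 x) = Z0 (V x)" by (rule LIMSEQ_unique[OF _ limx])
    then show ?thesis by (simp add: R_def V.diff)
  qed
  ultimately show ?thesis using RR by blast
qed

text \<open>For \<open>y = X x - Y x\<close> commutation gives
  \<open>(X + Y) y = X\<^sup>2 x - Y\<^sup>2 x = 0\<close>. Both forms then vanish at
  \<open>y\<close>, hence \<open>X y = Y y = 0\<close>, and the square norm of \<open>y\<close> is
  \<open>inner (X y - Y y) x\<close>.\<close>

lemma pos_sqrt_unique:
  fixes X Y :: "'a::real_inner \<Rightarrow> 'a"
  assumes X: "linear X" "\<And>x y. inner (X x) y = inner x (X y)" "\<And>x. 0 \<le> inner x (X x)"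
    and Y: "linear Y" "\<And>x y. inner (Y x) y = inner x (Y y)" "\<And>x. 0 \<le> inner x (Y x)"
    and com: "\<And>x. X (Y x) = Y (X x)" and sq: "\<And>x. X (X x) = Y (Y x)"
  shows "X x = Y x"
proof -
  interpret X: linear X by fact
  interpret Y: linear Y by fact
  define y where "y = X x - Y x"
  have "X y + Y y = 0" by (simp add: y_def X.diff Y.diff com sq)
  then have "inner y (X y) + inner y (Y y) = 0" by (metis inner_add_right inner_zero_right)
  then have "inner y (X y) = 0" "inner y (Y y) = 0" using X(3)[of y] Y(3)[of y] by linarith+
  then have "X y = 0" "Y y = 0" using pos_form_zero X Y by blast+
  then have "inner y y = 0"
    unfolding y_def by (metis X(2) Y(2) diff_self inner_commute inner_diff_right inner_zero_left)
  then show ?thesis by (simp add: y_def)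
qed

subsection \<open>Square roots of unbounded operators\<close>

lemma norm_imult [simp]: "norm (imult (x::'a::complex_hilbert)) = norm x"
  by (simp add: norm_eq_sqrt_inner inner_imult)

lemma bounded_linear_imult: "bounded_linear (imult :: 'a::complex_hilbert \<Rightarrow> 'a)"
  by (rule bounded_linear_intro[of _ 1]) (auto simp: imult_add imult_scaleR)

lemma inner_imult_swap: "inner (imult x) (y::'a::complex_hilbert) = - inner x (imult y)"
  using inner_imult[of x "imult y"] by (simp add: imult_imult)

lemma dense_inner_eq:
  fixes u v :: "'a::real_inner"
  assumes D: "closure D = UNIV" and eq: "\<And>x. x \<in> D \<Longrightarrow> inner x u = inner x v"
  shows "u = v"
proof -
  have "closed {x. inner x (u - v) = 0}"
    by (intro closed_Collect_eq continuous_intros)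
  moreover have "D \<subseteq> {x. inner x (u - v) = 0}" using eq by (auto simp: inner_diff_right)
  ultimately have "closure D \<subseteq> {x. inner x (u - v) = 0}" by (rule closure_minimal[rotated])
  then have "inner (u - v) (u - v) = 0" using D by blast
  then show ?thesis by simp
qed

lemma op_self_adjointD:
  fixes A :: "('a::complex_hilbert) set \<times> ('a \<Rightarrow> 'a)"
  assumes "op_self_adjoint A"
  shows "subspace (fst A)" "closure (fst A) = UNIV"
    "x \<in> fst A \<Longrightarrow> imult x \<in> fst A"
    "x \<in> fst A \<Longrightarrow> y \<in> fst A \<Longrightarrow> x + y \<in> fst A"
    "x \<in> fst A \<Longrightarrow> y \<in> fst A \<Longrightarrow> x - y \<in> fst A"
    "x \<in> fst A \<Longrightarrow> r *\<^sub>R x \<in> fst A"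
    "x \<in> fst A \<Longrightarrow> y \<in> fst A \<Longrightarrow> snd A (x + y) = snd A x + snd A y"
    "x \<in> fst A \<Longrightarrow> snd A (r *\<^sub>R x) = r *\<^sub>R snd A x"
    "x \<in> fst A \<Longrightarrow> snd A (imult x) = imult (snd A x)"
    "x \<in> fst A \<Longrightarrow> y \<in> fst A \<Longrightarrow> inner (snd A x) y = inner x (snd A y)"
  using assms unfolding op_self_adjoint_def op_clinear_def
  by (auto simp: subspace_add subspace_diff subspace_scale)

lemma op_self_adjoint_diff:
  fixes A :: "('a::complex_hilbert) set \<times> ('a \<Rightarrow> 'a)"
  assumes A: "op_self_adjoint A" and "x \<in> fst A" "y \<in> fst A"
  shows "snd A (x - y) = snd A x - snd A y"
  using op_self_adjointD(7)[OF A, of x "(-1) *\<^sub>R y"] op_self_adjointD(6,8)[OF A, of y "-1"] assms by simp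

text \<open>The standard way of proving membership in a domain here: it suffices to exhibit a
  candidate \<open>z\<close> for the value.\<close>

lemma op_self_adjoint_adjI:
  fixes A :: "('a::complex_hilbert) set \<times> ('a \<Rightarrow> 'a)"
  assumes A: "op_self_adjoint A" and eq: "\<And>x. x \<in> fst A \<Longrightarrow> inner (snd A x) y = inner x z"
  shows "y \<in> fst A" "snd A y = z"
proof -
  have fA: "fst A = {y. \<exists>z. \<forall>x\<in>fst A. inner (snd A x) y = inner x z}"
    using A by (simp add: op_self_adjoint_def)
  show y: "y \<in> fst A" by (subst fA) (use eq in auto)
  show "snd A y = z"
    by (rule dense_inner_eq[OF op_self_adjointD(2)[OF A]])
      (use eq op_self_adjointD(10)[OF A _ y] in simp)
qed

lemma op_self_adjointI:
  fixes A :: "('a::complex_hilbert) set \<times> ('a \<Rightarrow> 'a)"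
  assumes "op_clinear A" "closure (fst A) = UNIV"
    and sym: "\<And>x y. x \<in> fst A \<Longrightarrow> y \<in> fst A \<Longrightarrow> inner (snd A x) y = inner x (snd A y)"
    and adj: "\<And>y z. (\<And>x. x \<in> fst A \<Longrightarrow> inner (snd A x) y = inner x z) \<Longrightarrow> y \<in> fst A"
  shows "op_self_adjoint A"
  unfolding op_self_adjoint_def using assms by blast

text \<open>Since \<open>A \<ge> 0\<close>, the operator \<open>L = 1 + a A\<close> satisfies
  \<open>norm x \<le> norm (L x)\<close>, so it is injective, and its range is closed because
  \<open>A\<close> is closed. A vector orthogonal to the range would be an eigenvector of
  \<open>A\<close> for \<open>- 1/a\<close>, which nonnegativity excludes.\<close>

lemma nonneg_resolvent:
  fixes A :: "('a::complex_hilbert) set \<times> ('a \<Rightarrow> 'a)"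
  assumes A: "op_self_adjoint A" and pos: "op_nonneg A" and a: "a > 0"
  obtains R where "pos_contraction R" "\<And>y. R y \<in> fst A" "\<And>y. R y + a *\<^sub>R snd A (R y) = y"
    "\<And>x. x \<in> fst A \<Longrightarrow> R (x + a *\<^sub>R snd A x) = x"
proof -
  define L where "L x = x + a *\<^sub>R snd A x" for x
  note D = op_self_adjointD[OF A]
  have inner_L: "inner x x \<le> inner x (L x)" if "x \<in> fst A" for x
    using pos that a by (simp add: L_def inner_add_right op_nonneg_def)
  have norm_L: "norm x \<le> norm (L x)" if "x \<in> fst A" for x
  proof (cases "x = 0")
    case False
    have "norm x * norm x \<le> norm x * norm (L x)"
      using inner_L[OF that] norm_cauchy_schwarz[of x "L x"]
      by (simp add: power2_norm_eq_inner[symmetric] power2_eq_square)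
    then show ?thesis using False by simp
  qed simp
  have L_add: "L (x + y) = L x + L y" if "x \<in> fst A" "y \<in> fst A" for x y
    using that by (simp add: L_def D algebra_simps)
  have L_diff: "L (x - y) = L x - L y" if "x \<in> fst A" "y \<in> fst A" for x y
    using that by (simp add: L_def op_self_adjoint_diff[OF A] algebra_simps)
  have L_scale: "L (r *\<^sub>R x) = r *\<^sub>R L x" if "x \<in> fst A" for r x
    using that by (simp add: L_def D algebra_simps)
  have L_inj: "x = y" if "x \<in> fst A" "y \<in> fst A" "L x = L y" for x y
    using norm_L[of "x - y"] that by (simp add: D L_diff)
  have sub: "subspace (L ` fst A)"
  proof (rule subspaceI)
    have "0 \<in> fst A" "L 0 = 0" using subspace_0[OF D(1)] L_scale[of 0 0] by auto
    then show "0 \<in> L ` fst A" by force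
    show "x + y \<in> L ` fst A" if "x \<in> L ` fst A" "y \<in> L ` fst A" for x y
      using that by (auto simp: L_add[symmetric] D)
    show "r *\<^sub>R x \<in> L ` fst A" if "x \<in> L ` fst A" for r x
      using that by (auto simp: L_scale[symmetric] D)
  qed
  have cl: "closed (L ` fst A)"
    unfolding closed_sequential_limits
  proof (intro allI impI, elim conjE)
    fix Y l assume Y: "\<forall>n. Y n \<in> L ` fst A" and l: "Y \<longlonglongrightarrow> l"
    from Y have "\<forall>n. \<exists>x. x \<in> fst A \<and> Y n = L x" by auto
    from choice[OF this] obtain X where X: "\<And>n. X n \<in> fst A" "\<And>n. Y n = L (X n)" by auto
    have dXY: "dist (X m) (X n) \<le> dist (Y m) (Y n)" for m n
      using norm_L[of "X m - X n"] X by (simp add: D L_diff dist_norm)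
    have CY: "Cauchy Y" by (rule LIMSEQ_imp_Cauchy[OF l])
    have "Cauchy X"
    proof (rule metric_CauchyI)
      fix e :: real assume "e > 0"
      from metric_CauchyD[OF CY this] obtain M where "\<forall>m\<ge>M. \<forall>n\<ge>M. dist (Y m) (Y n) < e" by auto
      then have "\<forall>m\<ge>M. \<forall>n\<ge>M. dist (X m) (X n) < e" using le_less_trans[OF dXY] by auto
      then show "\<exists>M. \<forall>m\<ge>M. \<forall>n\<ge>M. dist (X m) (X n) < e" by blast
    qed
    then obtain x where x: "X \<longlonglongrightarrow> x" unfolding Cauchy_convergent_iff convergent_def by blast
    \<comment> \<open>Closedness of \<open>A\<close>: the adjoint relation survives the limit, and
      self-adjointness puts the limit point back in the domain.\<close>
    have eq: "inner (snd A u) x = inner u ((1/a) *\<^sub>R (l - x))" if u: "u \<in> fst A" for u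
    proof (rule LIMSEQ_unique)
      show "(\<lambda>n. inner (snd A u) (X n)) \<longlonglongrightarrow> inner (snd A u) x" by (intro tendsto_intros x)
      have AX: "inner (snd A u) (X n) = inner u ((1/a) *\<^sub>R (Y n - X n))" for n
        using u X a by (simp add: D L_def)
      show "(\<lambda>n. inner (snd A u) (X n)) \<longlonglongrightarrow> inner u ((1/a) *\<^sub>R (l - x))"
        unfolding AX by (intro tendsto_intros x l)
    qed
    have "x \<in> fst A" "snd A x = (1/a) *\<^sub>R (l - x)"
      using op_self_adjoint_adjI[OF A eq] by auto
    then have "L x = l" "x \<in> fst A" using a by (auto simp: L_def)
    then show "l \<in> L ` fst A" by blast
  qed
  have surj: "L ` fst A = UNIV"
  proof (rule ccontr)
    assume "L ` fst A \<noteq> UNIV"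
    from closed_subspace_orthogonal_vector[OF cl sub this]
    obtain y where y: "y \<noteq> 0" "\<And>x. x \<in> fst A \<Longrightarrow> inner (L x) y = 0" by auto
    have eq: "inner (snd A x) y = inner x ((- 1/a) *\<^sub>R y)" if "x \<in> fst A" for x
      using y(2)[OF that] a by (simp add: L_def inner_add_left field_simps)
    note yA = op_self_adjoint_adjI[OF A eq]
    have "inner y (snd A y) \<ge> 0" using pos yA(1) by (simp add: op_nonneg_def)
    moreover have "inner y (snd A y) = - (inner y y / a)" by (simp add: yA(2))
    moreover have "inner y y / a > 0" using y(1) a by simp
    ultimately show False by linarith
  qed
  define R where "R y = (SOME x. x \<in> fst A \<and> L x = y)" for y
  have R: "R y \<in> fst A \<and> L (R y) = y" for y
  proof -
    have "y \<in> L ` fst A" by (simp add: surj)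
    then show ?thesis unfolding R_def by (intro someI_ex[of "\<lambda>x. x \<in> fst A \<and> L x = y"]) auto
  qed
  have R_eq: "R y = x" if "x \<in> fst A" "L x = y" for x y using R[of y] that L_inj by auto
  have nR: "norm (R y) \<le> norm y" for y using norm_L[of "R y"] R[of y] by simp
  have bl: "bounded_linear R"
  proof (rule bounded_linear_intro[of _ 1])
    show "R (x + y) = R x + R y" for x y by (rule R_eq) (use R in \<open>auto simp: D L_add\<close>)
    show "R (r *\<^sub>R x) = r *\<^sub>R R x" for r x by (rule R_eq) (use R in \<open>auto simp: D L_scale\<close>)
  qed (use nR in simp)
  have sym: "inner (R x) y = inner x (R y)" for x y
  proof -
    have "inner (R x) y = inner (R x) (L (R y))" using R by simp
    also have "\<dots> = inner (L (R x)) (R y)"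
      unfolding L_def inner_add_left inner_add_right using D(10)[of "R x" "R y"] R by simp
    finally show ?thesis using R by simp
  qed
  have "pos_contraction R"
    unfolding pos_contraction_def
  proof (intro conjI allI bl sym)
    fix x
    have "inner x (R x) \<ge> inner (R x) (R x)" using inner_L[of "R x"] R[of x] by (simp add: inner_commute)
    then show "0 \<le> inner x (R x)" using inner_ge_zero[of "R x"] by linarith
    show "inner x (R x) \<le> inner x x"
      using norm_cauchy_schwarz[of x "R x"] mult_left_mono[OF nR[of x], of "norm x"]
      by (simp add: power2_norm_eq_inner[symmetric] power2_eq_square)
  qed
  then show thesis using that R R_eq unfolding L_def by blast
qed

definition op_commutes :: "('a \<Rightarrow> 'a) \<Rightarrow> 'a set \<times> ('a \<Rightarrow> 'a) \<Rightarrow> bool" where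
  "op_commutes V A \<longleftrightarrow> (\<forall>x\<in>fst A. V x \<in> fst A \<and> snd A (V x) = V (snd A x))"

lemma op_commutes_resolvent:
  assumes V: "op_commutes V A" "bounded_linear V"
    and R: "\<And>y. R y \<in> fst A" "\<And>y. R y + a *\<^sub>R snd A (R y) = y"
      "\<And>x. x \<in> fst A \<Longrightarrow> R (x + a *\<^sub>R snd A x) = x"
  shows "V (R y) = R (V y)"
proof -
  interpret V: bounded_linear V by fact
  have VR: "V (R y) \<in> fst A" "snd A (V (R y)) = V (snd A (R y))"
    using V(1) R(1) by (auto simp: op_commutes_def)
  have "V y = V (R y + a *\<^sub>R snd A (R y))" by (simp add: R(2))
  also have "\<dots> = V (R y) + a *\<^sub>R snd A (V (R y))" by (simp add: V.add V.scaleR VR)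
  finally show ?thesis using R(3)[OF VR(1)] by simp
qed

text \<open>The condition inside the description \<open>op_sqrt\<close>. Prescribing the value 0 off
  the domain makes uniqueness an equality of pairs rather than merely of operators on their
  domain.\<close>

abbreviation is_op_sqrt :: "('a::complex_hilbert) set \<times> ('a \<Rightarrow> 'a) \<Rightarrow> 'a set \<times> ('a \<Rightarrow> 'a) \<Rightarrow> bool" where
  "is_op_sqrt H R \<equiv> op_self_adjoint R \<and> op_nonneg R \<and> (\<forall>x. x \<notin> fst R \<longrightarrow> snd R x = 0) \<and>
      fst H = {x \<in> fst R. snd R x \<in> fst R} \<and> (\<forall>x\<in>fst H. snd H x = snd R (snd R x))"

text \<open>With \<open>B = (1 + H)\<^sup>-\<^sup>1\<close>, \<open>b = B\<^sup>1\<^sup>/\<^sup>2\<close> and \<open>c = (1 - B)\<^sup>1\<^sup>/\<^sup>2\<close>, the square root of \<open>H\<close> is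
  \<open>c b\<^sup>-\<^sup>1\<close>.  A second square root \<open>R\<close> agrees with it on the core \<open>D(H)\<close>, because \<open>R B\<close> and \<open>b c\<close> are
  commuting positive square roots of \<open>B (1 - B)\<close>.\<close>

theorem op_sqrt_main:
  fixes H :: "('a::complex_hilbert) set \<times> ('a \<Rightarrow> 'a)"
  assumes H: "op_self_adjoint H" and pos: "op_nonneg H"
  shows op_sqrt_is_sqrt: "is_op_sqrt H (op_sqrt H)"
    and op_sqrt_core: "x \<in> fst (op_sqrt H) \<Longrightarrow>
      \<exists>u. (\<forall>n::nat. u n \<in> fst H) \<and> u \<longlonglongrightarrow> x \<and> (\<lambda>n. snd (op_sqrt H) (u n)) \<longlonglongrightarrow> snd (op_sqrt H) x"
    and op_sqrt_commutes: "bounded_linear V \<Longrightarrow> op_commutes V H \<Longrightarrow> op_commutes V (op_sqrt H)"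
proof -
  obtain B where B: "pos_contraction B" "\<And>y. B y \<in> fst H" "\<And>y. B y + 1 *\<^sub>R snd H (B y) = y"
    "\<And>x. x \<in> fst H \<Longrightarrow> B (x + 1 *\<^sub>R snd H x) = x"
    using nonneg_resolvent[OF H pos zero_less_one] by blast
  have HB: "snd H (B y) = y - B y" for y using B(3)[of y] by (simp add: algebra_simps)
  have BH: "B (snd H x) = x - B x" if "x \<in> fst H" for x
    using B(4)[OF that] bounded_linear.linear[OF pos_contractionD(1)[OF B(1)]]
    by (simp add: linear_add algebra_simps)
  obtain b where b: "pos_contraction b" "\<And>x. b (b x) = B x"
    "\<And>V x. bounded_linear V \<Longrightarrow> (\<And>x. V (B x) = B (V x)) \<Longrightarrow> V (b x) = b (V x)"
    using pos_contraction_sqrt[OF B(1)] by blast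
  obtain c where c: "pos_contraction c" "\<And>x. c (c x) = x - B x"
    "\<And>V x. bounded_linear V \<Longrightarrow> (\<And>x. V (x - B x) = V x - B (V x)) \<Longrightarrow> V (c x) = c (V x)"
    using pos_contraction_sqrt[OF pos_contraction_complement[OF B(1)]] by blast
  interpret Bl: bounded_linear B by (rule pos_contractionD(1)[OF B(1)])
  interpret bl: bounded_linear b by (rule pos_contractionD(1)[OF b(1)])
  interpret cl: bounded_linear c by (rule pos_contractionD(1)[OF c(1)])
  have commc: "V (c x) = c (V x)" if V: "bounded_linear V" and "\<And>x. V (B x) = B (V x)" for V x
    by (rule c(3)[OF V]) (simp add: linear_diff[OF bounded_linear.linear[OF V]] that)
  have bc: "b (c x) = c (b x)" for x
    by (rule commc[OF bl.bounded_linear_axioms]) (simp add: b(2)[symmetric])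
  \<comment> \<open>Positivity of \<open>b c\<close> is read off from a further square root
    \<open>r\<close> of \<open>b\<close>: as \<open>r\<close> commutes with \<open>c\<close>, the
    form of \<open>b c\<close> at \<open>x\<close> is that of \<open>c\<close> at
    \<open>r x\<close>.\<close>
  obtain r where r: "pos_contraction r" "\<And>x. r (r x) = b x"
    "\<And>V x. bounded_linear V \<Longrightarrow> (\<And>x. V (b x) = b (V x)) \<Longrightarrow> V (r x) = r (V x)"
    using pos_contraction_sqrt[OF b(1)] by blast
  have bsym: "inner (b x) y = inner x (b y)" for x y by (rule pos_contractionD(3)[OF b(1)])
  have csym: "inner (c x) y = inner x (c y)" for x y by (rule pos_contractionD(3)[OF c(1)])
  have bc_pos: "0 \<le> inner (b x) (c x)" for x
  proof -
    have "inner (b x) (c x) = inner (r (r x)) (c x)" by (simp add: r(2))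
    also have "\<dots> = inner (r x) (r (c x))" by (rule pos_contractionD(3)[OF r(1)])
    also have "\<dots> = inner (r x) (c (r x))"
      using r(3)[OF cl.bounded_linear_axioms, of x] bc by simp
    finally show ?thesis using pos_contractionD(4)[OF c(1)] by simp
  qed
  have b_inj: "x = y" if "b x = b y" for x y
  proof -
    have "B (x - y) = 0" by (metis b(2) bl.diff bl.zero that cancel_comm_monoid_add_class.diff_cancel)
    then show ?thesis using HB[of "x - y"] HB[of 0] Bl.zero by simp
  qed
  have sq1: "b (b x) + c (c x) = x" for x by (simp add: b(2) c(2))
  define S where "S = (range b, \<lambda>x. if x \<in> range b then c (inv b x) else 0)"
  have "inj b" using b_inj by (simp add: inj_def)
  then have Sb: "snd S (b x) = c x" for x by (simp add: S_def)
  have fS: "fst S = range b" by (simp add: S_def)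
  have D_eq: "fst H = range B" using B(2,4) by (metis equalityI image_subset_iff rangeI subsetI)
  have D_sub: "range B \<subseteq> range b" using b(2) by (metis image_subset_iff rangeI)
  have dense: "closure (range b) = UNIV"
    using closure_mono[OF D_sub] op_self_adjointD(2)[OF H] D_eq by auto
  have b_imult: "b (imult x) = imult (b x)" and c_imult: "c (imult x) = imult (c x)" for x
  proof -
    have "imult (B y) = B (imult y)" for y
      by (rule op_commutes_resolvent[OF _ bounded_linear_imult B(2-4)])
        (use op_self_adjointD[OF H] in \<open>auto simp: op_commutes_def\<close>)
    then show "b (imult x) = imult (b x)" "c (imult x) = imult (c x)"
      using b(3)[OF bounded_linear_imult, of x] commc[OF bounded_linear_imult, of x] by auto
  qed
  have "op_self_adjoint S"
  proof (rule op_self_adjointI)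
    have "subspace (range b)"
      using linear_subspace_image[OF bl.linear_axioms subspace_UNIV] by simp
    then show "op_clinear S" unfolding op_clinear_def fS
      by (auto simp: Sb bl.add[symmetric] bl.scaleR[symmetric] b_imult[symmetric] cl.add cl.scaleR c_imult)
    show "closure (fst S) = UNIV" using dense fS by simp
    show "inner (snd S x) y = inner x (snd S y)" if "x \<in> fst S" "y \<in> fst S" for x y
      using that by (auto simp: fS Sb) (metis bc bsym csym)
    fix y z assume *: "\<And>x. x \<in> fst S \<Longrightarrow> inner (snd S x) y = inner x z"
    have "inner x (c y) = inner x (b z)" for x
      using *[of "b x"] by (simp add: fS Sb bsym csym)
    then have "c y = b z" by (rule dense_inner_eq[of UNIV, rotated]) simp
    \<comment> \<open>From \<open>b\<^sup>2 + c\<^sup>2 = 1\<close> and \<open>c y = b z\<close>: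
      \<open>y = b (b y) + c (b z)\<close>, and \<open>c\<close> commutes with
      \<open>b\<close>.\<close>
    then have "y = b (b y + c z)" using sq1[of y] by (simp add: bl.add bc)
    then show "y \<in> fst S" unfolding fS by blast
  qed
  note Ssa = this
  moreover have "op_nonneg S" using bc_pos by (auto simp: op_nonneg_def fS Sb)
  moreover have "\<forall>x. x \<notin> fst S \<longrightarrow> snd S x = 0" by (simp add: S_def)
  moreover have "fst H = {x \<in> fst S. snd S x \<in> fst S}"
  proof (intro set_eqI iffI)
    fix x assume "x \<in> fst H"
    then obtain y where "x = b (b y)" using D_eq b(2) by auto
    then show "x \<in> {x \<in> fst S. snd S x \<in> fst S}" by (simp add: fS Sb) (simp add: bc[symmetric])
  next
    fix x assume "x \<in> {x \<in> fst S. snd S x \<in> fst S}"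
    then obtain u y where "x = b u" "c u = b y" by (auto simp: fS Sb)
    then have "u = b (b u + c y)" using sq1[of u] by (simp add: bl.add bc)
    then have "x = B (b u + c y)" using \<open>x = b u\<close> b(2) by metis
    then show "x \<in> fst H" using D_eq by blast
  qed
  moreover have "\<forall>x\<in>fst H. snd H x = snd S (snd S x)"
  proof
    fix x assume "x \<in> fst H"
    then obtain y where y: "x = B y" using D_eq by auto
    have "snd S (snd S (b (b y))) = c (c y)" by (simp add: Sb bc[symmetric])
    then show "snd H x = snd S (snd S x)" by (simp add: y HB c(2) b(2))
  qed
  ultimately have S: "is_op_sqrt H S" by blast
  \<comment> \<open>\<open>D(H)\<close> is the image under \<open>b\<close> of the dense set
    \<open>range b\<close>, and \<open>S b = c\<close> is bounded, so convergence of preimages gives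
    convergence in the graph of \<open>S\<close>.\<close>
  have core: "\<exists>u. (\<forall>n::nat. u n \<in> fst H) \<and> u \<longlonglongrightarrow> x \<and> (\<lambda>n. snd S (u n)) \<longlonglongrightarrow> snd S x"
    if x: "x \<in> fst S" for x
  proof -
    obtain z where z: "x = b z" using x fS by auto
    obtain v where v: "\<And>n::nat. v n \<in> range b" "v \<longlonglongrightarrow> z"
      using dense closure_sequential[of z "range b"] by auto
    have "b (v n) \<in> fst H" for n using v(1)[of n] D_eq b(2) by auto
    moreover have "(\<lambda>n. b (v n)) \<longlonglongrightarrow> x" unfolding z by (rule bl.tendsto[OF v(2)])
    moreover have "(\<lambda>n. snd S (b (v n))) \<longlonglongrightarrow> snd S x" unfolding z Sb by (rule cl.tendsto[OF v(2)])
    ultimately show ?thesis by (intro exI[of _ "\<lambda>n. b (v n)"]) simp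
  qed
  have uniq: "R = S" if R: "is_op_sqrt H R" for R
  proof -
    have Rsa: "op_self_adjoint R" and Rpos: "op_nonneg R" and DH: "fst H = {x \<in> fst R. snd R x \<in> fst R}"
      and RR: "\<And>x. x \<in> fst H \<Longrightarrow> snd H x = snd R (snd R x)" using R by auto
    note D = op_self_adjointD[OF Rsa]
    have dB: "B x \<in> fst R" "snd R (B x) \<in> fst R" for x using B(2)[of x] DH by auto
    have RRB: "snd R (snd R (B x)) = x - B x" for x using RR[OF B(2)] HB by simp
    \<comment> \<open>\<open>R B x\<close> lies in \<open>D(H)\<close> and \<open>1 + H\<close>
      sends it to \<open>R x\<close>; applying \<open>B\<close> inverts this.\<close>
    have BR: "B (snd R x) = snd R (B x)" if x: "x \<in> fst R" for x
    proof -
      have "snd R (B x) \<in> fst H" using dB x by (simp add: DH RRB D)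
      moreover have "snd H (snd R (B x)) = snd R x - snd R (B x)"
        using RR[OF calculation] RRB x dB by (simp add: op_self_adjoint_diff[OF Rsa])
      ultimately show ?thesis using B(4)[of "snd R (B x)"] by simp
    qed
    define K where "K x = snd R (B x)" for x
    \<comment> \<open>Writing \<open>y = B y + R (R (B y))\<close>, and likewise \<open>x\<close>,
      leaves only vectors in the domain of \<open>R\<close>, between which \<open>R\<close> can be
      moved freely.\<close>
    have Ksym: "inner (K x) y = inner x (K y)" for x y
    proof -
      have "inner (K x) y = inner (K x) (B y + snd R (snd R (B y)))" by (simp add: RRB)
      also have "\<dots> = inner (B x + snd R (snd R (B x))) (K y)"
        using dB by (simp add: K_def inner_add_left inner_add_right D)
      finally show ?thesis by (simp add: RRB)
    qed
    have Kpos: "0 \<le> inner x (K x)" for x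
    proof -
      have "inner x (K x) = inner (B x + snd R (snd R (B x))) (K x)" by (simp add: RRB)
      also have "\<dots> = inner (B x) (snd R (B x)) + inner (snd R (B x)) (snd R (snd R (B x)))"
        using dB by (simp add: K_def inner_add_left D)
      also have "\<dots> \<ge> 0" using Rpos dB by (auto simp: op_nonneg_def)
      finally show ?thesis .
    qed
    have Kbl: "bounded_linear K"
    proof (rule bounded_linear_intro[of _ 1])
      show "K (x + y) = K x + K y" for x y by (simp add: K_def Bl.add D dB)
      show "K (t *\<^sub>R x) = t *\<^sub>R K x" for t x by (simp add: K_def Bl.scaleR D dB)
      show "norm (K x) \<le> norm x * 1" for x
      proof -
        have "inner (K x) (K x) = inner (B x) (x - B x)" using dB by (simp add: K_def D RRB)
        also have "\<dots> \<le> inner x x"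
          using pos_contractionD(5)[OF B(1), of x] inner_ge_zero[of "B x"]
          unfolding inner_diff_right inner_commute[of "B x" x] by linarith
        finally show ?thesis by (simp add: norm_le)
      qed
    qed
    have KB: "K (B x) = B (K x)" for x using BR[OF dB(1)] by (simp add: K_def)
    have Kb: "K (b x) = b (K x)" and Kc: "K (c x) = c (K x)" for x
      using b(3)[OF Kbl] commc[OF Kbl] KB by auto
    have "K x = b (c x)" for x
    proof (rule pos_sqrt_unique[where Y = "\<lambda>x. b (c x)"])
      show "linear (\<lambda>x. b (c x))"
        using linear_compose[OF cl.linear_axioms bl.linear_axioms] by (simp add: o_def)
      show "inner (b (c x)) y = inner x (b (c y))" for x y by (simp add: bsym csym bc)
      show "0 \<le> inner x (b (c x))" for x using bc_pos[of x] by (simp add: bsym)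
      show "K (K x) = b (c (b (c x)))" for x
      proof -
        have "K (K x) = snd R (snd R (B (B x)))" by (simp add: K_def BR dB)
        also have "\<dots> = B x - B (B x)" by (rule RRB)
        also have "\<dots> = b (c (b (c x)))" by (simp add: bc[symmetric] b(2) c(2) Bl.diff[symmetric])
        finally show ?thesis .
      qed
    qed (auto simp: Kbl bounded_linear.linear Ksym Kpos Kb Kc)
    then have agree: "snd R x = snd S x" if "x \<in> fst H" for x
      using that D_eq by (auto simp: K_def bc) (metis Sb b(2))
    \<comment> \<open>Agreement on the core of \<open>S\<close> yields the adjoint relation against
      all of \<open>S\<close>, hence \<open>R \<subseteq> S\<close>. The reverse inclusion is the
      maximality of self-adjoint operators.\<close>
    have ext: "x \<in> fst S" "snd S x = snd R x" if x: "x \<in> fst R" for x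
    proof -
      have eq: "inner (snd S w) x = inner w (snd R x)" if w: "w \<in> fst S" for w
      proof -
        obtain u where u: "\<And>n::nat. u n \<in> fst H" "u \<longlonglongrightarrow> w" "(\<lambda>n. snd S (u n)) \<longlonglongrightarrow> snd S w"
          using core[OF w] by auto
        have eqn: "inner (snd S (u n)) x = inner (u n) (snd R x)" for n
          using u(1)[of n] DH x by (simp add: agree[symmetric] D)
        show ?thesis
        proof (rule LIMSEQ_unique)
          show "(\<lambda>n. inner (snd S (u n)) x) \<longlonglongrightarrow> inner (snd S w) x" by (intro tendsto_intros u)
          show "(\<lambda>n. inner (snd S (u n)) x) \<longlonglongrightarrow> inner w (snd R x)"
            unfolding eqn by (intro tendsto_intros u)
        qed
      qed
      show "x \<in> fst S" "snd S x = snd R x"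
        using op_self_adjoint_adjI[OF Ssa eq] by simp_all
    qed
    have "y \<in> fst R" if y: "y \<in> fst S" for y
    proof (rule op_self_adjoint_adjI(1)[OF Rsa])
      show "inner (snd R x) y = inner x (snd S y)" if "x \<in> fst R" for x
        using ext[OF that] y op_self_adjointD(10)[of S x y] S by simp
    qed
    then have "fst R = fst S" using ext by auto
    moreover have "snd R x = snd S x" for x
      using ext[of x] R S calculation by (cases "x \<in> fst R") auto
    ultimately show ?thesis by (simp add: prod_eq_iff fun_eq_iff)
  qed
  have "op_sqrt H = S" unfolding op_sqrt_def
  proof (rule the_equality)
    show "is_op_sqrt H S" by (rule S)
    show "R = S" if "is_op_sqrt H R" for R by (rule uniq[OF that])
  qed
  note [simp] = this
  show "is_op_sqrt H (op_sqrt H)" using S by simp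
  show "\<exists>u. (\<forall>n::nat. u n \<in> fst H) \<and> u \<longlonglongrightarrow> x \<and> (\<lambda>n. snd (op_sqrt H) (u n)) \<longlonglongrightarrow> snd (op_sqrt H) x"
    if "x \<in> fst (op_sqrt H)" using core that by simp
  show "op_commutes V (op_sqrt H)" if V: "bounded_linear V" "op_commutes V H"
  proof -
    have "V (B x) = B (V x)" for x by (rule op_commutes_resolvent[OF V(2,1) B(2-4)])
    then have "V (b x) = b (V x)" "V (c x) = c (V x)" for x using b(3)[OF V(1)] commc[OF V(1)] by auto
    then show ?thesis by (auto simp: op_commutes_def fS Sb)
  qed
qed

subsection \<open>Unitary groups\<close>

lemma vector_mean_value_bound:
  fixes f :: "real \<Rightarrow> 'a::real_normed_vector"
  assumes f: "\<And>s. \<bar>s\<bar> \<le> \<bar>t\<bar> \<Longrightarrow> (f has_vector_derivative f' s) (at s)"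
    and B: "\<And>s. \<bar>s\<bar> \<le> \<bar>t\<bar> \<Longrightarrow> norm (f' s) \<le> B"
  shows "norm (f t - f 0) \<le> B * \<bar>t\<bar>"
proof -
  have "norm (f t - f 0) \<le> B * norm (t - 0)"
  proof (rule differentiable_bound[of "{-\<bar>t\<bar>..\<bar>t\<bar>}" f "\<lambda>s h. h *\<^sub>R f' s"])
    show "(f has_derivative (\<lambda>h. h *\<^sub>R f' s)) (at s within {- \<bar>t\<bar>..\<bar>t\<bar>})" if "s \<in> {- \<bar>t\<bar>..\<bar>t\<bar>}" for s
      using f[of s] that by (auto simp: has_vector_derivative_def intro: has_derivative_at_withinI)
    show "onorm (\<lambda>h. h *\<^sub>R f' s) \<le> B" if "s \<in> {- \<bar>t\<bar>..\<bar>t\<bar>}" for s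
    proof (rule onorm_le)
      have "norm (f' s) \<le> B" using B[of s] that by auto
      then show "norm (h *\<^sub>R f' s) \<le> B * norm h" for h :: real
        using mult_right_mono[of "norm (f' s)" B "\<bar>h\<bar>"] by (simp add: mult.commute)
    qed
  qed auto
  then show ?thesis by simp
qed

text \<open>The norm is not differentiable at zeros of \<open>f\<close>, so it is replaced by
  \<open>sqrt (inner (f t) (f t) + e\<^sup>2)\<close>, whose derivative is bounded by
  \<open>c\<close> for every \<open>e > 0\<close>. The case \<open>c = 0\<close> serves as a
  uniqueness principle for skew evolution equations.\<close>

lemma norm_growth_bound:
  fixes f :: "real \<Rightarrow> 'a::real_inner"
  assumes f: "\<And>t. (f has_vector_derivative f' t) (at t)"
    and c: "\<And>t. \<bar>inner (f t) (f' t)\<bar> \<le> c * norm (f t)" and f0: "f 0 = 0" and "c \<ge> 0"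
  shows "norm (f t) \<le> c * \<bar>t\<bar>"
proof (rule field_le_epsilon)
  fix e :: real assume e: "e > 0"
  define h where "h t = sqrt (inner (f t) (f t) + e\<^sup>2)" for t
  have p: "inner (f t) (f t) + e\<^sup>2 > 0" for t using e by (simp add: add_nonneg_pos)
  have hpos: "h t > 0" for t using p by (simp add: h_def)
  have fh: "norm (f t) \<le> h t" for t
    unfolding h_def norm_eq_sqrt_inner by simp
  have dh: "(h has_vector_derivative inner (f t) (f' t) / h t) (at t)" for t
  proof -
    have "((\<lambda>t. inner (f t) (f t) + e\<^sup>2) has_real_derivative (2 * inner (f t) (f' t))) (at t)"
      using f[of t] unfolding has_vector_derivative_def has_field_derivative_def
      by (auto intro!: derivative_eq_intros simp: inner_commute algebra_simps)
    from DERIV_chain2[OF DERIV_real_sqrt[OF p] this]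
    show ?thesis unfolding h_def has_real_derivative_iff_has_vector_derivative[symmetric]
      by (simp add: field_simps)
  qed
  have "norm (h t - h 0) \<le> c * \<bar>t\<bar>"
  proof (rule vector_mean_value_bound[OF dh])
    fix s
    have "\<bar>inner (f s) (f' s)\<bar> \<le> c * h s"
      using c[of s] mult_left_mono[OF fh[of s] \<open>c \<ge> 0\<close>] by linarith
    then show "norm (inner (f s) (f' s) / h s) \<le> c"
      using hpos[of s] by (simp add: pos_divide_le_eq)
  qed
  moreover have "h 0 = e" using e by (simp add: h_def f0)
  ultimately show "norm (f t) \<le> c * \<bar>t\<bar> + e" using fh[of t] by simp
qed

text \<open>\<open>E\<close> is the exponential series of \<open>t A\<close>, differentiated term by
  term on a bounded interval around \<open>t\<close>.\<close>

lemma bounded_linear_flow: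
  fixes A :: "'a::banach \<Rightarrow> 'a"
  assumes "bounded_linear A"
  obtains E where "\<And>x. E 0 x = x" "\<And>x t. ((\<lambda>t. E t x) has_vector_derivative A (E t x)) (at t)"
proof -
  interpret bounded_linear A by fact
  obtain K where K: "K \<ge> 0" "\<And>x. norm (A x) \<le> norm x * K" using nonneg_bounded by auto
  define f where "f x n t = (t ^ n / fact n) *\<^sub>R (A ^^ n) x" for x :: 'a and n and t :: real
  define E where "E t x = (\<Sum>n. f x n t)" for t x
  have nA: "norm ((A ^^ n) x) \<le> K ^ n * norm x" for n x
  proof (induction n)
    case (Suc n)
    have "norm ((A ^^ Suc n) x) \<le> norm ((A ^^ n) x) * K" using K(2) by simp
    also have "\<dots> \<le> K ^ n * norm x * K" using Suc K(1) by (rule mult_right_mono)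
    finally show ?case by (simp add: mult_ac)
  qed simp
  have fb: "norm (f x n t) \<le> norm x * (inverse (fact n) * (M * K) ^ n)" if "\<bar>t\<bar> \<le> M" for x n t M
  proof -
    have "norm (f x n t) = \<bar>t\<bar> ^ n / fact n * norm ((A ^^ n) x)"
      by (simp add: f_def power_abs)
    also have "\<dots> \<le> M ^ n / fact n * (K ^ n * norm x)"
      using that nA by (intro mult_mono divide_right_mono power_mono) (auto intro: order_trans[OF abs_ge_zero])
    also have "\<dots> = norm x * (inverse (fact n) * (M * K) ^ n)"
      by (simp add: power_mult_distrib divide_inverse)
    finally show ?thesis .
  qed
  have "((\<lambda>t. E t x) has_vector_derivative A (E t x)) (at t)" for x t
  proof -
    define M where "M = \<bar>t\<bar> + 1"
    define S where "S = {-M<..<M}"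
    have ul: "uniform_limit S (\<lambda>n t. \<Sum>i<n. f x i t) (\<lambda>t. E t x) sequentially"
      unfolding E_def
      by (rule Weierstrass_m_test[OF fb[where M = M]])
        (auto simp: S_def intro: summable_mult summable_exp)
    have "\<exists>g. \<forall>t\<in>S. (\<lambda>n. f x n t) sums g t \<and> (g has_derivative (\<lambda>h. h *\<^sub>R A (E t x))) (at t within S)"
    \<comment> \<open>The derivative of the term of index \<open>Suc m\<close> is \<open>A\<close>
      applied to the term of index \<open>m\<close>; the constant term contributes the default value
      0.\<close>
    proof (rule has_derivative_series[where f' = "\<lambda>n t h. h *\<^sub>R (case n of 0 \<Rightarrow> 0 | Suc m \<Rightarrow> A (f x m t))"])
      show "convex S" by (simp add: S_def)
      show "(f x n has_derivative (\<lambda>h. h *\<^sub>R (case n of 0 \<Rightarrow> 0 | Suc m \<Rightarrow> A (f x m t)))) (at t within S)" for n t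
      proof (cases n)
        case 0 then show ?thesis by (simp add: f_def[abs_def])
      next
        case (Suc m)
        have "((\<lambda>t. t ^ Suc m / fact (Suc m)) has_real_derivative
            real (Suc m) * t ^ (Suc m - Suc 0) / fact (Suc m)) (at t within S)"
          by (intro DERIV_cdivide DERIV_pow)
        also have "real (Suc m) * t ^ (Suc m - Suc 0) / fact (Suc m) = t ^ m / fact m"
          by (simp del: of_nat_Suc)
        finally have "((\<lambda>t. (t ^ Suc m / fact (Suc m)) *\<^sub>R (A ^^ Suc m) x) has_vector_derivative
            (t ^ m / fact m) *\<^sub>R (A ^^ Suc m) x) (at t within S)"
          unfolding has_real_derivative_iff_has_vector_derivative
          by (rule bounded_linear.has_vector_derivative[OF bounded_linear_scaleR_left])
        then show ?thesis unfolding has_vector_derivative_def Suc by (simp add: f_def[abs_def] scaleR)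
      qed
      fix e :: real assume e: "e > 0"
      \<comment> \<open>By the index shift, the first \<open>Suc n\<close> derivatives add up to
        \<open>A\<close> of the \<open>n\<close>-th partial sum, so uniform convergence of the
        series itself suffices. Dividing by \<open>K + 1\<close> rather than \<open>K\<close> covers
        \<open>K = 0\<close>.\<close>
      have "\<forall>\<^sub>F n in sequentially. \<forall>t\<in>S. dist (\<Sum>i<n. f x i t) (E t x) < e / (K + 1)"
        by (rule uniform_limitD[OF ul]) (use e K in auto)
      then have "\<forall>\<^sub>F n in sequentially. \<forall>t\<in>S. \<forall>h. norm ((\<Sum>i<Suc n. h *\<^sub>R (case i of 0 \<Rightarrow> 0 | Suc m \<Rightarrow> A (f x m t)))
          - h *\<^sub>R A (E t x)) \<le> e * norm h"
      proof (eventually_elim, intro ballI allI)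
        fix n t and h :: real
        assume "\<forall>t\<in>S. dist (\<Sum>i<n. f x i t) (E t x) < e / (K + 1)" and "t \<in> S"
        then have d: "norm ((\<Sum>i<n. f x i t) - E t x) < e / (K + 1)" by (auto simp: dist_norm)
        have "(\<Sum>i<Suc n. h *\<^sub>R (case i of 0 \<Rightarrow> 0 | Suc m \<Rightarrow> A (f x m t))) = h *\<^sub>R A (\<Sum>i<n. f x i t)"
          by (subst sum.lessThan_Suc_shift) (simp add: sum scaleR_sum_right)
        then have "norm ((\<Sum>i<Suc n. h *\<^sub>R (case i of 0 \<Rightarrow> 0 | Suc m \<Rightarrow> A (f x m t))) - h *\<^sub>R A (E t x))
            = norm h * norm (A ((\<Sum>i<n. f x i t) - E t x))"
          by (simp add: diff scaleR_diff_right[symmetric])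
        also have "\<dots> \<le> norm h * (e / (K + 1) * K)"
          using K(2)[of "(\<Sum>i<n. f x i t) - E t x"] mult_right_mono[OF less_imp_le[OF d] K(1)]
          by (intro mult_left_mono) auto
        also have "\<dots> \<le> norm h * e" using K(1) e by (intro mult_left_mono) (auto simp: field_simps)
        finally show "norm ((\<Sum>i<Suc n. h *\<^sub>R (case i of 0 \<Rightarrow> 0 | Suc m \<Rightarrow> A (f x m t))) - h *\<^sub>R A (E t x)) \<le> e * norm h"
          by (simp add: mult.commute)
      qed
      then show "\<forall>\<^sub>F n in sequentially. \<forall>t\<in>S. \<forall>h. norm ((\<Sum>i<n. h *\<^sub>R (case i of 0 \<Rightarrow> 0 | Suc m \<Rightarrow> A (f x m t)))
          - h *\<^sub>R A (E t x)) \<le> e * norm h"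
        by (subst (asm) eventually_sequentially_Suc)
    next
      show "0 \<in> S" using abs_ge_zero[of t] by (simp add: S_def M_def del: abs_ge_zero)
      show "(\<lambda>n. f x n 0) sums (\<Sum>n. f x n 0)"
        by (intro summable_sums summable_comparison_test[OF _ summable_mult[OF summable_exp]])
          (use fb[where M = 0 and t = 0] in auto)
    qed
    then obtain g where g: "\<And>t. t \<in> S \<Longrightarrow> (\<lambda>n. f x n t) sums g t"
      "\<And>t. t \<in> S \<Longrightarrow> (g has_derivative (\<lambda>h. h *\<^sub>R A (E t x))) (at t within S)" by auto
    have gE: "g s = E s x" if "s \<in> S" for s using g(1)[OF that] by (simp add: E_def sums_iff)
    have tS: "t \<in> S" "open S" by (auto simp: S_def M_def)
    have "(g has_derivative (\<lambda>h. h *\<^sub>R A (E t x))) (at t)"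
      using g(2)[OF tS(1)] at_within_open[OF tS] by simp
    then have "((\<lambda>t. E t x) has_derivative (\<lambda>h. h *\<^sub>R A (E t x))) (at t)"
      by (rule has_derivative_transform_within_open[OF _ tS(2,1)]) (use gE in auto)
    then show ?thesis by (simp add: has_vector_derivative_def)
  qed
  moreover have "E 0 x = x" for x
  proof -
    have "(\<lambda>n. f x n 0) sums f x 0 0" 
    proof -
      have "(\<lambda>n. f x n 0) = (\<lambda>n. if n = 0 then x else 0)" by (auto simp: f_def)
      then show ?thesis using sums_single[of 0 "\<lambda>_. x"] by (simp add: f_def)
    qed
    then show ?thesis by (simp add: E_def sums_iff f_def)
  qed
  ultimately show thesis using that by blast
qed


text \<open>Solutions of \<open>x' = A x\<close> with \<open>A\<close> skew have constant norm; uniqueness then yields all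
  algebraic properties of the flow.\<close>

lemma skew_flow:
  fixes A :: "'a::{real_inner,banach} \<Rightarrow> 'a"
  assumes A: "bounded_linear A" and skew: "\<And>x. inner x (A x) = 0"
  obtains E where "\<And>t. bounded_linear (E t)" "\<And>t x. norm (E t x) = norm x" "\<And>x. E 0 x = x"
    "\<And>s t x. E (s + t) x = E s (E t x)"
    "\<And>x t. ((\<lambda>t. E t x) has_vector_derivative A (E t x)) (at t)"
    "\<And>V t x. bounded_linear V \<Longrightarrow> (\<And>x. V (A x) = A (V x)) \<Longrightarrow> V (E t x) = E t (V x)"
proof -
  obtain E where E: "\<And>x. E 0 x = x" "\<And>x t. ((\<lambda>t. E t x) has_vector_derivative A (E t x)) (at t)"
    using bounded_linear_flow[OF A] by blast
  interpret A: bounded_linear A by fact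
  have unique: "f t = E t (f 0)" if f: "\<And>t. (f has_vector_derivative A (f t)) (at t)" for f t
  proof -
    have "norm (f t - E t (f 0)) \<le> 0 * \<bar>t\<bar>"
    proof (rule norm_growth_bound[where f' = "\<lambda>t. A (f t) - A (E t (f 0))"])
      show "((\<lambda>t. f t - E t (f 0)) has_vector_derivative A (f t) - A (E t (f 0))) (at t)" for t
        by (intro has_vector_derivative_diff f E(2))
      show "\<bar>inner (f t - E t (f 0)) (A (f t) - A (E t (f 0)))\<bar> \<le> 0 * norm (f t - E t (f 0))" for t
        using skew[of "f t - E t (f 0)"] by (simp add: A.diff)
    qed (auto simp: E(1))
    then show ?thesis by simp
  qed
  have norm_E: "norm (E t x) = norm x" for t x
  proof -
    have "((\<lambda>t. inner (E t x) (E t x)) has_real_derivative 0) (at t)" for t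
      using E(2)[of x t] skew[of "E t x"] unfolding has_vector_derivative_def has_field_derivative_def
      by (auto intro!: derivative_eq_intros simp: inner_commute)
    then have "inner (E t x) (E t x) = inner (E 0 x) (E 0 x)" by (rule DERIV_isconst_all[rule_format])
    then show ?thesis by (simp add: E(1) norm_eq_sqrt_inner)
  qed
  have lin: "bounded_linear (E t)" for t
  proof (rule bounded_linear_intro[of _ 1])
    show "E t (x + y) = E t x + E t y" for x y
      using unique[of "\<lambda>t. E t x + E t y" t] has_vector_derivative_add[OF E(2)[of x] E(2)[of y]]
      by (simp add: E(1) A.add)
    show "E t (r *\<^sub>R x) = r *\<^sub>R E t x" for r x
      using unique[of "\<lambda>t. r *\<^sub>R E t x" t]
        bounded_linear.has_vector_derivative[OF bounded_linear_scaleR_right[of r] E(2)[of x]]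
      by (simp add: E(1) A.scaleR)
  qed (simp add: norm_E)
  have "E (s + t) x = E s (E t x)" for s t x
  proof -
    have "((\<lambda>s. E (s + t) x) has_vector_derivative A (E (s + t) x)) (at s)" for s
    proof -
      have "((\<lambda>s. s + t) has_vector_derivative 1 + 0) (at s)"
        by (intro has_vector_derivative_add has_vector_derivative_id has_vector_derivative_const)
      then show ?thesis
        using vector_diff_chain_at[of "\<lambda>s. s + t" 1 s "\<lambda>t. E t x" "A (E (s + t) x)"] E(2)[of x "s + t"]
        by (simp add: o_def)
    qed
    from unique[OF this, of s] show ?thesis by simp
  qed
  moreover have "V (E t x) = E t (V x)" if V: "bounded_linear V" "\<And>x. V (A x) = A (V x)" for V t x
  proof -
    have "((\<lambda>t. V (E t x)) has_vector_derivative A (V (E t x))) (at t)" for t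
      using bounded_linear.has_vector_derivative[OF V(1) E(2)[of x t]] by (simp add: V(2))
    from unique[OF this, of t] show ?thesis by (simp add: E(1))
  qed
  ultimately show thesis using that[OF lin norm_E E(1) _ E(2)] by blast
qed


section \<open>Unitary groups and their generators: invariance of the domain, derivatives,
  uniqueness\<close>

lemma has_vector_derivative_at_iff_quotient:
  fixes f :: "real \<Rightarrow> 'a::real_normed_vector"
  shows "(f has_vector_derivative D) (at t) \<longleftrightarrow> ((\<lambda>h. (1 / h) *\<^sub>R (f (t + h) - f t)) \<longlongrightarrow> D) (at 0)"
proof -
  have "(f has_vector_derivative D) (at t) \<longleftrightarrow> ((\<lambda>h. norm (f (t + h) - f t - h *\<^sub>R D) / norm h) \<longlongrightarrow> 0) (at 0)"
    by (simp add: has_vector_derivative_def has_derivative_at bounded_linear_scaleR_left)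
  also have "\<dots> \<longleftrightarrow> ((\<lambda>h. norm ((1 / h) *\<^sub>R (f (t + h) - f t) - D)) \<longlongrightarrow> 0) (at 0)"
  proof (rule filterlim_cong[OF refl refl])
    have "norm (f (t + h) - f t - h *\<^sub>R D) / norm h = norm ((1 / h) *\<^sub>R (f (t + h) - f t) - D)" if "h \<noteq> 0" for h
    proof -
      have "(1 / h) *\<^sub>R (f (t + h) - f t) - D = (1 / h) *\<^sub>R (f (t + h) - f t - h *\<^sub>R D)"
        using that by (simp add: scaleR_diff_right)
      then show ?thesis by simp
    qed
    then show "\<forall>\<^sub>F h in at 0. norm (f (t + h) - f t - h *\<^sub>R D) / norm h = norm ((1 / h) *\<^sub>R (f (t + h) - f t) - D)"
      by (auto simp: eventually_at_filter)
  qed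
  also have "\<dots> \<longleftrightarrow> ((\<lambda>h. (1 / h) *\<^sub>R (f (t + h) - f t)) \<longlongrightarrow> D) (at 0)"
    by (simp add: tendsto_norm_zero_iff LIM_zero_iff)
  finally show ?thesis .
qed

lemma unitary_group_ofD:
  assumes "unitary_group_of A U"
  shows "bounded_linear (U t)" "norm (U t x) = norm x" "U t (imult x) = imult (U t x)" "U 0 x = x"
    "U (s + t) x = U s (U t x)" "continuous_on UNIV (\<lambda>t. U t x)"
    "((\<lambda>s. (1 / s) *\<^sub>R (U s x - x)) \<longlongrightarrow> y) (at 0) \<Longrightarrow> x \<in> fst A"
    "x \<in> fst A \<Longrightarrow> ((\<lambda>s. (1 / s) *\<^sub>R (U s x - x)) \<longlongrightarrow> - imult (snd A x)) (at 0)"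
  using assms unfolding unitary_group_of_def by auto

lemma unitary_group_ofD_diff: "unitary_group_of A U \<Longrightarrow> U t (x - y) = U t x - U t y"
  by (intro linear_diff bounded_linear.linear unitary_group_ofD(1))

lemma unitary_group_quotient:
  assumes U: "unitary_group_of A U" and x: "x \<in> fst A"
  shows "((\<lambda>s. (1 / s) *\<^sub>R (U s (U t x) - U t x)) \<longlongrightarrow> U t (- imult (snd A x))) (at 0)"
proof -
  have "(1 / s) *\<^sub>R (U s (U t x) - U t x) = U t ((1 / s) *\<^sub>R (U s x - x))" for s
    using unitary_group_ofD(5)[OF U, of s t x] unitary_group_ofD(5)[OF U, of t s x]
    by (simp add: linear_scale[OF bounded_linear.linear[OF unitary_group_ofD(1)[OF U]]]
        unitary_group_ofD_diff[OF U] add.commute)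
  then show ?thesis
    using bounded_linear.tendsto[OF unitary_group_ofD(1)[OF U] unitary_group_ofD(8)[OF U x]] by simp
qed

text \<open>The quotient at \<open>U t x\<close> is \<open>U t\<close> applied to the quotient at
  \<open>x\<close>, so it converges; the generator's domain contains every vector with convergent
  quotients, and comparing the two limits gives the value.\<close>

lemma unitary_group_commutes:
  assumes U: "unitary_group_of A U"
  shows "op_commutes (U t) A"
  unfolding op_commutes_def
proof (intro ballI conjI)
  fix x assume x: "x \<in> fst A"
  note q = unitary_group_quotient[OF U x, of t]
  show Ux: "U t x \<in> fst A" by (rule unitary_group_ofD(7)[OF U q])
  have "- imult (snd A (U t x)) = U t (- imult (snd A x))"
    by (rule tendsto_unique[OF _ unitary_group_ofD(8)[OF U Ux] q]) simp
  also have "\<dots> = - imult (U t (snd A x))"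
    by (simp add: linear_neg[OF bounded_linear.linear[OF unitary_group_ofD(1)[OF U]]] unitary_group_ofD(3)[OF U])
  finally have "imult (imult (snd A (U t x))) = imult (imult (U t (snd A x)))" by simp
  then show "snd A (U t x) = U t (snd A x)" by (simp add: imult_imult)
qed

text \<open>Both forms are needed: the first exposes skewness for energy arguments, the second has
  norm independent of \<open>t\<close>.\<close>

lemma unitary_group_derivative:
  assumes U: "unitary_group_of A U" and x: "x \<in> fst A"
  shows "((\<lambda>t. U t x) has_vector_derivative - imult (snd A (U t x))) (at t)"
    "((\<lambda>t. U t x) has_vector_derivative U t (- imult (snd A x))) (at t)"
proof -
  note Ux = unitary_group_commutes[OF U, of t, unfolded op_commutes_def, rule_format, OF x]
  have eq: "U (t + h) x = U h (U t x)" for h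
    using unitary_group_ofD(5)[OF U, of h t x] by (simp add: add.commute)
  show "((\<lambda>t. U t x) has_vector_derivative - imult (snd A (U t x))) (at t)"
    unfolding has_vector_derivative_at_iff_quotient eq
    by (rule unitary_group_ofD(8)[OF U]) (use Ux in simp)
  show "((\<lambda>t. U t x) has_vector_derivative U t (- imult (snd A x))) (at t)"
    unfolding has_vector_derivative_at_iff_quotient eq by (rule unitary_group_quotient[OF U x])
qed

lemma unitary_group_lipschitz:
  assumes U: "unitary_group_of A U" and x: "x \<in> fst A"
  shows "norm (U t x - x) \<le> norm (snd A x) * \<bar>t\<bar>"
  using vector_mean_value_bound[of t "\<lambda>t. U t x" "\<lambda>t. U t (- imult (snd A x))", OF unitary_group_derivative(2)[OF U x]]
  by (simp add: unitary_group_ofD[OF U])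

lemma unitary_group_near_identity:
  assumes U: "unitary_group_of A U" and r: "r > 0"
  shows "\<exists>d>0. \<forall>s. \<bar>s\<bar> < d \<longrightarrow> norm (U s x - x) < r"
proof -
  have "\<exists>d>0. \<forall>s\<in>UNIV. dist s 0 < d \<longrightarrow> dist (U s x) (U 0 x) < r"
    using unitary_group_ofD(6)[OF U, of x] r unfolding continuous_on_iff by blast
  then show ?thesis by (simp add: dist_norm unitary_group_ofD(4)[OF U])
qed

lemma inner_imult_self_adjoint:
  assumes A: "op_self_adjoint A" and x: "x \<in> fst A"
  shows "inner x (imult (snd A x)) = 0"
proof -
  have "inner x (imult (snd A x)) = - inner (imult x) (snd A x)" by (simp add: inner_imult_swap)
  also have "\<dots> = - inner (snd A (imult x)) x"
    using op_self_adjointD(10)[OF A op_self_adjointD(3)[OF A x] x] by simp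
  also have "\<dots> = - inner x (imult (snd A x))"
    by (simp add: op_self_adjointD(9)[OF A x] inner_commute)
  finally show ?thesis by simp
qed

text \<open>On the domain the difference of two orbits solves the same skew equation with zero
  initial value; density and boundedness do the rest.\<close>

lemma unitary_group_unique:
  assumes A: "op_self_adjoint A" and U: "unitary_group_of A U" and V: "unitary_group_of A V"
  shows "U = V"
proof (intro ext)
  fix t x
  have eqD: "U t x = V t x" if x: "x \<in> fst A" for x
  proof -
    have dom: "U t x \<in> fst A" "V t x \<in> fst A" for t
      using unitary_group_commutes[OF U] unitary_group_commutes[OF V] x by (auto simp: op_commutes_def)
    have "norm (U t x - V t x) \<le> 0 * \<bar>t\<bar>"
    proof (rule norm_growth_bound)
      show "((\<lambda>t. U t x - V t x) has_vector_derivative (- imult (snd A (U t x)) - (- imult (snd A (V t x))))) (at t)" for t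
        by (intro has_vector_derivative_diff unitary_group_derivative(1)[OF _ x] U V)
      show "\<bar>inner (U t x - V t x) (- imult (snd A (U t x)) - - imult (snd A (V t x)))\<bar> \<le> 0 * norm (U t x - V t x)" for t
      proof -
        have "- imult (snd A (U t x)) - - imult (snd A (V t x)) = - imult (snd A (U t x - V t x))"
          using op_self_adjoint_diff[OF A dom(1) dom(2)]
          by (simp add: linear_diff[OF bounded_linear.linear[OF bounded_linear_imult]])
        then show ?thesis
          using inner_imult_self_adjoint[OF A op_self_adjointD(5)[OF A dom(1) dom(2)]] by simp
      qed
    qed (auto simp: unitary_group_ofD[OF U] unitary_group_ofD[OF V])
    then show ?thesis by simp
  qed
  have "closed {x. U t x = V t x}"
    by (intro closed_Collect_eq linear_continuous_on unitary_group_ofD(1)[OF U] unitary_group_ofD(1)[OF V])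
  moreover have "fst A \<subseteq> {x. U t x = V t x}" using eqD by auto
  ultimately have "closure (fst A) \<subseteq> {x. U t x = V t x}" by (rule closure_minimal[rotated])
  then show "U t x = V t x" using op_self_adjointD(2)[OF A] by auto
qed

lemma closure_UNIV_approx:
  fixes x :: "'a::real_normed_vector"
  assumes "closure D = UNIV" "e > 0"
  obtains y where "y \<in> D" "norm (x - y) < e"
  using assms closure_approachable[of x D] by (auto simp: dist_norm norm_minus_commute)

lemma norm_add_diff_le: "norm (a + b - c) \<le> norm a + norm b + norm (c::'a::real_normed_vector)"
  using norm_triangle_ineq4[of "a + b" c] norm_triangle_ineq[of a b] by linarith

lemma linear_isometry_inner:
  assumes "linear U" and n: "\<And>x. norm (U x) = norm x"
  shows "inner (U x) (U y) = inner x y"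
proof -
  have "(norm (U (x + y)))\<^sup>2 = (norm (x + y))\<^sup>2" by (simp add: n)
  moreover have "(norm (U x))\<^sup>2 = (norm x)\<^sup>2" "(norm (U y))\<^sup>2 = (norm y)\<^sup>2" by (simp_all add: n)
  ultimately show ?thesis using assms(1)
    by (simp add: linear_add power2_norm_eq_inner inner_add_left inner_add_right inner_commute)
qed

text \<open>Yosida approximation: with \<open>R\<^sub>k = (1 + H / (k + 1))\<^sup>-\<^sup>1\<close> the bounded skew operators
  \<open>- i (k + 1) (1 - R\<^sub>k) = - i R\<^sub>k H\<close> generate norm-preserving flows which converge strongly.\<close>

theorem stone_nonneg:
  fixes H :: "('a::complex_hilbert) set \<times> ('a \<Rightarrow> 'a)"
  assumes H: "op_self_adjoint H" and pos: "op_nonneg H"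
  shows "\<exists>U. unitary_group_of H U"
proof -
  note D = op_self_adjointD[OF H]
  define a :: "nat \<Rightarrow> real" where "a k = 1 / Suc k" for k
  have a: "a k > 0" for k by (simp add: a_def)
  have alim: "a \<longlonglongrightarrow> 0" unfolding a_def by (rule LIMSEQ_Suc[OF lim_1_over_n])
  define is_res where "is_res k R \<longleftrightarrow> pos_contraction R \<and> (\<forall>y. R y \<in> fst H) \<and>
    (\<forall>y. R y + a k *\<^sub>R snd H (R y) = y) \<and> (\<forall>x\<in>fst H. R (x + a k *\<^sub>R snd H x) = x)" for k R
  have "\<exists>R. is_res k R" for k
    by (rule nonneg_resolvent[OF H pos a[of k]]) (auto simp: is_res_def)
  then obtain R where "\<And>k. is_res k (R k)" by metis
  then have R: "\<And>k. pos_contraction (R k)" "\<And>k y. R k y \<in> fst H"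
    "\<And>k y. R k y + a k *\<^sub>R snd H (R k y) = y" "\<And>k x. x \<in> fst H \<Longrightarrow> R k (x + a k *\<^sub>R snd H x) = x"
    by (auto simp: is_res_def)
  have Rbl: "bounded_linear (R k)" for k by (rule pos_contractionD(1)[OF R(1)])
  have Rlin: "R k (x + y) = R k x + R k y" "R k (x - y) = R k x - R k y" "R k (r *\<^sub>R x) = r *\<^sub>R R k x" for k x y r
    using bounded_linear.linear[OF Rbl] by (simp_all add: linear_add linear_diff linear_scale)
  have Rn: "norm (R k x) \<le> norm x" for k x by (rule pos_contraction_norm_le[OF R(1)])
  have RH: "a k *\<^sub>R R k (snd H x) = x - R k x" if "x \<in> fst H" for k x
    using R(4)[OF that, of k] by (simp add: Rlin algebra_simps)
  have HR: "a k *\<^sub>R snd H (R k x) = x - R k x" for k x using R(3)[of k x] by (simp add: algebra_simps)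
  have Rcom: "op_commutes (R k) H" for k
    unfolding op_commutes_def
  proof (intro ballI conjI R(2))
    fix x assume "x \<in> fst H"
    then have "a k *\<^sub>R snd H (R k x) = a k *\<^sub>R R k (snd H x)" by (simp add: RH HR)
    then show "snd H (R k x) = R k (snd H x)" using a[of k] by simp
  qed
  have RR: "R k (R l x) = R l (R k x)" for k l x
    by (rule op_commutes_resolvent[OF Rcom Rbl R(2,3,4)]) simp_all
  have Ri: "imult (R k x) = R k (imult x)" for k x
    by (rule op_commutes_resolvent[OF _ bounded_linear_imult R(2,3,4)]) (auto simp: op_commutes_def D)
  note il = bounded_linear.linear[OF bounded_linear_imult]
  note isimps = linear_add[OF il] linear_diff[OF il] linear_neg[OF il] linear_scale[OF il]
  define A where "A k x = (- (1 / a k)) *\<^sub>R imult (x - R k x)" for k x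
  have Abl: "bounded_linear (A k)" for k
    unfolding A_def
    by (intro bounded_linear_const_scaleR bounded_linear_compose[OF bounded_linear_imult] bounded_linear_sub
        bounded_linear_ident Rbl)
  have Alin: "A k (x + y) = A k x + A k y" "A k (x - y) = A k x - A k y" for k x y
    using bounded_linear.linear[OF Abl] by (simp_all add: linear_add linear_diff)
  have Askew: "inner x (A k x) = 0" for k x
  proof -
    have sym: "inner (R k x) y = inner x (R k y)" for x y by (rule pos_contractionD(3)[OF R(1)])
    have "inner x (imult (x - R k x)) = - inner (imult x) (x - R k x)" by (simp add: inner_imult_swap)
    also have "\<dots> = - inner (imult x - R k (imult x)) x"
      by (simp add: inner_diff_left inner_diff_right sym)
    also have "\<dots> = - inner x (imult (x - R k x))"
      by (simp add: isimps Ri inner_commute)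
    finally show ?thesis by (simp add: A_def)
  qed
  have Acom: "A k (A l x) = A l (A k x)" for k l x
    by (simp add: A_def isimps Rlin Ri RR linear_scale[OF bounded_linear.linear[OF Rbl]]
        linear_neg[OF bounded_linear.linear[OF Rbl]] algebra_simps)
  have Ai: "imult (A k x) = A k (imult x)" for k x by (simp add: A_def isimps Ri)
  \<comment> \<open>On \<open>D(H)\<close> the factor \<open>1 / a k\<close> cancels, which gives
    both convergence of \<open>A k x\<close> and a bound independent of \<open>k\<close>.\<close>
  have AH: "A k x = - imult (R k (snd H x))" if "x \<in> fst H" for k x
    unfolding A_def RH[OF that, symmetric] using a[of k] by (simp add: isimps)
  have Rlim: "(\<lambda>k. R k y) \<longlonglongrightarrow> y" for y
  proof (rule LIMSEQ_I)
    fix e :: real assume e: "e > 0"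
    obtain z where z: "z \<in> fst H" "norm (y - z) < e / 3"
      using closure_UNIV_approx[OF D(2), of "e / 3" y] e by auto
    have "(\<lambda>k. a k * norm (snd H z)) \<longlonglongrightarrow> 0 * norm (snd H z)" by (intro tendsto_intros alim)
    then have "\<exists>n. \<forall>k\<ge>n. norm (a k * norm (snd H z) - 0) < e / 3"
      using e by (intro LIMSEQ_D) auto
    then obtain n where n: "\<And>k. k \<ge> n \<Longrightarrow> a k * norm (snd H z) < e / 3"
      by (auto simp: abs_mult) (metis a abs_of_pos)
    have "norm (R k y - y) < e" if "k \<ge> n" for k
    proof -
      have "z - R k z = a k *\<^sub>R R k (snd H z)" by (simp add: RH z)
      then have "norm (z - R k z) = a k * norm (R k (snd H z))" using a[of k] by simp
      also have "\<dots> \<le> a k * norm (snd H z)" using Rn a[of k] by (intro mult_left_mono) auto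
      finally have 1: "norm (z - R k z) < e / 3" using n[OF that] by linarith
      have "R k y - y = R k (y - z) - (z - R k z) - (y - z)" by (simp add: Rlin)
      then have "norm (R k y - y) \<le> norm (R k (y - z)) + norm (z - R k z) + norm (y - z)"
        using norm_add_diff_le[of "R k (y - z)" "- (z - R k z)" "y - z"] by (simp add: norm_minus_commute)
      then show ?thesis using 1 z(2) Rn[of k "y - z"] by linarith
    qed
    then show "\<exists>n. \<forall>k\<ge>n. norm (R k y - y) < e" by blast
  qed
  have Alim: "(\<lambda>k. A k x) \<longlonglongrightarrow> - imult (snd H x)" if "x \<in> fst H" for x
    unfolding AH[OF that] by (intro tendsto_minus bounded_linear.tendsto[OF bounded_linear_imult] Rlim)
  have An: "norm (A k x) \<le> norm (snd H x)" if "x \<in> fst H" for k x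
    using Rn by (simp add: AH[OF that])
  define is_flow where "is_flow k E \<longleftrightarrow> (\<forall>t. bounded_linear (E t)) \<and> (\<forall>t x. norm (E t x) = norm x) \<and> (\<forall>x. E 0 x = x) \<and>
    (\<forall>s t x. E (s + t) x = E s (E t x)) \<and>
    (\<forall>x t. ((\<lambda>t. E t x) has_vector_derivative A k (E t x)) (at t)) \<and>
    (\<forall>V. bounded_linear V \<longrightarrow> (\<forall>x. V (A k x) = A k (V x)) \<longrightarrow> (\<forall>t x. V (E t x) = E t (V x)))" for k E
  have "\<exists>E. is_flow k E" for k
  proof (rule skew_flow[OF Abl Askew])
    fix E
    assume "\<And>t. bounded_linear (E t)" "\<And>t x. norm (E t x) = norm x" "\<And>x. E 0 x = x"
      "\<And>s t x. E (s + t) x = E s (E t x)"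
      "\<And>x t. ((\<lambda>t. E t x) has_vector_derivative A k (E t x)) (at t)"
      "\<And>V t x. bounded_linear V \<Longrightarrow> (\<And>x. V (A k x) = A k (V x)) \<Longrightarrow> V (E t x) = E t (V x)"
    then have "is_flow k E" unfolding is_flow_def by simp
    then show "\<exists>E. is_flow k E" by blast
  qed
  then obtain E where "\<And>k. is_flow k (E k)" by metis
  then have E: "\<And>k t. bounded_linear (E k t)" "\<And>k t x. norm (E k t x) = norm x"
      "\<And>k x. E k 0 x = x" "\<And>k s t x. E k (s + t) x = E k s (E k t x)"
      "\<And>k x t. ((\<lambda>t. E k t x) has_vector_derivative A k (E k t x)) (at t)"
      "\<And>k V t x. bounded_linear V \<Longrightarrow> (\<And>x. V (A k x) = A k (V x)) \<Longrightarrow> V (E k t x) = E k t (V x)"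
    unfolding is_flow_def by simp_all
  have Elin: "E k t (x + y) = E k t x + E k t y" "E k t (x - y) = E k t x - E k t y"
    "E k t (r *\<^sub>R x) = r *\<^sub>R E k t x" for k t x y r
    using bounded_linear.linear[OF E(1)] by (simp_all add: linear_add linear_diff linear_scale)
  have EA: "A l (E k t x) = E k t (A l x)" for k l t x
    by (rule E(6)[OF Abl]) (rule Acom)
  have Edist: "norm (E k t x - E l t x) \<le> norm (A k x - A l x) * \<bar>t\<bar>" for k l t x
  proof (rule norm_growth_bound)
    show "((\<lambda>t. E k t x - E l t x) has_vector_derivative A k (E k t x) - A l (E l t x)) (at t)" for t
      by (intro has_vector_derivative_diff E(5))
    fix t
    \<comment> \<open>Because everything commutes, the derivative splits into a skew part acting on
      the difference, invisible in the inner product, and a part of constant norm.\<close>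
    have "A k (E k t x) - A l (E l t x) = A l (E k t x - E l t x) + E k t (A k x - A l x)"
      by (simp add: Alin Elin EA)
    then have "inner (E k t x - E l t x) (A k (E k t x) - A l (E l t x))
        = inner (E k t x - E l t x) (E k t (A k x - A l x))"
      by (simp add: inner_add_right Askew)
    then show "\<bar>inner (E k t x - E l t x) (A k (E k t x) - A l (E l t x))\<bar>
        \<le> norm (A k x - A l x) * norm (E k t x - E l t x)"
      using Cauchy_Schwarz_ineq2[of "E k t x - E l t x" "E k t (A k x - A l x)"] by (simp add: E(2) mult.commute)
  qed (auto simp: E(3))
  have "Cauchy (\<lambda>k. E k t x)" for t x
  proof (rule metric_CauchyI)
    fix e :: real assume e: "e > 0"
    obtain z where z: "z \<in> fst H" "norm (x - z) < e / 4"
      using closure_UNIV_approx[OF D(2), of "e / 4" x] e by auto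
    have "Cauchy (\<lambda>k. A k z)" by (rule LIMSEQ_imp_Cauchy[OF Alim[OF z(1)]])
    then obtain M where M: "\<And>m n. m \<ge> M \<Longrightarrow> n \<ge> M \<Longrightarrow> dist (A m z) (A n z) < e / (2 * (\<bar>t\<bar> + 1))"
      using e metric_CauchyD[of "\<lambda>k. A k z" "e / (2 * (\<bar>t\<bar> + 1))"] by (auto simp: add_nonneg_pos)
    have "dist (E m t x) (E n t x) < e" if "m \<ge> M" "n \<ge> M" for m n
    proof -
      have "norm (E m t z - E n t z) \<le> e / (2 * (\<bar>t\<bar> + 1)) * \<bar>t\<bar>"
        using Edist[of m t z n] mult_right_mono[OF less_imp_le[OF M[OF that]], of "\<bar>t\<bar>"] by (simp add: dist_norm)
      also have "\<dots> \<le> e / 2" using e by (simp add: field_simps)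
      finally have 1: "norm (E m t z - E n t z) \<le> e / 2" .
      have "E m t x - E n t x = E m t (x - z) + (E m t z - E n t z) - E n t (x - z)" by (simp add: Elin)
      then have "norm (E m t x - E n t x) \<le> norm (E m t (x - z)) + norm (E m t z - E n t z) + norm (E n t (x - z))"
        by (simp only: norm_add_diff_le)
      then show ?thesis using 1 z(2) by (simp add: E(2) dist_norm)
    qed
    then show "\<exists>M. \<forall>m\<ge>M. \<forall>n\<ge>M. dist (E m t x) (E n t x) < e" by blast
  qed
  then have "convergent (\<lambda>k. E k t x)" for t x by (rule Cauchy_convergent)
  define U where "U t x = lim (\<lambda>k. E k t x)" for t x
  have U: "(\<lambda>k. E k t x) \<longlonglongrightarrow> U t x" for t x
    unfolding U_def using \<open>convergent (\<lambda>k. E k t x)\<close> by (simp add: convergent_LIMSEQ_iff)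
  have Un: "norm (U t x) = norm x" for t x
  proof (rule LIMSEQ_unique)
    show "(\<lambda>k. norm (E k t x)) \<longlonglongrightarrow> norm (U t x)" by (intro tendsto_norm U)
    show "(\<lambda>k. norm (E k t x)) \<longlonglongrightarrow> norm x" unfolding E(2) by simp
  qed
  have Ubl: "bounded_linear (U t)" for t
  proof (rule bounded_linear_intro[of _ 1])
    show "U t (x + y) = U t x + U t y" for x y
      by (rule LIMSEQ_unique[OF U]) (unfold Elin, intro tendsto_add U)
    show "U t (r *\<^sub>R x) = r *\<^sub>R U t x" for r x
      by (rule LIMSEQ_unique[OF U]) (unfold Elin, intro tendsto_scaleR tendsto_const U)
  qed (simp add: Un)
  have Udiff: "U t (x - y) = U t x - U t y" for t x y by (rule linear_diff[OF bounded_linear.linear[OF Ubl]])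
  have Ui: "U t (imult x) = imult (U t x)" for t x
  proof (rule LIMSEQ_unique[OF U])
    have "E k t (imult x) = imult (E k t x)" for k by (rule E(6)[OF bounded_linear_imult Ai, symmetric])
    then show "(\<lambda>k. E k t (imult x)) \<longlonglongrightarrow> imult (U t x)"
      by (simp add: bounded_linear.tendsto[OF bounded_linear_imult U])
  qed
  have U0: "U 0 x = x" for x by (rule LIMSEQ_unique[OF U]) (simp add: E(3))
  have Uadd: "U (s + t) x = U s (U t x)" for s t x
  proof (rule LIMSEQ_unique[OF U])
    have "(\<lambda>k. E k s (E k t x - U t x)) \<longlonglongrightarrow> 0"
      by (rule tendsto_norm_zero_cancel) (unfold E(2), intro tendsto_norm_zero LIM_zero U)
    from tendsto_add[OF this U[of s "U t x"]]
    show "(\<lambda>k. E k (s + t) x) \<longlonglongrightarrow> U s (U t x)" by (simp add: Elin E(4))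
  qed
  \<comment> \<open>Strong continuity at time 0 uniformly in \<open>k\<close>, so that it passes to
    the limit \<open>U\<close> and also controls the difference quotients below.\<close>
  have equi: "\<exists>d>0. \<forall>k s. \<bar>s\<bar> < d \<longrightarrow> norm (E k s y - y) < e" if e: "e > 0" for y e
  proof -
    obtain z where z: "z \<in> fst H" "norm (y - z) < e / 3"
      using closure_UNIV_approx[OF D(2), of "e / 3" y] e by auto
    define d where "d = e / 3 / (norm (snd H z) + 1)"
    have d: "d > 0" using e by (simp add: d_def add_nonneg_pos)
    have "norm (E k s y - y) < e" if s: "\<bar>s\<bar> < d" for k s
    proof -
      have "norm (E k s z - E k 0 z) \<le> norm (A k z) * \<bar>s\<bar>"
        by (rule vector_mean_value_bound[OF E(5)]) (simp add: EA E(2))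
      also have "\<dots> \<le> norm (snd H z) * \<bar>s\<bar>" by (intro mult_right_mono An z) auto
      also have "\<dots> \<le> norm (snd H z) * d" using s by (intro mult_left_mono) auto
      also have "\<dots> \<le> e / 3" 
      proof -
        have "norm (snd H z) * d \<le> (norm (snd H z) + 1) * d" using d by (simp add: algebra_simps)
        also have "\<dots> = e / 3"
          using add_nonneg_pos[OF norm_ge_zero zero_less_one, of "snd H z"] by (simp add: d_def del: divide_divide_eq_left)
        finally show ?thesis .
      qed
      finally have 1: "norm (E k s z - z) \<le> e / 3" by (simp add: E(3))
      have "E k s y - y = E k s (y - z) + (E k s z - z) - (y - z)" by (simp add: Elin)
      then have "norm (E k s y - y) \<le> norm (E k s (y - z)) + norm (E k s z - z) + norm (y - z)"
        by (simp only: norm_add_diff_le)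
      then show ?thesis using 1 z(2) by (simp add: E(2))
    qed
    then show ?thesis using d by blast
  qed
  have Ucont: "continuous_on UNIV (\<lambda>t. U t x)" for x
    unfolding continuous_on_iff
  proof (intro ballI allI impI)
    fix t and e :: real assume "e > 0"
    then obtain d where d: "d > 0" "\<And>k s. \<bar>s\<bar> < d \<Longrightarrow> norm (E k s x - x) < e / 2" using equi[of "e / 2" x] by auto
    have "dist (U s x) (U t x) < e" if "dist s t < d" for s
    proof -
      have "norm (U (s - t) x - x) \<le> e / 2"
      proof (rule LIMSEQ_le_const2)
        show "(\<lambda>k. norm (E k (s - t) x - x)) \<longlonglongrightarrow> norm (U (s - t) x - x)" by (intro tendsto_intros U)
        show "\<exists>N. \<forall>k\<ge>N. norm (E k (s - t) x - x) \<le> e / 2"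
          using d(2)[of "s - t"] that by (auto simp: dist_real_def intro: less_imp_le)
      qed
      moreover have "U s x - U t x = U t (U (s - t) x - x)"
        using Uadd[of t "s - t" x] by (simp add: Udiff)
      ultimately show ?thesis using \<open>e > 0\<close> by (simp add: dist_norm Un)
    qed
    then show "\<exists>d>0. \<forall>s\<in>UNIV. dist s t < d \<longrightarrow> dist (U s x) (U t x) < e" using d(1) by blast
  qed
  have gen: "((\<lambda>s. (1 / s) *\<^sub>R (U s x - x)) \<longlongrightarrow> - imult (snd H x)) (at 0)" if x: "x \<in> fst H" for x
    unfolding LIM_eq
  proof (intro allI impI)
    fix e :: real assume e: "0 < e"
    define z where "z = - imult (snd H x)"
    obtain d where d: "d > 0" "\<And>k s. \<bar>s\<bar> < d \<Longrightarrow> norm (E k s z - z) < e / 2" using equi[of "e / 2" z] e by auto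
    have "norm ((1 / t) *\<^sub>R (U t x - x) - z) < e" if t: "t \<noteq> 0" "\<bar>t\<bar> < d" for t
    proof -
      \<comment> \<open>Derivatives need not pass to pointwise limits, so the first-order remainder
        is estimated for each \<open>k\<close> with a bound whose limit is
        \<open>e / 2 * \<bar>t\<bar>\<close>.\<close>
      have *: "norm (E k t x - x - t *\<^sub>R z) \<le> (norm (A k x - z) + e / 2) * \<bar>t\<bar>" for k
      proof -
        have "norm ((E k t x - t *\<^sub>R z) - (E k 0 x - 0 *\<^sub>R z)) \<le> (norm (A k x - z) + e / 2) * \<bar>t\<bar>"
        proof (rule vector_mean_value_bound)
          show "((\<lambda>s. E k s x - s *\<^sub>R z) has_vector_derivative A k (E k s x) - 1 *\<^sub>R z) (at s)" for s
            by (intro has_vector_derivative_diff E(5) bounded_linear.has_vector_derivative[OF bounded_linear_scaleR_left]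
                has_vector_derivative_id)
          fix s assume "\<bar>s\<bar> \<le> \<bar>t\<bar>"
          then have "norm (E k s z - z) \<le> e / 2" using d(2)[of s k] t by simp
          then have "norm (E k s (A k x - z) + (E k s z - z)) \<le> norm (A k x - z) + e / 2"
            using norm_triangle_ineq[of "E k s (A k x - z)" "E k s z - z"] E(2)[of k s "A k x - z"] by linarith
          moreover have "A k (E k s x) - 1 *\<^sub>R z = E k s (A k x - z) + (E k s z - z)" by (simp add: EA Elin)
          ultimately show "norm (A k (E k s x) - 1 *\<^sub>R z) \<le> norm (A k x - z) + e / 2"
            by (simp only:)
        qed
        then show ?thesis by (simp add: E(3) algebra_simps)
      qed
      have "norm (U t x - x - t *\<^sub>R z) \<le> (0 + e / 2) * \<bar>t\<bar>"
      proof (rule LIMSEQ_le)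
        show "(\<lambda>k. norm (E k t x - x - t *\<^sub>R z)) \<longlonglongrightarrow> norm (U t x - x - t *\<^sub>R z)" by (intro tendsto_intros U)
        show "(\<lambda>k. (norm (A k x - z) + e / 2) * \<bar>t\<bar>) \<longlonglongrightarrow> (0 + e / 2) * \<bar>t\<bar>"
          using Alim[OF x, folded z_def] by (intro tendsto_intros tendsto_norm_zero LIM_zero)
        show "\<exists>N. \<forall>k\<ge>N. norm (E k t x - x - t *\<^sub>R z) \<le> (norm (A k x - z) + e / 2) * \<bar>t\<bar>" using * by blast
      qed
      moreover have "(1 / t) *\<^sub>R (U t x - x) - z = (1 / t) *\<^sub>R (U t x - x - t *\<^sub>R z)"
        using t by (simp add: scaleR_diff_right)
      then have "norm ((1 / t) *\<^sub>R (U t x - x) - z) = norm (U t x - x - t *\<^sub>R z) / \<bar>t\<bar>" by simp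
      ultimately have "norm ((1 / t) *\<^sub>R (U t x - x) - z) \<le> e / 2" using t by (simp add: pos_divide_le_eq)
      then show ?thesis using e by simp
    qed
    then show "\<exists>s>0. \<forall>t. t \<noteq> 0 \<and> norm (t - 0) < s \<longrightarrow> norm ((1 / t) *\<^sub>R (U t x - x) - - imult (snd H x)) < e"
      using d(1) by (auto simp: z_def)
  qed
  have dom: "x \<in> fst H" if y: "((\<lambda>s. (1 / s) *\<^sub>R (U s x - x)) \<longlongrightarrow> y) (at 0)" for x y
  proof -
    have "filterlim uminus (at 0) (at (0::real))"
      unfolding filterlim_at by (auto simp: eventually_at_filter intro!: tendsto_eq_intros)
    from filterlim_compose[OF y this]
    have y': "((\<lambda>s. (1 / (- s)) *\<^sub>R (U (- s) x - x)) \<longlongrightarrow> y) (at 0)" .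
    \<comment> \<open>Unitarity moves the quotient from \<open>u\<close> at time \<open>s\<close> to
      \<open>x\<close> at time \<open>- s\<close>. The limit is an adjoint relation for
      \<open>imult x\<close>, which self-adjointness turns into membership in
      \<open>D(H)\<close>.\<close>
    have eq: "inner (snd H u) (imult x) = inner u (- y)" if u: "u \<in> fst H" for u
    proof -
      have "inner (- imult (snd H u)) x = inner u (- y)"
      proof (rule tendsto_unique)
        show "((\<lambda>s. inner ((1 / s) *\<^sub>R (U s u - u)) x) \<longlongrightarrow> inner (- imult (snd H u)) x) (at 0)"
          by (intro tendsto_intros gen[OF u])
        have "inner (U s u) x = inner u (U (- s) x)" for s
          using linear_isometry_inner[OF bounded_linear.linear[OF Ubl] Un, of s u "U (- s) x"]
            Uadd[of s "- s" x] by (simp add: U0)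
        then have "inner ((1 / s) *\<^sub>R (U s u - u)) x = inner u (- ((1 / (- s)) *\<^sub>R (U (- s) x - x)))" for s
          by (simp add: inner_diff_left inner_diff_right)
        then show "((\<lambda>s. inner ((1 / s) *\<^sub>R (U s u - u)) x) \<longlongrightarrow> inner u (- y)) (at 0)"
          by (simp only:) (intro tendsto_intros y')
      qed simp
      then show ?thesis by (simp add: inner_imult_swap)
    qed
    have "imult x \<in> fst H" by (rule op_self_adjoint_adjI(1)[OF H eq])
    then have "(-1) *\<^sub>R imult (imult x) \<in> fst H" by (rule D(6)[OF D(3)])
    then show ?thesis unfolding imult_imult by simp
  qed
  have "unitary_group_of H U"
    unfolding unitary_group_of_def
  proof (intro conjI allI ballI)
    show "U 0 = id" "U (s + t) = U s \<circ> U t" for s t using U0 Uadd by auto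
    show "x \<in> fst H \<longleftrightarrow> (\<exists>y. ((\<lambda>s. (1 / s) *\<^sub>R (U s x - x)) \<longlongrightarrow> y) (at 0))" for x
      using dom[of x] gen[of x] by auto
  qed (fact Ubl Un Ui Ucont gen)+
  then show ?thesis by blast
qed

lemma expmi_unitary_group:
  assumes "op_self_adjoint A" "op_nonneg A"
  shows "unitary_group_of A (expmi A)"
proof -
  obtain U where U: "unitary_group_of A U" using stone_nonneg[OF assms] by blast
  have "(THE U. unitary_group_of A U) = U"
    by (rule the_equality, rule U) (rule unitary_group_unique[OF assms(1) _ U])
  then show ?thesis using U by (simp add: expmi_def[abs_def])
qed

subsection \<open>Uniform boundedness and finite-dimensional subspaces\<close>

text \<open>The closed sets \<open>E n\<close> cover the space, so by Baire one of them contains a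
  ball.\<close>

lemma uniform_boundedness:
  fixes T :: "'i \<Rightarrow> 'a::banach \<Rightarrow> 'b::real_normed_vector"
  assumes bl: "\<And>i. i \<in> I \<Longrightarrow> bounded_linear (T i)" and pw: "\<And>x. \<exists>C. \<forall>i\<in>I. norm (T i x) \<le> C"
  obtains C where "C \<ge> 0" "\<And>i x. i \<in> I \<Longrightarrow> norm (T i x) \<le> C * norm x"
proof -
  define E where "E n = {x. \<forall>i\<in>I. norm (T i x) \<le> real n}" for n
  have cl: "closed (E n)" for n
  proof -
    have "E n = (\<Inter>i\<in>I. {x. norm (T i x) \<le> real n})" by (auto simp: E_def)
    moreover have "closed {x. norm (T i x) \<le> real n}" if "i \<in> I" for i
      by (intro closed_Collect_le continuous_on_norm linear_continuous_on bl[OF that] continuous_on_const)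
    ultimately show ?thesis by auto
  qed
  have un: "\<Union>(range E) = UNIV"
  proof -
    have "\<exists>n. x \<in> E n" for x
    proof -
      obtain C where C: "\<forall>i\<in>I. norm (T i x) \<le> C" using pw[of x] by blast
      obtain n :: nat where "C \<le> real n" using real_arch_simple by blast
      then have "x \<in> E n" using C by (force simp: E_def)
      then show ?thesis by blast
    qed
    then show ?thesis by blast
  qed
  have "\<exists>n. interior (E n) \<noteq> {}"
  proof (rule ccontr)
    assume n: "\<not> (\<exists>n. interior (E n) \<noteq> {})"
    have "(euclidean :: 'a topology) interior_of \<Union>(range E) = {}"
      by (rule Baire_category_alt) (use n cl completely_metrizable_space_euclidean in auto)
    then show False by (simp add: un)
  qed
  then obtain n x0 where "x0 \<in> interior (E n)" by blast
  then obtain r where r: "r > 0" "ball x0 r \<subseteq> E n" by (meson mem_interior)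
  show thesis
  proof (rule that[of "4 * real n / r"])
    show "4 * real n / r \<ge> 0" using r by simp
    fix i x assume i: "i \<in> I"
    interpret bounded_linear "T i" by (rule bl[OF i])
    show "norm (T i x) \<le> 4 * real n / r * norm x"
    proof (cases "x = 0")
      case False
      define y where "y = (r / (2 * norm x)) *\<^sub>R x"
      have "norm y < r" using False r by (simp add: y_def)
      then have "x0 + y \<in> E n" "x0 \<in> E n" using r by (auto simp: dist_norm subset_iff)
      then have "norm (T i (x0 + y)) \<le> n" "norm (T i x0) \<le> n" using i by (auto simp: E_def)
      moreover have "T i y = T i (x0 + y) - T i x0" by (simp add: add)
      ultimately have "norm (T i y) \<le> 2 * real n"
        using norm_triangle_ineq4[of "T i (x0 + y)" "T i x0"] by simp
      moreover have "norm (T i y) = r / (2 * norm x) * norm (T i x)" using r by (simp add: y_def scaleR)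
      ultimately show ?thesis using False r by (simp add: field_simps)
    qed (simp add: zero)
  qed
qed

text \<open>Adjoining one vector \<open>b\<close> at positive distance \<open>d\<close> from a
  closed span: \<open>d\<close> bounds the coefficient of \<open>b\<close> by the norm, so
  coefficients of a convergent sequence are Cauchy.\<close>

lemma closed_span_finite:
  fixes B :: "'a::real_normed_vector set"
  assumes "finite B"
  shows "closed (span B)"
  using assms
proof (induction B)
  case (insert b B)
  show ?case
  proof (cases "b \<in> span B")
    case True then show ?thesis using insert by (simp add: span_redundant)
  next
    case False
    define d where "d = infdist b (span B)"
    have "span B \<noteq> {}" using span_zero by blast
    have d: "d > 0" unfolding d_def
      using False insert.IH infdist_pos_not_in_closed[OF insert.IH \<open>span B \<noteq> {}\<close>] by blast
    have lower: "\<bar>r\<bar> * d \<le> norm (r *\<^sub>R b + y)" if y: "y \<in> span B" for r y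
    proof (cases "r = 0")
      case False
      have "(- 1 / r) *\<^sub>R y \<in> span B" using y by (rule span_scale)
      then have "d \<le> norm (b - (- 1 / r) *\<^sub>R y)" unfolding d_def
        by (metis infdist_le dist_norm)
      then have "\<bar>r\<bar> * d \<le> \<bar>r\<bar> * norm (b - (- 1 / r) *\<^sub>R y)" by (simp add: mult_left_mono)
      also have "\<dots> = norm (r *\<^sub>R (b - (- 1 / r) *\<^sub>R y))" by simp
      also have "r *\<^sub>R (b - (- 1 / r) *\<^sub>R y) = r *\<^sub>R b + y" using False by (simp add: scaleR_add_right)
      finally show ?thesis .
    qed simp
    show ?thesis unfolding closed_sequential_limits
    proof (intro allI impI, elim conjE)
      fix X x assume X: "\<forall>n. X n \<in> span (insert b B)" and lim: "X \<longlonglongrightarrow> x"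
      have "\<exists>k. X n - k *\<^sub>R b \<in> span B" for n
        using spec[OF X, of n] by (simp add: span_breakdown_eq)
      then have "\<exists>k. \<forall>n. X n - k n *\<^sub>R b \<in> span B" by (intro choice allI)
      then obtain k where k: "\<And>n. X n - k n *\<^sub>R b \<in> span B" by blast
      have dk: "\<bar>k m - k n\<bar> * d \<le> norm (X m - X n)" for m n
      proof -
        have "(X m - k m *\<^sub>R b) - (X n - k n *\<^sub>R b) \<in> span B" by (intro span_diff k)
        from lower[OF this, of "k m - k n"] show ?thesis by (simp add: algebra_simps)
      qed
      have "Cauchy k"
      proof (rule metric_CauchyI)
        fix e :: real assume e: "e > 0"
        then have "e * d > 0" using d by simp
        from metric_CauchyD[OF LIMSEQ_imp_Cauchy[OF lim] this]
        obtain M where M: "\<forall>m\<ge>M. \<forall>n\<ge>M. dist (X m) (X n) < e * d" by blast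
        have "dist (k m) (k n) < e" if "m \<ge> M" "n \<ge> M" for m n
        proof -
          have "\<bar>k m - k n\<bar> * d < e * d" using M that dk[of m n] by (force simp: dist_norm)
          then show ?thesis using d by (simp add: dist_real_def)
        qed
        then show "\<exists>M. \<forall>m\<ge>M. \<forall>n\<ge>M. dist (k m) (k n) < e" by blast
      qed
      then obtain l where l: "k \<longlonglongrightarrow> l" unfolding Cauchy_convergent_iff convergent_def by blast
      have "(\<lambda>n. X n - k n *\<^sub>R b) \<longlonglongrightarrow> x - l *\<^sub>R b" by (intro tendsto_intros lim l)
      then have "x - l *\<^sub>R b \<in> span B" by (rule closed_sequentially[OF insert.IH, rotated]) (rule k)
      then show "x \<in> span (insert b B)" by (auto simp: span_breakdown_eq)
    qed
  qed
qed simp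

lemma closed_subspace_finite_span:
  fixes V :: "'a::real_normed_vector set"
  assumes "subspace V" "finite B" "V \<subseteq> span B"
  shows "closed V"
proof -
  obtain A where A: "A \<subseteq> V" "independent A" "V \<subseteq> span A" using maximal_independent_subset[of V] by blast
  have "finite A" using independent_span_bound[OF assms(2) A(2)] A(1) assms(3) by blast
  moreover have "V = span A" using A assms(1) by (simp add: span_minimal subset_antisym)
  ultimately show ?thesis by (simp add: closed_span_finite)
qed

text \<open>Turns form estimates, tested against a dense set, into norm estimates.\<close>

lemma norm_le_of_inner_bound:
  fixes x :: "'a::real_inner"
  assumes D: "closure D = UNIV" and b: "\<And>w. w \<in> D \<Longrightarrow> inner x w \<le> c * norm w" and "c \<ge> 0"
  shows "norm x \<le> c"
proof (cases "x = 0")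
  case False
  have "closed {w. inner x w \<le> c * norm w}" by (intro closed_Collect_le continuous_intros)
  moreover have "D \<subseteq> {w. inner x w \<le> c * norm w}" using b by auto
  ultimately have "closure D \<subseteq> {w. inner x w \<le> c * norm w}" by (rule closure_minimal[rotated])
  then have "inner x x \<le> c * norm x" using D by auto
  then have "norm x * norm x \<le> c * norm x" by (simp add: power2_norm_eq_inner[symmetric] power2_eq_square)
  then show ?thesis using False by simp
qed (simp add: assms)

subsection \<open>Form estimates for the unitary group\<close>

lemma orth_projD:
  assumes "orth_proj P"
  shows "bounded_linear P" "P (P x) = P x" "inner (P x) y = inner x (P y)" "P (imult x) = imult (P x)"
    "P (x + y) = P x + P y" "P (x - y) = P x - P y" "P (r *\<^sub>R x) = r *\<^sub>R P x" "norm (P x) \<le> norm x"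
    "norm (x - P x) \<le> norm x" "(norm x)\<^sup>2 = (norm (x - P x))\<^sup>2 + (norm (P x))\<^sup>2"
proof -
  show 1: "bounded_linear P" "P (P x) = P x" "inner (P x) y = inner x (P y)" "P (imult x) = imult (P x)" for x y
    using assms by (auto simp: orth_proj_def)
  show "P (x + y) = P x + P y" "P (x - y) = P x - P y" "P (r *\<^sub>R x) = r *\<^sub>R P x"
    using bounded_linear.linear[OF 1(1)] by (simp_all add: linear_add linear_diff linear_scale)
  show p: "(norm x)\<^sup>2 = (norm (x - P x))\<^sup>2 + (norm (P x))\<^sup>2"
    using 1(3)[of x "P x"] by (simp add: power2_norm_eq_inner inner_diff_left inner_diff_right 1(2) inner_commute)
  show "norm (P x) \<le> norm x" "norm (x - P x) \<le> norm x"
    by (rule power2_le_imp_le; use p in simp)+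
qed

text \<open>For \<open>v\<close> in \<open>D(H)\<close> the derivative of
  \<open>inner (U s v) w\<close> is \<open>- inner (imult (U s (S v))) (S w)\<close> with
  \<open>S\<close> the square root of \<open>H\<close>, so the first-order error is governed by the
  modulus of continuity \<open>k\<close> of the group at \<open>S v\<close>. Only \<open>S v\<close>
  and \<open>S w\<close> occur, so approximation along the core extends this to the form
  domain.\<close>

lemma unitary_group_form_estimate:
  fixes H :: "('a::complex_hilbert) set \<times> ('a \<Rightarrow> 'a)"
  assumes H: "op_self_adjoint H" and pos: "op_nonneg H" and U: "unitary_group_of H U"
    and v: "v \<in> fst (op_sqrt H)" and w: "w \<in> fst (op_sqrt H)"
    and k: "\<And>s. \<bar>s\<bar> \<le> \<bar>t\<bar> \<Longrightarrow> norm (U s (snd (op_sqrt H) v) - snd (op_sqrt H) v) \<le> k"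
  shows "\<bar>inner (U t v - v) w + t * inner (imult (snd (op_sqrt H) v)) (snd (op_sqrt H) w)\<bar>
    \<le> k * norm (snd (op_sqrt H) w) * \<bar>t\<bar>"
proof -
  define S where "S = snd (op_sqrt H)"
  note sq = op_sqrt_is_sqrt[OF H pos]
  have Ssa: "op_self_adjoint (op_sqrt H)" using sq by blast
  note D = op_self_adjointD[OF Ssa, folded S_def]
  have US: "U s x \<in> fst (op_sqrt H)" "S (U s x) = U s (S x)" if "x \<in> fst (op_sqrt H)" for s x
    using op_sqrt_commutes[OF H pos unitary_group_ofD(1)[OF U] unitary_group_commutes[OF U]] that
    by (auto simp: op_commutes_def S_def)
  have main: "\<bar>inner (U t v - v) w + t * inner (imult (S v)) (S w)\<bar> \<le> k * norm (S w) * \<bar>t\<bar>"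
    if v: "v \<in> fst H" and k: "\<And>s. \<bar>s\<bar> \<le> \<bar>t\<bar> \<Longrightarrow> norm (U s (S v) - S v) \<le> k" for v k
  proof -
    define g where "g s = inner (U s v) w + s * inner (imult (S v)) (S w)" for s
    have dom: "x \<in> fst (op_sqrt H)" "S x \<in> fst (op_sqrt H)" "snd H x = S (S x)" if "x \<in> fst H" for x
      using sq that by (auto simp: S_def)
    have Uv: "U s v \<in> fst H" for s using unitary_group_commutes[OF U] v by (auto simp: op_commutes_def)
    have "norm (g t - g 0) \<le> k * norm (S w) * \<bar>t\<bar>"
    proof (rule vector_mean_value_bound)
      fix s
      have "inner (- imult (snd H (U s v))) w = - inner (imult (U s (S v))) (S w)"
      proof -
        have "inner (imult (snd H (U s v))) w = inner (S (imult (S (U s v)))) w"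
          by (simp add: dom[OF Uv] D)
        also have "\<dots> = inner (imult (S (U s v))) (S w)" by (intro D dom[OF Uv] w)
        finally show ?thesis by (simp add: US dom[OF v])
      qed
      moreover have "(g has_vector_derivative inner (- imult (snd H (U s v))) w + 1 * inner (imult (S v)) (S w)) (at s)"
        unfolding g_def
        by (intro has_vector_derivative_add bounded_linear.has_vector_derivative[OF bounded_linear_inner_left]
            bounded_linear.has_vector_derivative[OF bounded_linear_mult_left]
            unitary_group_derivative(1)[OF U v] has_vector_derivative_id)
      ultimately show "(g has_vector_derivative - inner (imult (U s (S v) - S v)) (S w)) (at s)"
        by (simp add: linear_diff[OF bounded_linear.linear[OF bounded_linear_imult]] inner_diff_left)
      assume s: "\<bar>s\<bar> \<le> \<bar>t\<bar>"
      have "norm (- inner (imult (U s (S v) - S v)) (S w)) \<le> norm (imult (U s (S v) - S v)) * norm (S w)"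
        using Cauchy_Schwarz_ineq2[of "imult (U s (S v) - S v)" "S w"] by simp
      also have "\<dots> \<le> k * norm (S w)" using k[OF s] by (simp add: mult_right_mono)
      finally show "norm (- inner (imult (U s (S v) - S v)) (S w)) \<le> k * norm (S w)" .
    qed
    then show ?thesis by (simp add: g_def unitary_group_ofD[OF U] inner_diff_left algebra_simps)
  qed
  obtain u where u: "\<And>n::nat. u n \<in> fst H" "u \<longlonglongrightarrow> v" "(\<lambda>n. S (u n)) \<longlonglongrightarrow> S v"
    using op_sqrt_core[OF H pos v] by (auto simp: S_def)
  \<comment> \<open>The vanishing term \<open>norm (S v - S v)\<close> is kept so that the
    right-hand side is visibly the limit of the bounds for the approximants.\<close>
  have "\<bar>inner (U t v - v) w + t * inner (imult (S v)) (S w)\<bar> \<le> (k + 2 * norm (S v - S v)) * norm (S w) * \<bar>t\<bar>"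
  proof (rule LIMSEQ_le)
    show "(\<lambda>n. \<bar>inner (U t (u n) - u n) w + t * inner (imult (S (u n))) (S w)\<bar>) \<longlonglongrightarrow>
        \<bar>inner (U t v - v) w + t * inner (imult (S v)) (S w)\<bar>"
      by (intro tendsto_intros u bounded_linear.tendsto[OF bounded_linear_imult]
          bounded_linear.tendsto[OF unitary_group_ofD(1)[OF U]])
    show "(\<lambda>n. (k + 2 * norm (S (u n) - S v)) * norm (S w) * \<bar>t\<bar>) \<longlonglongrightarrow>
        (k + 2 * norm (S v - S v)) * norm (S w) * \<bar>t\<bar>"
      by (intro tendsto_intros u)
    have "\<bar>inner (U t (u n) - u n) w + t * inner (imult (S (u n))) (S w)\<bar>
        \<le> (k + 2 * norm (S (u n) - S v)) * norm (S w) * \<bar>t\<bar>" for n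
    proof (rule main[OF u(1)])
      fix s assume "\<bar>s\<bar> \<le> \<bar>t\<bar>"
      then have 1: "norm (U s (S v) - S v) \<le> k" using k by (simp add: S_def)
      have "U s (S (u n)) - S (u n) = U s (S (u n) - S v) + (U s (S v) - S v) - (S (u n) - S v)"
        by (simp add: unitary_group_ofD_diff[OF U])
      then have "norm (U s (S (u n)) - S (u n)) \<le>
          norm (U s (S (u n) - S v)) + norm (U s (S v) - S v) + norm (S (u n) - S v)"
        by (simp only: norm_add_diff_le)
      then show "norm (U s (S (u n)) - S (u n)) \<le> k + 2 * norm (S (u n) - S v)"
        using 1 by (simp add: unitary_group_ofD(2)[OF U])
    qed
    then show "\<exists>N. \<forall>n\<ge>N. \<bar>inner (U t (u n) - u n) w + t * inner (imult (S (u n))) (S w)\<bar>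
        \<le> (k + 2 * norm (S (u n) - S v)) * norm (S w) * \<bar>t\<bar>" by blast
  qed
  then show ?thesis by (simp add: S_def)
qed

text \<open>The crude modulus \<open>2 * norm (S v)\<close> plus the size of the linear term account
  for the factor 3.\<close>

lemma unitary_group_form_bound:
  fixes H :: "('a::complex_hilbert) set \<times> ('a \<Rightarrow> 'a)"
  assumes H: "op_self_adjoint H" "op_nonneg H" and U: "unitary_group_of H U"
    and v: "v \<in> fst (op_sqrt H)" and w: "w \<in> fst (op_sqrt H)"
  shows "\<bar>inner (U t v - v) w\<bar> \<le> 3 * norm (snd (op_sqrt H) v) * norm (snd (op_sqrt H) w) * \<bar>t\<bar>"
proof -
  define S where "S = snd (op_sqrt H)"
  have "norm (U s (S v) - S v) \<le> 2 * norm (S v)" for s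
    using norm_triangle_ineq4[of "U s (S v)" "S v"] by (simp add: unitary_group_ofD(2)[OF U])
  from unitary_group_form_estimate[OF H U v w, folded S_def, OF this]
  have "\<bar>inner (U t v - v) w + t * inner (imult (S v)) (S w)\<bar> \<le> 2 * norm (S v) * norm (S w) * \<bar>t\<bar>" .
  moreover have "\<bar>t * inner (imult (S v)) (S w)\<bar> \<le> \<bar>t\<bar> * (norm (S v) * norm (S w))"
    using Cauchy_Schwarz_ineq2[of "imult (S v)" "S w"] by (simp add: abs_mult mult_left_mono)
  ultimately show ?thesis unfolding S_def[symmetric] by (simp add: algebra_simps)
qed

text \<open>For an isometry the square norm of \<open>U t v - v\<close> equals
  \<open>- 2 * inner (U t v - v) v\<close>, which the form bound controls. The rate is uniform over
  vectors with bounded form, unlike strong continuity.\<close>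

lemma unitary_group_sqrt_bound:
  fixes H :: "('a::complex_hilbert) set \<times> ('a \<Rightarrow> 'a)"
  assumes H: "op_self_adjoint H" "op_nonneg H" and U: "unitary_group_of H U" and v: "v \<in> fst (op_sqrt H)"
  shows "(norm (U t v - v))\<^sup>2 \<le> 6 * \<bar>t\<bar> * (norm (snd (op_sqrt H) v))\<^sup>2"
proof -
  have "inner (U t v) (U t v) = inner v v" using unitary_group_ofD(2)[OF U] by (simp add: norm_eq_sqrt_inner)
  then have "(norm (U t v - v))\<^sup>2 = - 2 * inner (U t v - v) v"
    by (simp add: power2_norm_eq_inner inner_diff_left inner_diff_right inner_commute)
  also have "\<dots> \<le> 2 * \<bar>inner (U t v - v) v\<bar>" by simp
  also have "\<dots> \<le> 2 * (3 * norm (snd (op_sqrt H) v) * norm (snd (op_sqrt H) v) * \<bar>t\<bar>)"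
    by (intro mult_left_mono unitary_group_form_bound[OF H U v v]) simp
  finally show ?thesis by (simp add: power2_eq_square algebra_simps)
qed

lemma funpow_telescope:
  fixes G V :: "'a::real_normed_vector \<Rightarrow> 'a"
  assumes G: "linear G" "\<And>x. norm (G x) \<le> norm x"
    and c: "\<And>k. k < n \<Longrightarrow> norm (G ((V ^^ k) f) - V ((V ^^ k) f)) \<le> c"
  shows "norm ((G ^^ n) f - (V ^^ n) f) \<le> real n * c"
  using c
proof (induction n)
  case (Suc n)
  have "(G ^^ Suc n) f - (V ^^ Suc n) f = G ((G ^^ n) f - (V ^^ n) f) + (G ((V ^^ n) f) - V ((V ^^ n) f))"
    by (simp add: linear_diff[OF G(1)])
  then have "norm ((G ^^ Suc n) f - (V ^^ Suc n) f) \<le>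
      norm (G ((G ^^ n) f - (V ^^ n) f)) + norm (G ((V ^^ n) f) - V ((V ^^ n) f))"
    by (simp only: norm_triangle_ineq)
  also have "\<dots> \<le> real n * c + c"
    using Suc by (intro add_mono order_trans[OF G(2)]) auto
  finally show ?case by (simp add: algebra_simps)
qed simp

subsection \<open>Product formulas\<close>

locale zeno_family =
  fixes H :: "('a::complex_hilbert) set \<times> ('a \<Rightarrow> 'a)"
    and P :: "'a \<Rightarrow> 'a" and Pt :: "real \<Rightarrow> 'a \<Rightarrow> 'a" and \<delta> :: real
  assumes H_sa: "op_self_adjoint H" and H_nonneg: "op_nonneg H"
    and P_proj: "orth_proj P" and P_fin: "finite_rank P"
    and \<delta>_pos: "\<delta> > 0"
    and Pt_proj: "\<And>t. \<bar>t\<bar> < \<delta> \<Longrightarrow> orth_proj (Pt t)"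
    and Pt_cont: "\<And>f. continuous_on {-\<delta><..<\<delta>} (\<lambda>t. Pt t f)"
    and Pt_0: "Pt 0 = P"
    and Pt_dom: "\<And>t. \<bar>t\<bar> < \<delta> \<Longrightarrow> form_dom H P \<subseteq> form_dom H (Pt t)"
    and Pt_lim: "\<And>v. v \<in> form_dom H P \<Longrightarrow>
       ((\<lambda>t. norm (snd (op_sqrt H) (Pt t v))) \<longlongrightarrow> norm (snd (op_sqrt H) (P v))) (at 0)"
    and dense: "closure (form_dom H P) = UNIV"
begin

abbreviation "DS \<equiv> fst (op_sqrt H)"
abbreviation "S \<equiv> snd (op_sqrt H)"
abbreviation "U \<equiv> expmi H"
abbreviation "HP \<equiv> op_HP H P"
abbreviation "W \<equiv> expmi HP"

section \<open>Boundedness and convergence of \<open>T\<close>\<close>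

definition T :: "real \<Rightarrow> 'a \<Rightarrow> 'a" where "T p v = S (Pt p v)"

lemma S_sa: "op_self_adjoint (op_sqrt H)"
  using op_sqrt_is_sqrt[OF H_sa H_nonneg] by blast

lemmas SD = op_self_adjointD[OF S_sa]

lemma U: "unitary_group_of H U"
  by (rule expmi_unitary_group[OF H_sa H_nonneg])

text \<open>A dense subspace of \<open>\<H>\<close> is mapped by \<open>P\<close> onto a dense, hence full, subspace of the
  finite-dimensional range of \<open>P\<close>.\<close>

lemma P_in_DS: "P v \<in> DS"
proof -
  note PD = orth_projD[OF P_proj]
  obtain B where B: "finite B" "range P \<subseteq> span B" using P_fin by (auto simp: finite_rank_def)
  have sub: "subspace (form_dom H P)"
    using SD(1) linear_0[OF bounded_linear.linear[OF PD(1)]]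
    by (auto simp: subspace_def form_dom_def PD)
  have "subspace (P ` form_dom H P)"
    by (rule linear_subspace_image[OF bounded_linear.linear[OF PD(1)] sub])
  then have cl: "closed (P ` form_dom H P)"
    by (rule closed_subspace_finite_span[OF _ B(1)]) (use B(2) in auto)
  obtain x where x: "\<And>n::nat. x n \<in> form_dom H P" "x \<longlonglongrightarrow> v"
    using dense closure_sequential[of v "form_dom H P"] by auto
  have "(\<lambda>n. P (x n)) \<longlonglongrightarrow> P v" by (rule bounded_linear.tendsto[OF PD(1) x(2)])
  then have "P v \<in> P ` form_dom H P"
    by (rule closed_sequentially[OF cl, rotated]) (use x in auto)
  then show ?thesis by (auto simp: form_dom_def)
qed

lemma form_dom_UNIV: "form_dom H P = UNIV"
  using P_in_DS by (auto simp: form_dom_def)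

lemma Pt_in_DS: "\<bar>p\<bar> < \<delta> \<Longrightarrow> Pt p v \<in> DS"
  using Pt_dom[of p] form_dom_UNIV by (auto simp: form_dom_def)

lemma T_linear:
  assumes p: "\<bar>p\<bar> < \<delta>"
  shows "T p (x + y) = T p x + T p y" "T p (x - y) = T p x - T p y" "T p (r *\<^sub>R x) = r *\<^sub>R T p x"
    "T p (imult x) = imult (T p x)"
  using orth_projD[OF Pt_proj[OF p]] Pt_in_DS[OF p]
  by (simp_all add: T_def SD op_self_adjoint_diff[OF S_sa])

text \<open>On the dense domain of \<open>S\<close> this identifies the adjoint of
  \<open>T p\<close> as \<open>Pt p \<circ> S\<close>. Boundedness of \<open>T p\<close>, its weak
  convergence and the convergence of adjoints all rest on it.\<close>

lemma inner_T: "\<bar>p\<bar> < \<delta> \<Longrightarrow> w \<in> DS \<Longrightarrow> inner (T p v) w = inner v (Pt p (S w))"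
  using SD(10)[OF Pt_in_DS, of p w v] orth_projD(3)[OF Pt_proj] by (simp add: T_def)

text \<open>Uniform boundedness in place of a closed graph argument: the functionals
  \<open>inner v (Pt p (S w))\<close>, with \<open>w\<close> in the unit ball of the domain of
  \<open>S\<close>, are bounded pointwise by \<open>norm (T p v)\<close>.\<close>

lemma T_bounded_linear:
  assumes p: "\<bar>p\<bar> < \<delta>"
  shows "bounded_linear (T p)"
proof -
  have bl: "bounded_linear (\<lambda>v. inner v (Pt p (S w)))" for w by (rule bounded_linear_inner_left)
  have pw: "\<exists>C. \<forall>w\<in>{w\<in>DS. norm w \<le> 1}. norm (inner v (Pt p (S w))) \<le> C" for v
  proof (intro exI[of _ "norm (T p v)"] ballI)
    fix w assume w: "w \<in> {w\<in>DS. norm w \<le> 1}"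
    have "\<bar>inner (T p v) w\<bar> \<le> norm (T p v) * norm w" by (rule Cauchy_Schwarz_ineq2)
    also have "\<dots> \<le> norm (T p v) * 1" using w by (intro mult_left_mono) auto
    finally show "norm (inner v (Pt p (S w))) \<le> norm (T p v)" using w by (simp add: inner_T[OF p])
  qed
  obtain C where C: "C \<ge> 0" "\<And>w v. w \<in> {w\<in>DS. norm w \<le> 1} \<Longrightarrow> norm (inner v (Pt p (S w))) \<le> C * norm v"
    using uniform_boundedness[OF bl pw] by blast
  have "norm (T p v) \<le> norm v * C" for v
  proof (rule norm_le_of_inner_bound[OF SD(2)])
    fix w assume w: "w \<in> DS"
    show "inner (T p v) w \<le> norm v * C * norm w"
    proof (cases "w = 0")
      case False
      have "(1 / norm w) *\<^sub>R w \<in> {w\<in>DS. norm w \<le> 1}" using w False by (simp add: SD)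
      from abs_le_D1[OF C(2)[OF this, of v, unfolded real_norm_def]]
      have "inner (T p v) ((1 / norm w) *\<^sub>R w) \<le> C * norm v"
        using w by (simp add: inner_T[OF p] SD orth_projD(7)[OF Pt_proj[OF p]])
      then show ?thesis using False by (simp add: field_simps)
    qed simp
  qed (simp add: C)
  then show ?thesis by (intro bounded_linear_intro[of _ C]) (auto simp: T_linear[OF p])
qed

lemma Pt_tendsto: "((\<lambda>p. Pt p f) \<longlongrightarrow> P f) (nhds 0)"
proof -
  have "isCont (\<lambda>p. Pt p f) 0"
    by (rule continuous_on_interior[OF Pt_cont]) (simp add: \<delta>_pos)
  then show ?thesis by (simp add: isCont_def tendsto_nhds_iff Pt_0)
qed

lemma norm_T_tendsto: "((\<lambda>p. norm (T p v)) \<longlongrightarrow> norm (T 0 v)) (nhds 0)"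
  using Pt_lim[of v] by (simp add: form_dom_UNIV tendsto_nhds_iff T_def Pt_0)

text \<open>Convergence of norms bounds \<open>T p v\<close> only on a neighbourhood of 0 depending
  on \<open>v\<close>. The contradiction hypothesis supplies a sequence tending to 0, along which
  every \<open>v\<close> has bounded images, so uniform boundedness applies.\<close>

lemma T_uniformly_bounded:
  obtains \<eta> C where "0 < \<eta>" "\<eta> \<le> \<delta>" "C \<ge> 0" "\<And>p v. \<bar>p\<bar> < \<eta> \<Longrightarrow> norm (T p v) \<le> C * norm v"
proof -
  have "\<exists>\<eta> C. 0 < \<eta> \<and> \<eta> \<le> \<delta> \<and> C \<ge> 0 \<and> (\<forall>p v. \<bar>p\<bar> < \<eta> \<longrightarrow> norm (T p v) \<le> C * norm v)"
  proof (rule ccontr)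
    assume neg: "\<not> ?thesis"
    have "\<exists>p v. \<bar>p\<bar> < \<delta> / Suc n \<and> norm (T p v) > real n * norm v" for n
    proof (rule ccontr)
      assume "\<not> ?thesis"
      then have "\<forall>p v. \<bar>p\<bar> < \<delta> / Suc n \<longrightarrow> norm (T p v) \<le> real n * norm v" by (meson not_less)
      moreover have "0 < \<delta> / Suc n" "\<delta> / Suc n \<le> \<delta>" using \<delta>_pos by (auto simp: field_simps)
      ultimately show False using neg of_nat_0_le_iff by blast
    qed
    then obtain p v where pv: "\<And>n. \<bar>p n\<bar> < \<delta> / Suc n" "\<And>n. norm (T (p n) (v n)) > real n * norm (v n)"
      by metis
    have p\<delta>: "\<bar>p n\<bar> < \<delta>" for n
    proof -
      have "\<delta> / Suc n \<le> \<delta>" using \<delta>_pos by (auto simp: field_simps)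
      then show ?thesis using pv(1)[of n] by linarith
    qed
    have "p \<longlonglongrightarrow> 0"
    proof (rule Lim_null_comparison)
      have "(\<lambda>n. \<delta> * (1 / Suc n)) \<longlonglongrightarrow> \<delta> * 0" by (intro tendsto_intros LIMSEQ_Suc[OF lim_1_over_n])
      then show "(\<lambda>n. \<delta> / Suc n) \<longlonglongrightarrow> 0" by simp
      show "\<forall>\<^sub>F n in sequentially. norm (p n) \<le> \<delta> / Suc n" using pv(1) by (simp add: less_imp_le)
    qed
    then have "(\<lambda>n. norm (T (p n) x)) \<longlonglongrightarrow> norm (T 0 x)" for x
      by (rule filterlim_compose[OF norm_T_tendsto])
    then have "Bseq (\<lambda>n. norm (T (p n) x))" for x using convergent_imp_Bseq convergentI by blast
    then have pw: "\<exists>C. \<forall>n\<in>UNIV. norm (T (p n) x) \<le> C" for x by (auto simp: Bseq_def)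
    obtain C where C: "C \<ge> 0" "\<And>n x. norm (T (p n) x) \<le> C * norm x"
      using uniform_boundedness[of UNIV "\<lambda>n. T (p n)", OF T_bounded_linear[OF p\<delta>] pw] by auto
    obtain n :: nat where n: "C \<le> real n" using real_arch_simple by blast
    have "norm (T (p n) (v n)) \<le> real n * norm (v n)"
      using C(2)[of n "v n"] mult_right_mono[OF n norm_ge_zero[of "v n"]] by linarith
    then show False using pv(2)[of n] by linarith
  qed
  then show thesis using that by blast
qed

lemma T_tendsto: "((\<lambda>p. T p v) \<longlongrightarrow> T 0 v) (nhds 0)"
proof -
  obtain \<eta> C where \<eta>: "0 < \<eta>" "\<eta> \<le> \<delta>" "C \<ge> 0" "\<And>p v. \<bar>p\<bar> < \<eta> \<Longrightarrow> norm (T p v) \<le> C * norm v"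
    using T_uniformly_bounded by blast
  have ev\<eta>: "\<forall>\<^sub>F p in nhds 0. \<bar>p\<bar> < \<eta>"
    using eventually_nhds_metric[of "\<lambda>p. \<bar>p\<bar> < \<eta>" 0] \<eta>(1) by (auto simp: dist_real_def)
  have weak: "((\<lambda>p. inner (T p v) y) \<longlongrightarrow> inner (T 0 v) y) (nhds 0)" for y
  proof (rule tendstoI)
    fix e :: real assume e: "e > 0"
    \<comment> \<open>\<open>2 * (C * norm v)\<close> bounds \<open>norm (T p v - T 0 v)\<close>;
      the summand 1 keeps the denominator positive.\<close>
    define r where "r = e / 2 / (2 * (C * norm v) + 1)"
    have Cv: "0 \<le> C * norm v" using \<eta>(3) by simp
    have r: "r > 0" using e Cv by (simp add: r_def)
    obtain z where z: "z \<in> DS" "norm (y - z) < r" using closure_UNIV_approx[OF SD(2) r] by blast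
    have "((\<lambda>p. inner v (Pt p (S z))) \<longlongrightarrow> inner v (P (S z))) (nhds 0)" by (intro tendsto_intros Pt_tendsto)
    then have "\<forall>\<^sub>F p in nhds 0. dist (inner v (Pt p (S z))) (inner v (P (S z))) < e / 2"
      by (rule tendstoD) (use e in simp)
    with ev\<eta> show "\<forall>\<^sub>F p in nhds 0. dist (inner (T p v) y) (inner (T 0 v) y) < e"
    proof eventually_elim
      fix p assume p: "\<bar>p\<bar> < \<eta>" and d: "dist (inner v (Pt p (S z))) (inner v (P (S z))) < e / 2"
      have "inner (T p v) y - inner (T 0 v) y = inner (T p v - T 0 v) (y - z)
          + (inner v (Pt p (S z)) - inner v (P (S z)))"
        using inner_T[of p z v] inner_T[of 0 z v] p \<eta>(1,2) z(1)
        by (simp add: Pt_0 inner_diff_left inner_diff_right)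
      moreover have "\<bar>inner (T p v - T 0 v) (y - z)\<bar> \<le> e / 2"
      proof -
        have "norm (T p v - T 0 v) \<le> 2 * (C * norm v)"
          using norm_triangle_ineq4[of "T p v" "T 0 v"] \<eta>(4)[OF p, of v] \<eta>(4)[of 0 v] \<eta>(1) by simp
        then have "norm (T p v - T 0 v) * norm (y - z) \<le> (2 * (C * norm v) + 1) * r"
          using z(2) Cv by (intro mult_mono) auto
        also have "\<dots> = e / 2" using Cv by (simp add: r_def del: divide_divide_eq_left)
        finally show ?thesis using Cauchy_Schwarz_ineq2[of "T p v - T 0 v" "y - z"] by linarith
      qed
      ultimately show "dist (inner (T p v) y) (inner (T 0 v) y) < e" using d unfolding dist_real_def by linarith
    qed
  qed
  have "((\<lambda>p. (norm (T p v))\<^sup>2 - 2 * inner (T p v) (T 0 v) + (norm (T 0 v))\<^sup>2) \<longlongrightarrow>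
      (norm (T 0 v))\<^sup>2 - 2 * inner (T 0 v) (T 0 v) + (norm (T 0 v))\<^sup>2) (nhds 0)"
    by (intro tendsto_intros norm_T_tendsto weak)
  moreover have "(norm (T p v))\<^sup>2 - 2 * inner (T p v) (T 0 v) + (norm (T 0 v))\<^sup>2 = (norm (T p v - T 0 v))\<^sup>2" for p
    by (simp add: power2_norm_eq_inner inner_diff_left inner_diff_right inner_commute)
  ultimately have "((\<lambda>p. (norm (T p v - T 0 v))\<^sup>2) \<longlongrightarrow> 0) (nhds 0)" by (simp add: power2_norm_eq_inner)
  from tendsto_real_sqrt[OF this] have "((\<lambda>p. norm (T p v - T 0 v)) \<longlongrightarrow> 0) (nhds 0)" by simp
  then show ?thesis using tendsto_norm_zero_iff Lim_null by blast
qed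

text \<open>The form is bounded and everywhere defined, so Riesz supplies a representing vector for
  every \<open>u\<close>: \<open>HP\<close> is the bounded operator
  \<open>T(0)* T(0)\<close>.\<close>

lemma HP_char: "fst HP = UNIV" "inner (snd HP u) v = inner (T 0 u) (T 0 v)"
proof -
  have bl: "bounded_linear (T 0)" by (rule T_bounded_linear) (simp add: \<delta>_pos)
  have ex: "\<exists>w. \<forall>v. inner (T 0 u) (T 0 v) = inner w v" for u
    by (rule riesz_representation) (rule bounded_linear_compose[OF bounded_linear_inner_right bl])
  have eq: "op_HP H P = (UNIV, \<lambda>u. THE w. \<forall>v. inner (T 0 u) (T 0 v) = inner w v)"
    using ex unfolding op_HP_def form_dom_UNIV by (simp add: Let_def T_def Pt_0)
  show "fst HP = UNIV" by (simp add: eq)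
  obtain w where w: "\<And>v. inner (T 0 u) (T 0 v) = inner w v" using ex[of u] by blast
  have "(THE w. \<forall>v. inner (T 0 u) (T 0 v) = inner w v) = w"
  proof (rule the_equality)
    show "w' = w" if "\<forall>v. inner (T 0 u) (T 0 v) = inner w' v" for w'
      using that w by (intro dense_inner_eq[of UNIV w' w]) (auto simp: inner_commute)
  qed (simp add: w)
  then show "inner (snd HP u) v = inner (T 0 u) (T 0 v)" by (simp add: eq w)
qed

lemma HP_self_adjoint: "op_self_adjoint HP"
proof (rule op_self_adjointI)
  have eqI: "x = y" if "\<And>v. inner x v = inner y v" for x y :: 'a
    using that by (intro dense_inner_eq[of UNIV x y]) (auto simp: inner_commute)
  have \<delta>: "\<bar>0\<bar> < \<delta>" using \<delta>_pos by simp
  show "op_clinear HP"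
    unfolding op_clinear_def HP_char(1)
  proof (intro conjI ballI allI)
    show "snd HP (x + y) = snd HP x + snd HP y" for x y
      by (rule eqI) (simp add: HP_char inner_add_left T_linear[OF \<delta>])
    show "snd HP (r *\<^sub>R x) = r *\<^sub>R snd HP x" for r x
      by (rule eqI) (simp add: HP_char T_linear[OF \<delta>])
    show "snd HP (imult x) = imult (snd HP x)" for x
      by (rule eqI) (simp add: HP_char T_linear[OF \<delta>] inner_imult_swap)
  qed auto
  show "inner (snd HP x) y = inner x (snd HP y)" for x y
    using HP_char(2)[of x y] HP_char(2)[of y x] by (simp add: inner_commute)
qed (auto simp: HP_char)

lemma W: "unitary_group_of HP W"
proof (rule expmi_unitary_group[OF HP_self_adjoint])
  show "op_nonneg HP" unfolding op_nonneg_def using HP_char(2) by (simp add: inner_commute)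
qed


text \<open>\<open>G p \<tau>\<close> completes \<open>P(p) e\<^sup>-\<^sup>i\<^sup>\<tau>\<^sup>H P(p)\<close> by the identity on the kernel of \<open>P(p)\<close>, which makes
  \<open>G p \<tau> - 1\<close> of order \<open>\<tau>\<close>.\<close>

definition G :: "real \<Rightarrow> real \<Rightarrow> 'a \<Rightarrow> 'a" where
  "G p \<tau> x = x - Pt p x + Pt p (U \<tau> (Pt p x))"

text \<open>\<open>G p \<tau>\<close> respects the orthogonal splitting by \<open>Pt p\<close>, is
  the identity on the kernel and a compressed isometry on the range; Pythagoras combines the
  two.\<close>

lemma G_contraction:
  assumes p: "\<bar>p\<bar> < \<delta>"
  shows "linear (G p \<tau>)" "norm (G p \<tau> x) \<le> norm x"
proof -
  note PD = orth_projD[OF Pt_proj[OF p]]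
  have Ul: "U \<tau> (x + y) = U \<tau> x + U \<tau> y" "U \<tau> (r *\<^sub>R x) = r *\<^sub>R U \<tau> x" for x y r
    using bounded_linear.linear[OF unitary_group_ofD(1)[OF U]] by (simp_all add: linear_add linear_scale)
  show "linear (G p \<tau>)" by (rule linearI) (simp_all add: G_def PD Ul algebra_simps)
  have "G p \<tau> x - Pt p (G p \<tau> x) = x - Pt p x" "Pt p (G p \<tau> x) = Pt p (U \<tau> (Pt p x))"
    by (simp_all add: G_def PD)
  then have "(norm (G p \<tau> x))\<^sup>2 = (norm (x - Pt p x))\<^sup>2 + (norm (Pt p (U \<tau> (Pt p x))))\<^sup>2"
    using PD(10)[of "G p \<tau> x"] by simp
  also have "\<dots> \<le> (norm (x - Pt p x))\<^sup>2 + (norm (Pt p x))\<^sup>2"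
    using PD(8)[of "U \<tau> (Pt p x)"] by (auto intro!: power_mono simp: unitary_group_ofD(2)[OF U])
  also have "\<dots> = (norm x)\<^sup>2" by (rule PD(10)[symmetric])
  finally show "norm (G p \<tau> x) \<le> norm x" by (rule power2_le_imp_le) simp
qed

lemma inner_G_minus:
  assumes p: "\<bar>p\<bar> < \<delta>"
  shows "inner (G p \<tau> x - x) w = inner (U \<tau> (Pt p x) - Pt p x) (Pt p w)"
proof -
  note PD = orth_projD[OF Pt_proj[OF p]]
  have "G p \<tau> x - x = Pt p (U \<tau> (Pt p x) - Pt p x)" by (simp add: G_def PD)
  then show ?thesis by (simp add: PD(3))
qed

text \<open>Used to absorb the replacement of an orbit point by a nearby net point: the error must
  carry a factor \<open>\<bar>\<tau>\<bar>\<close>, because it is incurred in each of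
  \<open>n\<close> steps.\<close>

lemma G_W_lipschitz:
  obtains \<eta> c where "0 < \<eta>" "\<eta> \<le> \<delta>" "c \<ge> 0"
    "\<And>p \<tau> x. \<bar>p\<bar> < \<eta> \<Longrightarrow> norm (G p \<tau> x - W \<tau> x) \<le> c * norm x * \<bar>\<tau>\<bar>"
proof -
  obtain \<eta> C where \<eta>: "0 < \<eta>" "\<eta> \<le> \<delta>" "C \<ge> 0" "\<And>p v. \<bar>p\<bar> < \<eta> \<Longrightarrow> norm (T p v) \<le> C * norm v"
    using T_uniformly_bounded by blast
  have K: "norm (snd HP x) \<le> C * C * norm x" for x
  proof (rule norm_le_of_inner_bound[of UNIV])
    show "inner (snd HP x) w \<le> C * C * norm x * norm w" for w
    proof -
      have "inner (snd HP x) w \<le> norm (T 0 x) * norm (T 0 w)"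
        unfolding HP_char by (rule norm_cauchy_schwarz)
      also have "\<dots> \<le> (C * norm x) * (C * norm w)" using \<eta> by (intro mult_mono) auto
      finally show ?thesis by (simp add: mult_ac)
    qed
  qed (use \<eta> in auto)
  have Gx: "norm (G p \<tau> x - x) \<le> 3 * (C * C * norm x) * \<bar>\<tau>\<bar>" if p: "\<bar>p\<bar> < \<eta>" for p \<tau> x
  proof (rule norm_le_of_inner_bound[of UNIV])
    show "inner (G p \<tau> x - x) w \<le> 3 * (C * C * norm x) * \<bar>\<tau>\<bar> * norm w" for w
    proof -
      have p': "\<bar>p\<bar> < \<delta>" using p \<eta> by simp
      have "inner (G p \<tau> x - x) w \<le> \<bar>inner (U \<tau> (Pt p x) - Pt p x) (Pt p w)\<bar>"
        unfolding inner_G_minus[OF p'] by simp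
      also have "\<dots> \<le> 3 * norm (T p x) * norm (T p w) * \<bar>\<tau>\<bar>"
        unfolding T_def by (intro unitary_group_form_bound[OF H_sa H_nonneg U] Pt_in_DS p')
      also have "\<dots> \<le> 3 * (C * norm x) * (C * norm w) * \<bar>\<tau>\<bar>"
        using \<eta> p by (intro mult_right_mono mult_mono) auto
      finally show ?thesis by (simp add: mult_ac)
    qed
  qed (use \<eta> in auto)
  show thesis
  proof (rule that[of \<eta> "4 * (C * C)"])
    fix p \<tau> x assume p: "\<bar>p\<bar> < \<eta>"
    have "norm (W \<tau> x - x) \<le> norm (snd HP x) * \<bar>\<tau>\<bar>"
      by (rule unitary_group_lipschitz[OF W]) (simp add: HP_char)
    also have "\<dots> \<le> C * C * norm x * \<bar>\<tau>\<bar>" by (intro mult_right_mono K) simp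
    finally show "norm (G p \<tau> x - W \<tau> x) \<le> 4 * (C * C) * norm x * \<bar>\<tau>\<bar>"
      using Gx[OF p, of \<tau> x] norm_triangle_ineq4[of "G p \<tau> x - x" "W \<tau> x - x"] by (simp add: algebra_simps)
  qed (use \<eta> in auto)
qed

text \<open>Both \<open>G p \<tau> x\<close> and \<open>W \<tau> x\<close> are compared with
  \<open>x - \<tau> *\<^sub>R imult (snd HP x)\<close>. For \<open>G\<close> the comparison is
  tested against all \<open>w\<close>, so every error must be bounded by \<open>norm w\<close> with
  constants independent of \<open>w\<close>.\<close>

lemma G_W_small:
  assumes e: "e > 0"
  shows "\<exists>d>0. \<forall>p \<tau>. \<bar>p\<bar> < d \<longrightarrow> \<bar>\<tau>\<bar> < d \<longrightarrow> norm (G p \<tau> x - W \<tau> x) \<le> e * \<bar>\<tau>\<bar>"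
proof -
  obtain \<eta> C where \<eta>: "0 < \<eta>" "\<eta> \<le> \<delta>" "C \<ge> 0" "\<And>p v. \<bar>p\<bar> < \<eta> \<Longrightarrow> norm (T p v) \<le> C * norm v"
    using T_uniformly_bounded by blast
  \<comment> \<open>The form estimate contributes \<open>3 * C\<close> and the convergence of
    adjoints \<open>3 * C + 1\<close>.\<close>
  define r where "r = e / 2 / (6 * C + 1)"
  have r: "r > 0" using e \<eta> by (simp add: r_def)
  have r_eq: "(6 * C + 1) * r = e / 2" using \<eta> by (simp add: r_def del: divide_divide_eq_left)
  define y where "y = imult (T 0 x)"
  \<comment> \<open>\<open>T 0 w - T p w\<close> is not small uniformly in \<open>w\<close>. Paired
    with \<open>z\<close> it becomes a difference of projections applied to the fixed vector
    \<open>S z\<close>, which is.\<close>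
  obtain z where z: "z \<in> DS" "norm (y - z) < r" using closure_UNIV_approx[OF SD(2) r] by blast
  have "\<forall>\<^sub>F p in nhds 0. dist (T p x) (T 0 x) < r" using T_tendsto r by (rule tendstoD)
  then obtain d1 where d1: "d1 > 0" "\<And>p. \<bar>p\<bar> < d1 \<Longrightarrow> norm (T p x - T 0 x) < r"
    by (auto simp: eventually_nhds_metric dist_norm)
  have "\<forall>\<^sub>F p in nhds 0. dist (Pt p (S z)) (P (S z)) < r" using Pt_tendsto r by (rule tendstoD)
  then obtain d2 where d2: "d2 > 0" "\<And>p. \<bar>p\<bar> < d2 \<Longrightarrow> norm (Pt p (S z) - P (S z)) < r"
    by (auto simp: eventually_nhds_metric dist_norm)
  obtain d3 where d3: "d3 > 0" "\<And>s. \<bar>s\<bar> < d3 \<Longrightarrow> norm (U s (T 0 x) - T 0 x) < r"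
    using unitary_group_near_identity[OF U r] by blast
  have "((\<lambda>s. (1 / s) *\<^sub>R (W s x - x)) \<longlongrightarrow> - imult (snd HP x)) (at 0)"
    by (rule unitary_group_ofD(8)[OF W]) (simp add: HP_char)
  from LIM_D[OF this, of "e / 2"] e obtain d4 where d4: "d4 > 0"
    "\<And>s. s \<noteq> 0 \<Longrightarrow> \<bar>s\<bar> < d4 \<Longrightarrow> norm ((1 / s) *\<^sub>R (W s x - x) + imult (snd HP x)) < e / 2"
    by auto
  have Wx: "norm (W \<tau> x - x + \<tau> *\<^sub>R imult (snd HP x)) \<le> e / 2 * \<bar>\<tau>\<bar>" if "\<bar>\<tau>\<bar> < d4" for \<tau>
  proof (cases "\<tau> = 0")
    case False
    have "W \<tau> x - x + \<tau> *\<^sub>R imult (snd HP x) = \<tau> *\<^sub>R ((1 / \<tau>) *\<^sub>R (W \<tau> x - x) + imult (snd HP x))"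
      using False by (simp add: scaleR_add_right)
    then have "norm (W \<tau> x - x + \<tau> *\<^sub>R imult (snd HP x)) = \<bar>\<tau>\<bar> * norm ((1 / \<tau>) *\<^sub>R (W \<tau> x - x) + imult (snd HP x))"
      by simp
    also have "\<dots> \<le> \<bar>\<tau>\<bar> * (e / 2)" using d4(2)[OF False that] by (intro mult_left_mono) auto
    finally show ?thesis by (simp add: mult.commute)
  qed (simp add: unitary_group_ofD(4)[OF W])
  have Gx: "norm (G p \<tau> x - x + \<tau> *\<^sub>R imult (snd HP x)) \<le> e / 2 * \<bar>\<tau>\<bar>"
    if p: "\<bar>p\<bar> < \<eta>" "\<bar>p\<bar> < d1" "\<bar>p\<bar> < d2" and \<tau>: "\<bar>\<tau>\<bar> < d3" for p \<tau>
  proof (rule norm_le_of_inner_bound[of UNIV])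
    fix w
    have p': "\<bar>p\<bar> < \<delta>" and z': "\<bar>0\<bar> < \<delta>" using p \<eta> by simp_all
    have dT: "norm (T p x - T 0 x) \<le> r" using d1(2)[OF p(2)] by simp
    \<comment> \<open>Continuity of the group is known only at the fixed vector
      \<open>T 0 x\<close>; passing to \<open>T p x\<close> costs \<open>r\<close> twice
      more.\<close>
    have k: "norm (U s (S (Pt p x)) - S (Pt p x)) \<le> 3 * r" if "\<bar>s\<bar> \<le> \<bar>\<tau>\<bar>" for s
    proof -
      have "U s (T p x) - T p x = U s (T p x - T 0 x) + (U s (T 0 x) - T 0 x) - (T p x - T 0 x)"
        by (simp add: unitary_group_ofD_diff[OF U])
      then have "norm (U s (T p x) - T p x) \<le> norm (U s (T p x - T 0 x)) + norm (U s (T 0 x) - T 0 x) + norm (T p x - T 0 x)"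
        by (simp only: norm_add_diff_le)
      moreover have "norm (U s (T 0 x) - T 0 x) < r" using d3(2)[of s] that \<tau> by simp
      ultimately show ?thesis using dT unitary_group_ofD(2)[OF U, of s "T p x - T 0 x"] by (simp add: T_def)
    qed
    have nT: "norm (T q w) \<le> C * norm w" if "\<bar>q\<bar> < \<eta>" for q using \<eta>(4)[OF that] .
    note nTp = nT[OF p(1)]
    have 1: "\<bar>inner (U \<tau> (Pt p x) - Pt p x) (Pt p w) + \<tau> * inner (imult (T p x)) (T p w)\<bar> \<le> 3 * r * (C * norm w) * \<bar>\<tau>\<bar>"
    proof -
      have "\<bar>inner (U \<tau> (Pt p x) - Pt p x) (Pt p w) + \<tau> * inner (imult (T p x)) (T p w)\<bar>
          \<le> 3 * r * norm (T p w) * \<bar>\<tau>\<bar>"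
        unfolding T_def
        by (rule unitary_group_form_estimate[OF H_sa H_nonneg U Pt_in_DS[OF p'] Pt_in_DS[OF p'] k])
      also have "\<dots> \<le> 3 * r * (C * norm w) * \<bar>\<tau>\<bar>" using nTp r by (intro mult_right_mono mult_left_mono) auto
      finally show ?thesis .
    qed
    have 2: "\<bar>inner (imult (snd HP x)) w - inner (imult (T p x)) (T p w)\<bar> \<le> (3 * C + 1) * r * norm w"
    proof -
      have "inner (imult (snd HP x)) w = inner y (T 0 w)"
        using HP_char(2)[of "imult x" w] op_self_adjointD(9)[OF HP_self_adjoint, of x]
        by (simp add: HP_char(1) y_def T_linear[OF z'])
      moreover have "inner z (T 0 w) - inner z (T p w) = inner (P (S z) - Pt p (S z)) w"
        using inner_T[OF z' z(1), of w] inner_T[OF p' z(1), of w]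
        by (simp add: Pt_0 inner_diff_right inner_diff_left inner_commute)
      ultimately have "inner (imult (snd HP x)) w - inner (imult (T p x)) (T p w) =
          inner (y - z) (T 0 w - T p w) + inner (P (S z) - Pt p (S z)) w + inner (y - imult (T p x)) (T p w)"
        by (simp add: inner_diff_left inner_diff_right)
      moreover have "\<bar>inner (y - z) (T 0 w - T p w)\<bar> \<le> r * (2 * (C * norm w))"
      proof -
        have "norm (T 0 w - T p w) \<le> 2 * (C * norm w)"
          using norm_triangle_ineq4[of "T 0 w" "T p w"] nTp nT[of 0] \<eta>(1) by simp
        then have "norm (y - z) * norm (T 0 w - T p w) \<le> r * (2 * (C * norm w))"
          using z(2) r by (intro mult_mono) auto
        then show ?thesis using Cauchy_Schwarz_ineq2[of "y - z" "T 0 w - T p w"] by linarith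
      qed
      moreover have "\<bar>inner (P (S z) - Pt p (S z)) w\<bar> \<le> r * norm w"
      proof -
        have "norm (P (S z) - Pt p (S z)) * norm w \<le> r * norm w"
          using d2(2)[OF p(3)] by (intro mult_right_mono) (auto simp: norm_minus_commute)
        then show ?thesis using Cauchy_Schwarz_ineq2[of "P (S z) - Pt p (S z)" w] by linarith
      qed
      moreover have "\<bar>inner (y - imult (T p x)) (T p w)\<bar> \<le> r * (C * norm w)"
      proof -
        have "y - imult (T p x) = imult (T 0 x - T p x)"
          by (simp add: y_def linear_diff[OF bounded_linear.linear[OF bounded_linear_imult]])
        then have "norm (y - imult (T p x)) \<le> r" using dT by (simp add: norm_minus_commute)
        then have "norm (y - imult (T p x)) * norm (T p w) \<le> r * (C * norm w)"
          using nTp r by (intro mult_mono) auto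
        then show ?thesis using Cauchy_Schwarz_ineq2[of "y - imult (T p x)" "T p w"] by linarith
      qed
      ultimately have "\<bar>inner (imult (snd HP x)) w - inner (imult (T p x)) (T p w)\<bar>
          \<le> r * (2 * (C * norm w)) + r * norm w + r * (C * norm w)" by linarith
      then show ?thesis by (simp add: algebra_simps)
    qed
    have "inner (G p \<tau> x - x + \<tau> *\<^sub>R imult (snd HP x)) w =
       (inner (U \<tau> (Pt p x) - Pt p x) (Pt p w) + \<tau> * inner (imult (T p x)) (T p w))
       + \<tau> * (inner (imult (snd HP x)) w - inner (imult (T p x)) (T p w))"
      unfolding inner_add_left inner_G_minus[OF p'] by (simp add: algebra_simps)
    also have "\<dots> \<le> 3 * r * (C * norm w) * \<bar>\<tau>\<bar> + \<bar>\<tau>\<bar> * ((3 * C + 1) * r * norm w)"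
    proof (rule add_mono)
      show "\<tau> * (inner (imult (snd HP x)) w - inner (imult (T p x)) (T p w)) \<le> \<bar>\<tau>\<bar> * ((3 * C + 1) * r * norm w)"
        using mult_left_mono[OF 2 abs_ge_zero[of \<tau>]] by (simp add: abs_mult[symmetric] abs_le_iff)
    qed (use 1 in linarith)
    also have "\<dots> = (6 * C + 1) * r * \<bar>\<tau>\<bar> * norm w" by (simp add: algebra_simps)
    finally show "inner (G p \<tau> x - x + \<tau> *\<^sub>R imult (snd HP x)) w \<le> e / 2 * \<bar>\<tau>\<bar> * norm w"
      unfolding r_eq .
  qed (use e in auto)
  show ?thesis
  proof (intro exI[of _ "min (min \<eta> d1) (min d2 (min d3 d4))"] conjI allI impI)
    show "0 < min (min \<eta> d1) (min d2 (min d3 d4))" using \<eta> d1 d2 d3 d4 by simp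
    fix p \<tau> assume "\<bar>p\<bar> < min (min \<eta> d1) (min d2 (min d3 d4))" "\<bar>\<tau>\<bar> < min (min \<eta> d1) (min d2 (min d3 d4))"
    then have "norm (G p \<tau> x - x + \<tau> *\<^sub>R imult (snd HP x)) \<le> e / 2 * \<bar>\<tau>\<bar>"
      "norm (W \<tau> x - x + \<tau> *\<^sub>R imult (snd HP x)) \<le> e / 2 * \<bar>\<tau>\<bar>" using Gx Wx by auto
    then show "norm (G p \<tau> x - W \<tau> x) \<le> e * \<bar>\<tau>\<bar>"
      using norm_triangle_ineq4[of "G p \<tau> x - x + \<tau> *\<^sub>R imult (snd HP x)" "W \<tau> x - x + \<tau> *\<^sub>R imult (snd HP x)"]
      by simp
  qed
qed

section \<open>Telescoping along orbits of the limiting group\<close>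

lemma W_funpow: "(W \<tau> ^^ k) f = W (real k * \<tau>) f"
proof (induction k)
  case (Suc k)
  have "W (\<tau> + real k * \<tau>) f = W \<tau> (W (real k * \<tau>) f)" by (rule unitary_group_ofD(5)[OF W])
  then show ?case using Suc by (simp add: algebra_simps)
qed (simp add: unitary_group_ofD(4)[OF W])

text \<open>The small-error estimate holds vector by vector, while telescoping needs it at all
  \<open>W (real k * \<tau>) f\<close> with \<open>k < n\<close>. These lie on one compact orbit
  segment, so a finite net of radius \<open>r\<close> reduces the task to finitely many
  vectors.\<close>

lemma G_funpow_limit:
  assumes e: "e > 0" and M: "M \<ge> 0"
  shows "\<exists>d>0. d \<le> \<delta> \<and> (\<forall>p \<tau> n. \<bar>p\<bar> < d \<longrightarrow> \<bar>\<tau>\<bar> < d \<longrightarrow> real n * \<bar>\<tau>\<bar> \<le> M \<longrightarrow>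
    norm ((G p \<tau> ^^ n) f - W (real n * \<tau>) f) \<le> e)"
proof -
  obtain \<eta> c where \<eta>: "0 < \<eta>" "\<eta> \<le> \<delta>" "c \<ge> 0"
    "\<And>p \<tau> x. \<bar>p\<bar> < \<eta> \<Longrightarrow> norm (G p \<tau> x - W \<tau> x) \<le> c * norm x * \<bar>\<tau>\<bar>"
    using G_W_lipschitz by blast
  \<comment> \<open>A step costs \<open>(c + 1) * r * \<bar>\<tau>\<bar>\<close>:
    \<open>c * r\<close> for moving to the net and \<open>r\<close> at the net point. Summed over
    \<open>n\<close> steps this is at most \<open>M * ((c + 1) * r)\<close>.\<close>
  define r where "r = e / ((M + 1) * (c + 1))"
  have r: "r > 0" using e M \<eta> by (simp add: r_def)
  have Mr: "M * ((c + 1) * r) \<le> e"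
  proof -
    have "M * ((c + 1) * r) \<le> (M + 1) * ((c + 1) * r)" using r \<eta> by (intro mult_right_mono) auto
    also have "\<dots> = e" using M \<eta> by (simp add: r_def)
    finally show ?thesis .
  qed
  have "compact ((\<lambda>s. W s f) ` {-M..M})"
    by (intro compact_continuous_image continuous_on_subset[OF unitary_group_ofD(6)[OF W]]) auto
  then obtain X where X: "finite X" "(\<lambda>s. W s f) ` {-M..M} \<subseteq> (\<Union>x\<in>X. ball x r)"
    using r unfolding compact_eq_totally_bounded by blast
  have "\<forall>x\<in>X. \<exists>d>0. \<forall>p \<tau>. \<bar>p\<bar> < d \<longrightarrow> \<bar>\<tau>\<bar> < d \<longrightarrow> norm (G p \<tau> x - W \<tau> x) \<le> r * \<bar>\<tau>\<bar>"
    using G_W_small[OF r] by blast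
  from bchoice[OF this] obtain d where d: "\<And>x. x \<in> X \<Longrightarrow> d x > 0"
    "\<And>x p \<tau>. x \<in> X \<Longrightarrow> \<bar>p\<bar> < d x \<Longrightarrow> \<bar>\<tau>\<bar> < d x \<Longrightarrow> norm (G p \<tau> x - W \<tau> x) \<le> r * \<bar>\<tau>\<bar>"
    by auto
  define d0 where "d0 = Min (insert \<eta> (d ` X))"
  have d0: "d0 > 0" "d0 \<le> \<eta>" "\<And>x. x \<in> X \<Longrightarrow> d0 \<le> d x"
    using X(1) d(1) \<eta>(1) by (auto simp: d0_def)
  have "norm ((G p \<tau> ^^ n) f - W (real n * \<tau>) f) \<le> e"
    if p: "\<bar>p\<bar> < d0" and \<tau>: "\<bar>\<tau>\<bar> < d0" and n: "real n * \<bar>\<tau>\<bar> \<le> M" for p \<tau> n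
  proof -
    have p\<eta>: "\<bar>p\<bar> < \<eta>" "\<bar>p\<bar> < \<delta>" using p d0 \<eta> by linarith+
    have "norm ((G p \<tau> ^^ n) f - (W \<tau> ^^ n) f) \<le> real n * ((c + 1) * r * \<bar>\<tau>\<bar>)"
    proof (rule funpow_telescope[OF G_contraction[OF p\<eta>(2)]])
      fix k assume k: "k < n"
      define g where "g = (W \<tau> ^^ k) f"
      have "\<bar>real k * \<tau>\<bar> \<le> M"
      proof -
        have "\<bar>real k * \<tau>\<bar> \<le> real n * \<bar>\<tau>\<bar>" using k by (simp add: abs_mult mult_right_mono)
        then show ?thesis using n by linarith
      qed
      then have "g \<in> (\<lambda>s. W s f) ` {-M..M}" unfolding g_def W_funpow by (intro imageI) (auto simp: abs_le_iff)
      then obtain x where x: "x \<in> X" "norm (g - x) < r" using X(2) by (auto simp: dist_norm norm_minus_commute)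
      have "G p \<tau> g - W \<tau> g = (G p \<tau> (g - x) - W \<tau> (g - x)) + (G p \<tau> x - W \<tau> x)"
        by (simp add: linear_diff[OF G_contraction(1)[OF p\<eta>(2)]] unitary_group_ofD_diff[OF W])
      then have "norm (G p \<tau> g - W \<tau> g) \<le> norm (G p \<tau> (g - x) - W \<tau> (g - x)) + norm (G p \<tau> x - W \<tau> x)"
        by (simp only: norm_triangle_ineq)
      also have "\<dots> \<le> c * r * \<bar>\<tau>\<bar> + r * \<bar>\<tau>\<bar>"
      proof (rule add_mono)
        have "norm (G p \<tau> (g - x) - W \<tau> (g - x)) \<le> c * norm (g - x) * \<bar>\<tau>\<bar>" by (rule \<eta>(4)[OF p\<eta>(1)])
        also have "\<dots> \<le> c * r * \<bar>\<tau>\<bar>" using x(2) \<eta>(3) by (intro mult_right_mono mult_left_mono) auto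
        finally show "norm (G p \<tau> (g - x) - W \<tau> (g - x)) \<le> c * r * \<bar>\<tau>\<bar>" .
        show "norm (G p \<tau> x - W \<tau> x) \<le> r * \<bar>\<tau>\<bar>"
          using d(2)[OF x(1), of p \<tau>] d0(3)[OF x(1)] p \<tau> by simp
      qed
      finally show "norm (G p \<tau> ((W \<tau> ^^ k) f) - W \<tau> ((W \<tau> ^^ k) f)) \<le> (c + 1) * r * \<bar>\<tau>\<bar>"
        by (simp add: g_def algebra_simps)
    qed
    also have "\<dots> = (real n * \<bar>\<tau>\<bar>) * ((c + 1) * r)" by (simp add: algebra_simps)
    also have "\<dots> \<le> M * ((c + 1) * r)" using n r \<eta> by (intro mult_right_mono) auto
    also have "\<dots> \<le> e" by (rule Mr)
    finally show ?thesis by (simp add: W_funpow)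
  qed
  then show ?thesis using d0 \<eta> by (intro exI[of _ d0]) auto
qed

section \<open>The three products compared with powers of \<open>G\<close>\<close>

definition F1 :: "real \<Rightarrow> real \<Rightarrow> 'a \<Rightarrow> 'a" where "F1 p \<tau> = Pt p \<circ> U \<tau> \<circ> Pt p"
definition F2 :: "real \<Rightarrow> real \<Rightarrow> 'a \<Rightarrow> 'a" where "F2 p \<tau> = Pt p \<circ> U \<tau>"
definition F3 :: "real \<Rightarrow> real \<Rightarrow> 'a \<Rightarrow> 'a" where "F3 p \<tau> = U \<tau> \<circ> Pt p"

text \<open>\<open>F1\<close> and \<open>G\<close> agree on the range of \<open>Pt p\<close>, which
  \<open>G\<close> preserves. The exponent is positive because the zeroth power of \<open>F1\<close>
  does not project \<open>f\<close>.\<close>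

lemma F1_funpow:
  assumes p: "\<bar>p\<bar> < \<delta>"
  shows "(F1 p \<tau> ^^ Suc n) f = (G p \<tau> ^^ Suc n) (Pt p f)"
proof -
  note PD = orth_projD[OF Pt_proj[OF p]]
  have inv: "Pt p ((G p \<tau> ^^ n) (Pt p f)) = (G p \<tau> ^^ n) (Pt p f)" for n
    by (induction n) (simp_all add: PD G_def)
  have F1G: "F1 p \<tau> x = G p \<tau> x" if "Pt p x = x" for x using that by (simp add: F1_def G_def)
  show ?thesis
  proof (induction n)
    case 0 show ?case by (simp add: F1_def G_def PD)
  next
    case (Suc n)
    have "(F1 p \<tau> ^^ Suc (Suc n)) f = F1 p \<tau> ((G p \<tau> ^^ Suc n) (Pt p f))" using Suc by simp
    also have "\<dots> = G p \<tau> ((G p \<tau> ^^ Suc n) (Pt p f))" by (rule F1G[OF inv])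
    finally show ?case by simp
  qed
qed

text \<open>Powers of \<open>F1\<close> are powers of \<open>F2\<close> started at
  \<open>Pt p f\<close>, so only the contribution of \<open>f - Pt p f\<close> remains. As
  \<open>Pt p\<close> annihilates that vector, its first step sees only the increment of the
  group.\<close>

lemma F2_funpow_F1:
  assumes p: "\<bar>p\<bar> < \<delta>"
  shows "norm ((F2 p \<tau> ^^ Suc n) f - (F1 p \<tau> ^^ Suc n) f) \<le> norm (U \<tau> (f - Pt p f) - (f - Pt p f))"
proof -
  note PD = orth_projD[OF Pt_proj[OF p]]
  have lin: "linear (F2 p \<tau>)" unfolding F2_def
    by (intro linear_compose bounded_linear.linear[OF unitary_group_ofD(1)[OF U]] bounded_linear.linear[OF PD(1)])
  have nF2: "norm (F2 p \<tau> x) \<le> norm x" for x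
    using PD(8)[of "U \<tau> x"] by (simp add: F2_def unitary_group_ofD(2)[OF U])
  have powdiff: "(F2 p \<tau> ^^ n) (x - y) = (F2 p \<tau> ^^ n) x - (F2 p \<tau> ^^ n) y" for n x y
    by (induction n) (simp_all add: linear_diff[OF lin])
  have pown: "norm ((F2 p \<tau> ^^ n) x) \<le> norm x" for n x
    by (induction n) (auto intro: order_trans[OF nF2])
  have inv: "Pt p ((F2 p \<tau> ^^ n) (Pt p f)) = (F2 p \<tau> ^^ n) (Pt p f)" for n
    by (cases n) (simp_all add: F2_def PD)
  have F1_F2: "F1 p \<tau> x = F2 p \<tau> (Pt p x)" for x by (simp add: F1_def F2_def)
  have "(F1 p \<tau> ^^ Suc n) f = (F2 p \<tau> ^^ Suc n) (Pt p f)"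
  proof (induction n)
    case 0 show ?case by (simp add: F1_def F2_def)
  next
    case (Suc n)
    have "(F1 p \<tau> ^^ Suc (Suc n)) f = F2 p \<tau> (Pt p ((F1 p \<tau> ^^ Suc n) f))"
      by (simp add: F1_F2)
    also have "\<dots> = F2 p \<tau> (Pt p ((F2 p \<tau> ^^ Suc n) (Pt p f)))" by (simp only: Suc)
    also have "\<dots> = F2 p \<tau> ((F2 p \<tau> ^^ Suc n) (Pt p f))" by (simp only: inv)
    finally show ?case by simp
  qed
  then have "(F2 p \<tau> ^^ Suc n) f - (F1 p \<tau> ^^ Suc n) f = (F2 p \<tau> ^^ n) (F2 p \<tau> (f - Pt p f))"
    by (simp only: powdiff funpow_Suc_right o_apply linear_diff[OF lin])
  then have "norm ((F2 p \<tau> ^^ Suc n) f - (F1 p \<tau> ^^ Suc n) f) \<le> norm (F2 p \<tau> (f - Pt p f))"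
    by (simp only: pown)
  also have "F2 p \<tau> (f - Pt p f) = Pt p (U \<tau> (f - Pt p f) - (f - Pt p f))" by (simp add: F2_def PD)
  also have "norm \<dots> \<le> norm (U \<tau> (f - Pt p f) - (f - Pt p f))" by (rule PD(8))
  finally show ?thesis .
qed

text \<open>\<open>F1\<close> powers are \<open>Pt p\<close> applied to \<open>F3\<close> powers, so
  the difference is the part of \<open>U \<tau> v - v\<close> outside the range, with
  \<open>v\<close> the projected previous iterate. Since \<open>v\<close> varies with
  \<open>n\<close> and \<open>p\<close>, strong continuity is not enough and the square-root bound
  is used.\<close>

lemma F3_funpow_F1:
  assumes p: "\<bar>p\<bar> < \<delta>"
  shows "(norm ((F3 p \<tau> ^^ Suc n) f - (F1 p \<tau> ^^ Suc n) f))\<^sup>2 \<le> 6 * \<bar>\<tau>\<bar> * (norm (T p ((F3 p \<tau> ^^ n) f)))\<^sup>2"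
proof -
  note PD = orth_projD[OF Pt_proj[OF p]]
  have eq: "(F1 p \<tau> ^^ Suc n) f = Pt p ((F3 p \<tau> ^^ Suc n) f)" for n
  proof (induction n)
    case 0 show ?case by (simp add: F1_def F3_def)
  next
    case (Suc n)
    have "(F1 p \<tau> ^^ Suc (Suc n)) f = F1 p \<tau> (Pt p ((F3 p \<tau> ^^ Suc n) f))"
      using Suc by (simp only: funpow.simps o_apply)
    also have "\<dots> = Pt p (F3 p \<tau> ((F3 p \<tau> ^^ Suc n) f))" by (simp only: F1_def F3_def o_apply PD)
    finally show ?case by simp
  qed
  define v where "v = Pt p ((F3 p \<tau> ^^ n) f)"
  have "(F3 p \<tau> ^^ Suc n) f - (F1 p \<tau> ^^ Suc n) f = (U \<tau> v - v) - Pt p (U \<tau> v - v)"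
    unfolding eq by (simp add: F3_def v_def PD)
  then have "norm ((F3 p \<tau> ^^ Suc n) f - (F1 p \<tau> ^^ Suc n) f) \<le> norm (U \<tau> v - v)"
    by (simp only: PD(9))
  then have "(norm ((F3 p \<tau> ^^ Suc n) f - (F1 p \<tau> ^^ Suc n) f))\<^sup>2 \<le> (norm (U \<tau> v - v))\<^sup>2"
    by (intro power_mono) auto
  also have "\<dots> \<le> 6 * \<bar>\<tau>\<bar> * (norm (S v))\<^sup>2"
    by (rule unitary_group_sqrt_bound[OF H_sa H_nonneg U]) (simp add: v_def Pt_in_DS[OF p])
  finally show ?thesis by (simp add: T_def v_def)
qed

lemma product_formula:
  assumes e: "e > 0" and M: "M \<ge> 0"
  shows "\<exists>d>0. \<forall>p \<tau> n. \<bar>p\<bar> < d \<longrightarrow> \<bar>\<tau>\<bar> < d \<longrightarrow> n > 0 \<longrightarrow> real n * \<bar>\<tau>\<bar> \<le> M \<longrightarrow>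
    norm ((F1 p \<tau> ^^ n) f - W (real n * \<tau>) (P f)) < e \<and>
    norm ((F2 p \<tau> ^^ n) f - W (real n * \<tau>) (P f)) < e \<and>
    norm ((F3 p \<tau> ^^ n) f - W (real n * \<tau>) (P f)) < e"
proof -
  \<comment> \<open>\<open>F1\<close> is within \<open>2 * r\<close> of the limit; \<open>F2\<close>
    differs from \<open>F1\<close> by less than \<open>3 * r\<close> and \<open>F3\<close> by less
    than \<open>r\<close>.\<close>
  define r where "r = e / 5"
  have r: "r > 0" using e by (simp add: r_def)
  obtain d1 where d1: "d1 > 0" "d1 \<le> \<delta>" "\<And>p \<tau> n. \<bar>p\<bar> < d1 \<Longrightarrow> \<bar>\<tau>\<bar> < d1 \<Longrightarrow> real n * \<bar>\<tau>\<bar> \<le> M \<Longrightarrow>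
    norm ((G p \<tau> ^^ n) (P f) - W (real n * \<tau>) (P f)) \<le> r"
    using G_funpow_limit[OF r M, of "P f"] by blast
  have "\<forall>\<^sub>F p in nhds 0. dist (Pt p f) (P f) < r" using Pt_tendsto r by (rule tendstoD)
  then obtain d2 where d2: "d2 > 0" "\<And>p. \<bar>p\<bar> < d2 \<Longrightarrow> norm (Pt p f - P f) < r"
    by (auto simp: eventually_nhds_metric dist_norm)
  obtain d3 where d3: "d3 > 0" "\<And>s. \<bar>s\<bar> < d3 \<Longrightarrow> norm (U s (f - P f) - (f - P f)) < r"
    using unitary_group_near_identity[OF U r] by blast
  obtain \<eta> C where \<eta>: "0 < \<eta>" "\<eta> \<le> \<delta>" "C \<ge> 0" "\<And>p v. \<bar>p\<bar> < \<eta> \<Longrightarrow> norm (T p v) \<le> C * norm v"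
    using T_uniformly_bounded by blast
  \<comment> \<open>Chosen so that the square-root bound for \<open>F3\<close>, with iterates of
    norm at most \<open>norm f\<close>, stays below \<open>r\<^sup>2\<close>.\<close>
  define d4 where "d4 = r\<^sup>2 / (6 * (C * norm f)\<^sup>2 + 1)"
  have q: "6 * (C * norm f)\<^sup>2 + 1 > 0" by (simp add: add_nonneg_pos)
  have d4: "d4 > 0" unfolding d4_def using r q by (intro divide_pos_pos) auto
  define d where "d = min (min d1 d2) (min d3 (min \<eta> d4))"
  have d0: "d > 0" using d1 d2 d3 \<eta> d4 by (simp add: d_def)
  have "norm ((F1 p \<tau> ^^ n) f - W (real n * \<tau>) (P f)) < e \<and>
      norm ((F2 p \<tau> ^^ n) f - W (real n * \<tau>) (P f)) < e \<and>
      norm ((F3 p \<tau> ^^ n) f - W (real n * \<tau>) (P f)) < e"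
    if p: "\<bar>p\<bar> < d" and \<tau>: "\<bar>\<tau>\<bar> < d" and n0: "n > 0" and n: "real n * \<bar>\<tau>\<bar> \<le> M" for p \<tau> n
  proof -
    obtain m where m: "n = Suc m" using n0 gr0_implies_Suc by blast
    have p': "\<bar>p\<bar> < \<delta>" using p \<eta>(2) by (simp add: d_def)
    note PD = orth_projD[OF Pt_proj[OF p']]
    have Pf: "norm (Pt p f - P f) < r" using d2(2)[of p] p by (simp add: d_def)
    have Gpow: "norm ((G p \<tau> ^^ k) x) \<le> norm x" "(G p \<tau> ^^ k) (x - y) = (G p \<tau> ^^ k) x - (G p \<tau> ^^ k) y" for k x y
      by (induction k) (auto intro: order_trans[OF G_contraction(2)[OF p']] simp: linear_diff[OF G_contraction(1)[OF p']])
    have 1: "norm ((F1 p \<tau> ^^ n) f - W (real n * \<tau>) (P f)) < 2 * r"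
    proof -
      have "(F1 p \<tau> ^^ n) f - W (real n * \<tau>) (P f) =
          (G p \<tau> ^^ n) (Pt p f - P f) + ((G p \<tau> ^^ n) (P f) - W (real n * \<tau>) (P f))"
        by (simp only: m F1_funpow[OF p'] Gpow(2)) simp
      then have "norm ((F1 p \<tau> ^^ n) f - W (real n * \<tau>) (P f)) \<le>
          norm ((G p \<tau> ^^ n) (Pt p f - P f)) + norm ((G p \<tau> ^^ n) (P f) - W (real n * \<tau>) (P f))"
        by (simp only: norm_triangle_ineq)
      moreover have "norm ((G p \<tau> ^^ n) (P f) - W (real n * \<tau>) (P f)) \<le> r"
        using p \<tau> n by (intro d1(3)) (auto simp: d_def)
      ultimately show ?thesis using Gpow(1)[of n "Pt p f - P f"] Pf by linarith
    qed
    have 2: "norm ((F2 p \<tau> ^^ n) f - (F1 p \<tau> ^^ n) f) < 3 * r"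
    proof -
      \<comment> \<open>The moving vector \<open>f - Pt p f\<close> is traded for the fixed
        \<open>f - P f\<close>, where strong continuity applies, at the price of two copies of
        \<open>Pt p f - P f\<close>.\<close>
      have "U \<tau> (f - Pt p f) - (f - Pt p f) = (U \<tau> (f - P f) - (f - P f)) + (Pt p f - P f) - U \<tau> (Pt p f - P f)"
        by (simp add: unitary_group_ofD_diff[OF U])
      then have "norm (U \<tau> (f - Pt p f) - (f - Pt p f)) \<le>
          norm (U \<tau> (f - P f) - (f - P f)) + norm (Pt p f - P f) + norm (U \<tau> (Pt p f - P f))"
        by (simp only: norm_add_diff_le)
      moreover have "norm (U \<tau> (f - P f) - (f - P f)) < r" using d3(2)[of \<tau>] \<tau> by (simp add: d_def)
      ultimately have "norm (U \<tau> (f - Pt p f) - (f - Pt p f)) < 3 * r"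
        using Pf unitary_group_ofD(2)[OF U, of \<tau> "Pt p f - P f"] by linarith
      then show ?thesis using F2_funpow_F1[OF p', where \<tau> = \<tau> and n = m and f = f] unfolding m by linarith
    qed
    have 3: "norm ((F3 p \<tau> ^^ n) f - (F1 p \<tau> ^^ n) f) < r"
    proof (rule power2_less_imp_less)
      have nF3: "norm ((F3 p \<tau> ^^ k) f) \<le> norm f" for k
        by (induction k) (auto simp: F3_def unitary_group_ofD(2)[OF U] intro: order_trans[OF PD(8)])
      have "norm (T p ((F3 p \<tau> ^^ m) f)) \<le> C * norm f"
      proof -
        have "norm (T p ((F3 p \<tau> ^^ m) f)) \<le> C * norm ((F3 p \<tau> ^^ m) f)" using p by (intro \<eta>(4)) (simp add: d_def)
        also have "\<dots> \<le> C * norm f" using nF3 \<eta>(3) by (intro mult_left_mono) auto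
        finally show ?thesis .
      qed
      then have "6 * \<bar>\<tau>\<bar> * (norm (T p ((F3 p \<tau> ^^ m) f)))\<^sup>2 \<le> 6 * \<bar>\<tau>\<bar> * (C * norm f)\<^sup>2"
        by (intro mult_left_mono power_mono) auto
      also have "\<dots> \<le> \<bar>\<tau>\<bar> * (6 * (C * norm f)\<^sup>2 + 1)" by (simp add: algebra_simps)
      also have "\<dots> < d4 * (6 * (C * norm f)\<^sup>2 + 1)" using \<tau> q by (intro mult_strict_right_mono) (auto simp: d_def)
      also have "\<dots> = r\<^sup>2" using q by (simp add: d4_def)
      finally show "(norm ((F3 p \<tau> ^^ n) f - (F1 p \<tau> ^^ n) f))\<^sup>2 < r\<^sup>2"
        using F3_funpow_F1[OF p', where \<tau> = \<tau> and n = m and f = f] unfolding m by linarith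
    qed (use r in simp)
    have tri: "norm (a - c) \<le> norm (a - b) + norm (b - c)" for a b c :: 'a
      using norm_triangle_ineq[of "a - b" "b - c"] by simp
    show ?thesis
      using 1 2 3 r tri[of "(F2 p \<tau> ^^ n) f" "W (real n * \<tau>) (P f)" "(F1 p \<tau> ^^ n) f"]
        tri[of "(F3 p \<tau> ^^ n) f" "W (real n * \<tau>) (P f)" "(F1 p \<tau> ^^ n) f"]
      unfolding r_def by linarith
  qed
  then show ?thesis using d0 by blast
qed

text \<open>\<open>q\<close> is the argument of the projections, required only to be
  \<open>O(1/n)\<close> uniformly in \<open>t\<close>; this covers both the fixed and the moving
  choice.\<close>

lemma product_formula_uniform:
  assumes eps: "\<epsilon> \<in> {1, - 1 :: real}"
    and q: "\<And>n t. t \<in> {a..b} \<Longrightarrow> \<bar>q n t\<bar> \<le> L / real n"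
  shows "uniform_limit {a..b} (\<lambda>n t. (F1 (q n t) (\<epsilon> * t / real n) ^^ n) f) (\<lambda>t. W (\<epsilon> * t) (P f)) sequentially"
    "uniform_limit {a..b} (\<lambda>n t. (F2 (q n t) (\<epsilon> * t / real n) ^^ n) f) (\<lambda>t. W (\<epsilon> * t) (P f)) sequentially"
    "uniform_limit {a..b} (\<lambda>n t. (F3 (q n t) (\<epsilon> * t / real n) ^^ n) f) (\<lambda>t. W (\<epsilon> * t) (P f)) sequentially"
proof -
  define M where "M = max \<bar>a\<bar> \<bar>b\<bar>"
  have M: "M \<ge> 0" by (simp add: M_def)
  have tM: "\<bar>\<epsilon> * t\<bar> \<le> M" if "t \<in> {a..b}" for t using that eps by (auto simp: M_def)
  have ev: "\<forall>\<^sub>F n in sequentially. \<forall>t\<in>{a..b}.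
      norm ((F1 (q n t) (\<epsilon> * t / real n) ^^ n) f - W (\<epsilon> * t) (P f)) < e \<and>
      norm ((F2 (q n t) (\<epsilon> * t / real n) ^^ n) f - W (\<epsilon> * t) (P f)) < e \<and>
      norm ((F3 (q n t) (\<epsilon> * t / real n) ^^ n) f - W (\<epsilon> * t) (P f)) < e" if e: "e > 0" for e
  proof -
    obtain d where d: "d > 0" "\<And>p \<tau> n. \<bar>p\<bar> < d \<Longrightarrow> \<bar>\<tau>\<bar> < d \<Longrightarrow> n > 0 \<Longrightarrow> real n * \<bar>\<tau>\<bar> \<le> M \<Longrightarrow>
      norm ((F1 p \<tau> ^^ n) f - W (real n * \<tau>) (P f)) < e \<and>
      norm ((F2 p \<tau> ^^ n) f - W (real n * \<tau>) (P f)) < e \<and>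
      norm ((F3 p \<tau> ^^ n) f - W (real n * \<tau>) (P f)) < e"
      using product_formula[OF e M, of f] by blast
    have small: "\<forall>\<^sub>F n in sequentially. K / real n < d" for K
      using order_tendstoD(2)[OF lim_const_over_n d(1)] by blast
    show ?thesis using small[of L] small[of M] eventually_gt_at_top[of 0]
    proof (eventually_elim, intro ballI)
      fix n t assume n: "L / real n < d" "M / real n < d" "n > 0" and t: "t \<in> {a..b}"
      have "\<bar>q n t\<bar> < d" using q[OF t, of n] n(1) by linarith
      moreover have "\<bar>\<epsilon> * t / real n\<bar> < d"
      proof -
        have "\<bar>\<epsilon> * t / real n\<bar> \<le> M / real n" using tM[OF t] by (simp add: divide_right_mono)
        then show ?thesis using n(2) by linarith
      qed
      moreover have "real n * \<bar>\<epsilon> * t / real n\<bar> \<le> M" using tM[OF t] n(3) by simp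
      ultimately show "norm ((F1 (q n t) (\<epsilon> * t / real n) ^^ n) f - W (\<epsilon> * t) (P f)) < e \<and>
          norm ((F2 (q n t) (\<epsilon> * t / real n) ^^ n) f - W (\<epsilon> * t) (P f)) < e \<and>
          norm ((F3 (q n t) (\<epsilon> * t / real n) ^^ n) f - W (\<epsilon> * t) (P f)) < e"
        using d(2)[of "q n t" "\<epsilon> * t / real n" n] n(3) by simp
    qed
  qed
  show "uniform_limit {a..b} (\<lambda>n t. (F1 (q n t) (\<epsilon> * t / real n) ^^ n) f) (\<lambda>t. W (\<epsilon> * t) (P f)) sequentially"
    "uniform_limit {a..b} (\<lambda>n t. (F2 (q n t) (\<epsilon> * t / real n) ^^ n) f) (\<lambda>t. W (\<epsilon> * t) (P f)) sequentially"
    "uniform_limit {a..b} (\<lambda>n t. (F3 (q n t) (\<epsilon> * t / real n) ^^ n) f) (\<lambda>t. W (\<epsilon> * t) (P f)) sequentially"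
    unfolding uniform_limit_iff dist_norm by (intro allI impI, rule eventually_mono[OF ev], assumption, simp)+
qed

end

theorem theorem2p2:
  fixes H :: "('a::complex_hilbert) set \<times> ('a \<Rightarrow> 'a)"
    and P :: "'a \<Rightarrow> 'a" and Pt :: "real \<Rightarrow> 'a \<Rightarrow> 'a" and \<delta> :: real
  assumes sep: "separable_space (euclidean :: 'a topology)"
    and H_sa: "op_self_adjoint H" and H_nonneg: "op_nonneg H"
    and P_proj: "orth_proj P" and P_fin: "finite_rank P"
    and \<delta>_pos: "\<delta> > 0"
    and Pt_proj: "\<forall>t. \<bar>t\<bar> < \<delta> \<longrightarrow> orth_proj (Pt t) \<and> finite_rank (Pt t)"
    and Pt_cont: "\<forall>f. continuous_on {-\<delta><..<\<delta>} (\<lambda>t. Pt t f)"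
    and Pt_0: "Pt 0 = P"
    and Pt_dom: "\<forall>t. \<bar>t\<bar> < \<delta> \<longrightarrow> form_dom H P \<subseteq> form_dom H (Pt t)"
    and Pt_lim: "\<forall>v\<in>form_dom H P.
       ((\<lambda>t. norm (snd (op_sqrt H) (Pt t v))) \<longlongrightarrow> norm (snd (op_sqrt H) (P v))) (at 0)"
    and dense: "closure (form_dom H P) = UNIV"
  shows
   "(\<forall>f \<epsilon> a b. \<epsilon> \<in> {1, -1} \<and> 0 \<notin> {a..b} \<longrightarrow>
      uniform_limit {a..b}
        (\<lambda>n t. ((Pt (1 / real n) \<circ> expmi H (\<epsilon> * t / real n) \<circ> Pt (1 / real n)) ^^ n) f)
        (\<lambda>t. expmi (op_HP H P) (\<epsilon> * t) (P f)) sequentially \<and>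
      uniform_limit {a..b}
        (\<lambda>n t. ((Pt (1 / real n) \<circ> expmi H (\<epsilon> * t / real n)) ^^ n) f)
        (\<lambda>t. expmi (op_HP H P) (\<epsilon> * t) (P f)) sequentially \<and>
      uniform_limit {a..b}
        (\<lambda>n t. ((expmi H (\<epsilon> * t / real n) \<circ> Pt (1 / real n)) ^^ n) f)
        (\<lambda>t. expmi (op_HP H P) (\<epsilon> * t) (P f)) sequentially) \<and>
    (\<forall>f \<epsilon> a b. \<epsilon> \<in> {1, -1} \<longrightarrow>
      uniform_limit {a..b}
        (\<lambda>n t. ((Pt (t / real n) \<circ> expmi H (\<epsilon> * t / real n) \<circ> Pt (t / real n)) ^^ n) f)
        (\<lambda>t. expmi (op_HP H P) (\<epsilon> * t) (P f)) sequentially \<and>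
      uniform_limit {a..b}
        (\<lambda>n t. ((Pt (t / real n) \<circ> expmi H (\<epsilon> * t / real n)) ^^ n) f)
        (\<lambda>t. expmi (op_HP H P) (\<epsilon> * t) (P f)) sequentially \<and>
      uniform_limit {a..b}
        (\<lambda>n t. ((expmi H (\<epsilon> * t / real n) \<circ> Pt (t / real n)) ^^ n) f)
        (\<lambda>t. expmi (op_HP H P) (\<epsilon> * t) (P f)) sequentially)"
proof -
  interpret zeno_family H P Pt \<delta>
    using assms by unfold_locales auto
  \<comment> \<open>Division by zero gives 0, so both bounds also hold at
    \<open>n = 0\<close>.\<close>
  have b1: "\<bar>1 / real n\<bar> \<le> 1 / real n" for n by simp
  have b2: "\<bar>t / real n\<bar> \<le> max \<bar>a\<bar> \<bar>b\<bar> / real n" if "t \<in> {a..b}" for t a b n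
    using that by (auto intro!: divide_right_mono)
  note fixed = product_formula_uniform[where q = "\<lambda>n t. 1 / real n" and L = 1, OF _ b1,
    unfolded F1_def F2_def F3_def]
  note moving = product_formula_uniform[where q = "\<lambda>n t. t / real n", OF _ b2, unfolded F1_def F2_def F3_def]
  show ?thesis
    by (intro conjI allI impI; (elim conjE)?; (rule fixed, assumption | rule moving, assumption))
qed

end
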